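(* Let $\lambda>0$ and let $\alpha\in\mathcal S(\mathbb R)$ be such that the solution $\mathfrak a^x$ of $(x)_\kappa$ satisfies $\mathfrak a^x(0)>0$. Let $g\in\mathcal S(\mathbb R^+)$ be such that there exists $\kappa_1>0$ for which $(x)_{\kappa_1}$ is in Case C. Then there exists a unique $\bar\kappa>\kappa_1$ such that: (1) $(x)_\kappa$ is in Case A for every $\kappa>\bar\kappa$; (2) $(x)_\kappa$ is in Case B for $\kappa=\bar\kappa$; (3) $(x)_\kappa$ is in Case C for every $0<\kappa<\bar\kappa$.
   Context: Notation: $\mathbb R^+=[0,\infty)$ and $\mathcal S(\Omega)=L^1(\Omega)\cap L^\infty(\Omega)$ for $\Omega\subset\mathbb R$. For $\lambda>0$, $\alpha\in\mathcal S(\mathbb R)$, $g\in\mathcal S(\mathbb R^+)$ and $\kappa>0$ put $h(t;\kappa)=\alpha(t)$ for $t<0$ and $h(t;\kappa)=g(t\kappa)$ for $t\ge 0$, and consider $$(x)_\kappa:\qquad \dot x(t)=\lambda-h(t;\kappa)-x(t)^2 .$$ Solutions are Carathéodory solutions (locally absolutely continuous, equation holding almost everywhere); $t\mapsto x(t,s,x_0)$ is the maximal solution with $x(s,s,x_0)=x_0$. Hyperbolicity: a bounded solution $b:\mathbb R\to\mathbb R$ of $\dot x=f(t,x)$ is hyperbolic if there are $K\ge1,\beta>0$ such that either $\exp(\int_s^t f_x(l,b(l))\,dl)\le Ke^{-\beta(t-s)}$ for all $t\ge s$ (attractive) or $\exp(\int_s^t f_x(l,b(l))\,dl)\le Ke^{\beta(t-s)}$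 for all $t\le s$ (repelling). Known facts and definition of the cases: there is a maximal solution $\mathfrak a^x$ (the pullback attractor), defined on $\mathbb R$ or on a half-line $(-\infty,t_f)$ and bounded above, such that $x(t,s,x_0)$ remains bounded as $t\to-\infty$ if and only if $x_0\le\mathfrak a^x(s)$; and a maximal solution $\mathfrak r^x$, defined on $\mathbb R$ or on a half-line $(t_0,\infty)$ and bounded below, such that $x(t,s,x_0)$ remains bounded as $t\to\infty$ if and only if $x_0\ge\mathfrak r^x(s)$. Exactly one of the following holds. Case A: $\mathfrak a^x,\mathfrak r^x$ are globally defined and hyperbolic, $\mathfrak a^x$ attractive and $\mathfrak r^x$ repelling, with $\lim_{t\to\pm\infty}\mathfrak a^x(t)=\sqrt\lambda$ and $\lim_{t\to\pm\infty}\mathfrak r^x(t)=-\sqrt\lambda$. Case B: there are no hyperbolic solutions, $\mathfrak a^x=\mathfrak r^x$ is the only bounded solution, $\lim_{t\to-\infty}\mathfrak a^x(t)=\sqrt\lambda$ and $\lim_{t\to\infty}\mathfrak a^x(t)=-\sqrt\lambda$. Case C: there are no globally defined solutions, $\mathfrak a^x(t)\to-\infty$ as $t\uparrow t_f<\infty$ and $\mathfrak r^x(t)\to\infty$ as $t\downarrow t_0>-\infty$. The restriction of $\mathfrak a^x$ to $(-\infty,0]$ depends only on $\lambda$ and $\alpha$, not on $g$ or $\kappa$; the hypothesis $\mathfrak a^x(0)>0$ includes that $\mathfrak a^x$ is defined at $0$. *)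

theory Defs
  imports "HOL-Analysis.Analysis"
begin

definition in_S :: "real set \<Rightarrow> (real \<Rightarrow> real) \<Rightarrow> bool" where
  "in_S \<Omega> f \<longleftrightarrow> integrable (lebesgue_on \<Omega>) f \<and> (\<exists>C. AE t in lebesgue_on \<Omega>. \<bar>f t\<bar> \<le> C)"

text \<open>A division is a finite family of non-overlapping nonempty compact intervals, so this
  is the usual epsilon-delta absolute continuity; degenerate intervals contribute zero.\<close>

definition abs_continuous_on :: "real \<Rightarrow> real \<Rightarrow> (real \<Rightarrow> real) \<Rightarrow> bool" where
  "abs_continuous_on a b x \<longleftrightarrow>
     (\<forall>\<epsilon>>0. \<exists>\<delta>>0. \<forall>\<D> T. \<D> division_of T \<and> T \<subseteq> {a..b} \<and> (\<Sum>K\<in>\<D>. Sup K - Inf K) < \<delta>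
        \<longrightarrow> (\<Sum>K\<in>\<D>. \<bar>x (Sup K) - x (Inf K)\<bar>) < \<epsilon>)"

definition locally_abs_continuous_on :: "real set \<Rightarrow> (real \<Rightarrow> real) \<Rightarrow> bool" where
  "locally_abs_continuous_on I x \<longleftrightarrow> (\<forall>a b. a \<le> b \<and> {a..b} \<subseteq> I \<longrightarrow> abs_continuous_on a b x)"

text \<open>A solution is a pair of a total function and its interval of definition \<open>I\<close>; the
  values of the function outside \<open>I\<close> are irrelevant.\<close>

definition solution :: "(real \<Rightarrow> real \<Rightarrow> real) \<Rightarrow> (real \<Rightarrow> real) \<Rightarrow> real set \<Rightarrow> bool" where
  "solution f x I \<longleftrightarrow>
     open I \<and> is_interval I \<and> I \<noteq> {} \<and> locally_abs_continuous_on I x \<and>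
     (AE t\<in>I in lebesgue. (x has_real_derivative f t (x t)) (at t))"

definition maximal_solution :: "(real \<Rightarrow> real \<Rightarrow> real) \<Rightarrow> (real \<Rightarrow> real) \<Rightarrow> real set \<Rightarrow> bool" where
  "maximal_solution f x I \<longleftrightarrow>
     solution f x I \<and> \<not> (\<exists>y J. I \<subset> J \<and> solution f y J \<and> (\<forall>t\<in>I. y t = x t))"

text \<open>Boundedness of the maximal solution through \<open>(s, x0)\<close>, which includes that it is defined near
  minus (plus) infinity. For the equations below that solution is unique on its interval, so the
  existential quantifier just names it.\<close>

definition bounded_at_minus_infinity ::
    "(real \<Rightarrow> real \<Rightarrow> real) \<Rightarrow> real \<Rightarrow> real \<Rightarrow> bool" where
  "bounded_at_minus_infinity f s x0 \<longleftrightarrow>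
     (\<exists>x I. maximal_solution f x I \<and> s \<in> I \<and> x s = x0 \<and> (\<exists>T. {..T} \<subseteq> I \<and> bounded (x ` {..T})))"

definition bounded_at_plus_infinity ::
    "(real \<Rightarrow> real \<Rightarrow> real) \<Rightarrow> real \<Rightarrow> real \<Rightarrow> bool" where
  "bounded_at_plus_infinity f s x0 \<longleftrightarrow>
     (\<exists>x I. maximal_solution f x I \<and> s \<in> I \<and> x s = x0 \<and> (\<exists>T. {T..} \<subseteq> I \<and> bounded (x ` {T..})))"

text \<open>The pullback attractor (upper) and its repelling counterpart (lower): these conditions
  determine the function on its interval, and the interval.\<close>

definition upper_solution ::
    "(real \<Rightarrow> real \<Rightarrow> real) \<Rightarrow> (real \<Rightarrow> real) \<Rightarrow> real set \<Rightarrow> bool" where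
  "upper_solution f a I \<longleftrightarrow>
     maximal_solution f a I \<and> (I = UNIV \<or> (\<exists>tf. I = {..<tf})) \<and> bdd_above (a ` I) \<and>
     (\<forall>s\<in>I. \<forall>x0. bounded_at_minus_infinity f s x0 \<longleftrightarrow> x0 \<le> a s)"

definition lower_solution ::
    "(real \<Rightarrow> real \<Rightarrow> real) \<Rightarrow> (real \<Rightarrow> real) \<Rightarrow> real set \<Rightarrow> bool" where
  "lower_solution f r I \<longleftrightarrow>
     maximal_solution f r I \<and> (I = UNIV \<or> (\<exists>t0. I = {t0<..})) \<and> bdd_below (r ` I) \<and>
     (\<forall>s\<in>I. \<forall>x0. bounded_at_plus_infinity f s x0 \<longleftrightarrow> x0 \<ge> r s)"

definition bounded_solution :: "(real \<Rightarrow> real \<Rightarrow> real) \<Rightarrow> (real \<Rightarrow> real) \<Rightarrow> bool" where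
  "bounded_solution f b \<longleftrightarrow> solution f b UNIV \<and> bounded (range b)"

text \<open>The interval integral is oriented: it changes sign when the endpoints are swapped.\<close>

definition hyperbolic_attractive :: "(real \<Rightarrow> real \<Rightarrow> real) \<Rightarrow> (real \<Rightarrow> real) \<Rightarrow> bool" where
  "hyperbolic_attractive f b \<longleftrightarrow>
     bounded_solution f b \<and>
     (\<exists>K \<beta>. K \<ge> 1 \<and> \<beta> > 0 \<and>
        (\<forall>s t. t \<ge> s \<longrightarrow>
           exp (LINT l=ereal s..ereal t|lebesgue. deriv (f l) (b l)) \<le> K * exp (- \<beta> * (t - s))))"

definition hyperbolic_repelling :: "(real \<Rightarrow> real \<Rightarrow> real) \<Rightarrow> (real \<Rightarrow> real) \<Rightarrow> bool" where
  "hyperbolic_repelling f b \<longleftrightarrow>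
     bounded_solution f b \<and>
     (\<exists>K \<beta>. K \<ge> 1 \<and> \<beta> > 0 \<and>
        (\<forall>s t. t \<le> s \<longrightarrow>
           exp (LINT l=ereal s..ereal t|lebesgue. deriv (f l) (b l)) \<le> K * exp (\<beta> * (t - s))))"

definition hyperbolic :: "(real \<Rightarrow> real \<Rightarrow> real) \<Rightarrow> (real \<Rightarrow> real) \<Rightarrow> bool" where
  "hyperbolic f b \<longleftrightarrow> hyperbolic_attractive f b \<or> hyperbolic_repelling f b"

definition forcing :: "(real \<Rightarrow> real) \<Rightarrow> (real \<Rightarrow> real) \<Rightarrow> real \<Rightarrow> real \<Rightarrow> real" where
  "forcing \<alpha> g \<kappa> t = (if t < 0 then \<alpha> t else g (t * \<kappa>))"

definition rhs ::
    "real \<Rightarrow> (real \<Rightarrow> real) \<Rightarrow> (real \<Rightarrow> real) \<Rightarrow> real \<Rightarrow> real \<Rightarrow> real \<Rightarrow> real" where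
  "rhs lam \<alpha> g \<kappa> t x = lam - forcing \<alpha> g \<kappa> t - x\<^sup>2"

definition case_A ::
    "real \<Rightarrow> (real \<Rightarrow> real) \<Rightarrow> (real \<Rightarrow> real) \<Rightarrow> real \<Rightarrow> bool" where
  "case_A lam \<alpha> g \<kappa> \<longleftrightarrow>
     (\<exists>a r. upper_solution (rhs lam \<alpha> g \<kappa>) a UNIV \<and> lower_solution (rhs lam \<alpha> g \<kappa>) r UNIV \<and>
        hyperbolic_attractive (rhs lam \<alpha> g \<kappa>) a \<and> hyperbolic_repelling (rhs lam \<alpha> g \<kappa>) r \<and>
        (a \<longlongrightarrow> sqrt lam) at_top \<and> (a \<longlongrightarrow> sqrt lam) at_bot \<and>
        (r \<longlongrightarrow> - sqrt lam) at_top \<and> (r \<longlongrightarrow> - sqrt lam) at_bot)"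

definition case_B ::
    "real \<Rightarrow> (real \<Rightarrow> real) \<Rightarrow> (real \<Rightarrow> real) \<Rightarrow> real \<Rightarrow> bool" where
  "case_B lam \<alpha> g \<kappa> \<longleftrightarrow>
     \<not> (\<exists>b. hyperbolic (rhs lam \<alpha> g \<kappa>) b) \<and>
     (\<exists>a. upper_solution (rhs lam \<alpha> g \<kappa>) a UNIV \<and> lower_solution (rhs lam \<alpha> g \<kappa>) a UNIV \<and>
        (\<forall>b. bounded_solution (rhs lam \<alpha> g \<kappa>) b \<longleftrightarrow> b = a) \<and>
        (a \<longlongrightarrow> sqrt lam) at_bot \<and> (a \<longlongrightarrow> - sqrt lam) at_top)"

definition case_C ::
    "real \<Rightarrow> (real \<Rightarrow> real) \<Rightarrow> (real \<Rightarrow> real) \<Rightarrow> real \<Rightarrow> bool" where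
  "case_C lam \<alpha> g \<kappa> \<longleftrightarrow>
     \<not> (\<exists>b. solution (rhs lam \<alpha> g \<kappa>) b UNIV) \<and>
     (\<exists>a tf. upper_solution (rhs lam \<alpha> g \<kappa>) a {..<tf} \<and> filterlim a at_bot (at_left tf)) \<and>
     (\<exists>r t0. lower_solution (rhs lam \<alpha> g \<kappa>) r {t0<..} \<and> filterlim r at_top (at_right t0))"

end

theory Submission imports Defs begin

text \<open>Put \<open>H(t) = \<integral>\<^sub>t\<^sup>\<infinity> h\<close>, where \<open>h\<close> is the forcing term. A function \<open>x\<close> is a Caratheodory solution of
\<open>x' = lam - h - x\<^sup>2\<close> exactly when \<open>x - H\<close> is differentiable everywhere with derivative
\<open>lam - x\<^sup>2\<close> (\<open>solution_riccati_iff\<close>). Lebesgue differentiation, and the fact that an absolutely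
continuous function with derivative zero almost everywhere is constant, enter only here; the rest
of the argument uses classical derivatives and the continuity, boundedness and decay of \<open>H\<close>.

The substitution \<open>x = w / u + H\<close> linearizes the equation into a planar system with bounded
continuous coefficients. Solutions therefore exist as long as \<open>u > 0\<close>, and the maximal ones tend to
minus infinity at a finite right end and to plus infinity at a finite left end
(\<open>solution_through_exists\<close>, \<open>maximal_solution_iff\<close>). As \<open>H\<close> decays, a solution that survives to plus
infinity converges to \<open>sqrt lam\<close> or to \<open>- sqrt lam\<close> (\<open>forward_dichotomy\<close>). Exactly one solution \<open>r\<close>
converges to \<open>- sqrt lam\<close>; it is the lower solution, and every solution above it converges to
\<open>sqrt lam\<close>. Reversing time and changing the sign of \<open>x\<close> yields the upper solution \<open>a\<close>. Since \<open>a\<close>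
restricted to the negative half-line does not see the rate, its value \<open>a 0\<close> is common to all rates,
and the case is decided by the solutions on the positive half-line: Case A if some solution starting
below \<open>a 0\<close> survives, Case B if only those starting at or above \<open>a 0\<close> do, Case C if the one
starting at \<open>a 0\<close> does not (\<open>hyperbolic_case\<close>, \<open>nonhyperbolic_case\<close>, \<open>escape_case\<close>).

The dependence on the rate becomes monotone after rescaling: \<open>y(s) = \<kappa> x(s / \<kappa>)\<close> solves
\<open>y' = lam - g(s) - y\<^sup>2 / \<kappa>\<^sup>2\<close> with \<open>y(0) = \<kappa> x(0)\<close>. Increasing \<open>\<kappa>\<close> raises the right-hand side and,
because \<open>a 0 > 0\<close>, also the initial value \<open>\<kappa> a 0\<close>. Hence survival from \<open>a 0\<close> at one rate forces Case A
at every larger rate (\<open>persists_increase_rate\<close>), and large rates do survive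
(\<open>persists_large_rate\<close>). Sub- and supersolutions of the form \<open>y \<plusminus> \<eta> exp (L s)\<close> show that Case C is
open under increasing the rate and Case A under decreasing it. The supremum of the Case C rates
thus belongs to neither case, so it is the unique rate in Case B.\<close>

section \<open>Absolutely continuous functions and Lebesgue differentiation\<close>

text \<open>Distinct tagged pairs can share only a degenerate interval, so a sum over a tagged division agrees
with the sum over its intervals as soon as single points contribute zero.\<close>

lemma tagged_subdivision_interval_sum:
  fixes d :: "real set \<Rightarrow> real"
  assumes p: "p tagged_partial_division_of {a..b}" and z: "\<And>u. d {u} = 0"
  shows "(\<Sum>(x,K)\<in>p. d K) = (\<Sum>K\<in>snd ` p. d K)"
proof -
  let ?d = "\<lambda>K. if K = {} then 0 else d K"
  have ne: "K \<noteq> {}" if "(x,K) \<in> p" for x K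
    using p that by (auto simp: tagged_partial_division_of_def)
  have t: "p tagged_division_of \<Union> (snd ` p)"
    using p by (rule tagged_partial_division_of_Union_self)
  have "(\<Sum>(x,K)\<in>p. d K) = (\<Sum>(x,K)\<in>p. ?d K)"
    by (rule sum.cong) (use ne in auto)
  also have "\<dots> = (\<Sum>K\<in>snd ` p. ?d K)"
  proof (rule sum.over_tagged_division_lemma[OF t])
    fix u v :: real assume "box u v = {}"
    then have "u \<ge> v" by (simp add: box_real not_less)
    then show "?d (cbox u v) = 0" using z by (cases "u = v") auto
  qed
  also have "\<dots> = (\<Sum>K\<in>snd ` p. d K)"
    by (rule sum.cong) (use ne in auto)
  finally show ?thesis .
qed

text \<open>The proof takes a division fine for a gauge that is small around points with derivative zero and
stays, at the exceptional points, inside an open set of small measure; there absolute continuity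
bounds the increments.\<close>

lemma abs_continuous_zero_derivative_imp_eq:
  fixes f :: "real \<Rightarrow> real"
  assumes ab: "a \<le> b" and ac: "abs_continuous_on a b f" and N: "negligible N"
    and der: "\<And>t. t \<in> {a..b} - N \<Longrightarrow> (f has_real_derivative 0) (at t)"
  shows "f b = f a"
proof -
  have "\<bar>f b - f a\<bar> \<le> \<epsilon>" if "\<epsilon> > 0" for \<epsilon>
  proof -
    obtain \<delta> where \<delta>: "\<delta> > 0" and ac': "\<And>\<D> T. \<D> division_of T \<Longrightarrow> T \<subseteq> {a..b} \<Longrightarrow>
        (\<Sum>K\<in>\<D>. Sup K - Inf K) < \<delta> \<Longrightarrow> (\<Sum>K\<in>\<D>. \<bar>f (Sup K) - f (Inf K)\<bar>) < \<epsilon> / 2"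
      using ac \<open>\<epsilon> > 0\<close> unfolding abs_continuous_on_def by (meson half_gt_zero)
    have Nn: "N \<in> null_sets lebesgue" using N by (simp add: negligible_iff_null_sets)
    then have Ns: "N \<in> sets lebesgue" by auto
    obtain G where G: "open G" "N \<subseteq> G" "G - N \<in> lmeasurable" "emeasure lebesgue (G - N) < ennreal \<delta>"
      using sets_lebesgue_outer_open[OF Ns \<delta>] by blast
    have "emeasure lebesgue G = emeasure lebesgue ((G - N) \<union> N)"
      using G(2) by (simp add: Un_absorb2)
    also have "\<dots> = emeasure lebesgue (G - N)"
      using Nn G(3) by (intro emeasure_Un_null_set) auto
    finally have Gm: "emeasure lebesgue G < ennreal \<delta>" using G(4) by simp
    define e where "e = \<epsilon> / (2 * (b - a + 1))"
    have e: "e > 0" using \<open>\<epsilon> > 0\<close> ab by (auto simp: e_def)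
    have "\<exists>d>0. t \<in> {a..b} - N \<longrightarrow> (\<forall>s. \<bar>s - t\<bar> < d \<longrightarrow> \<bar>f s - f t\<bar> \<le> e * \<bar>s - t\<bar>)" for t
    proof (cases "t \<in> {a..b} - N")
      case True
      have "(f has_derivative (\<lambda>h. 0)) (at t)"
        using der[OF True] by (simp add: has_field_derivative_def lambda_zero)
      then show ?thesis using e unfolding has_derivative_at_alt by auto
    qed (auto intro: exI[of _ 1])
    then obtain d where d: "\<And>t. d t > 0"
      "\<And>t s. t \<in> {a..b} - N \<Longrightarrow> \<bar>s - t\<bar> < d t \<Longrightarrow> \<bar>f s - f t\<bar> \<le> e * \<bar>s - t\<bar>"
      by metis
    define \<gamma> where "\<gamma> t = (if t \<in> N then G else ball t (d t))" for t
    have "gauge \<gamma>" using G d(1) by (auto simp: gauge_def \<gamma>_def)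
    then obtain p where p: "p tagged_division_of {a..b}" "\<gamma> fine p"
      by (rule fine_division_exists_real)
    define p1 where "p1 = {(x,K) \<in> p. x \<in> N}"
    have finp: "finite p" using p(1) by auto
    have p1p: "p1 \<subseteq> p" by (auto simp: p1_def)
    have pp: "p tagged_partial_division_of {a..b}" using p(1) by (simp add: tagged_division_of_def)
    then have pp1: "p1 tagged_partial_division_of {a..b}" using p1p by (rule tagged_partial_division_subset)
    have K: "\<exists>u v. K = {u..v} \<and> u \<le> x \<and> x \<le> v \<and> a \<le> u \<and> v \<le> b \<and> K \<subseteq> \<gamma> x" if xK: "(x,K) \<in> p" for x K
    proof -
      obtain u v where "K = cbox u v" using p(1) xK by blast
      moreover have "x \<in> K" "K \<subseteq> {a..b}" using p(1) xK by blast+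
      moreover have "K \<subseteq> \<gamma> x" using p(2) xK by (auto simp: fine_def)
      ultimately show ?thesis by auto
    qed
    let ?D = "\<lambda>K. \<bar>f (Sup K) - f (Inf K)\<bar>"
    have "\<bar>f b - f a\<bar> = \<bar>\<Sum>(x,K)\<in>p. f (Sup K) - f (Inf K)\<bar>"
      by (simp add: additive_tagged_division_1[OF ab p(1)])
    also have "\<dots> \<le> (\<Sum>(x,K)\<in>p. ?D K)"
      by (rule order_trans[OF sum_abs]) (simp add: case_prod_unfold)
    also have "\<dots> = (\<Sum>(x,K)\<in>p1. ?D K) + (\<Sum>(x,K)\<in>p - p1. ?D K)"
      using finp p1p by (simp add: sum.subset_diff)
    also have "(\<Sum>(x,K)\<in>p - p1. ?D K) \<le> (\<Sum>(x,K)\<in>p - p1. e * measure lborel K)"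
    proof (rule sum_mono, clarify)
      fix x K assume xK: "(x,K) \<in> p" "(x,K) \<notin> p1"
      obtain u v where uv: "K = {u..v}" "u \<le> x" "x \<le> v" "a \<le> u" "v \<le> b" "K \<subseteq> \<gamma> x"
        using K[OF xK(1)] by blast
      have xN: "x \<in> {a..b} - N" using xK uv by (auto simp: p1_def)
      have "u \<in> K" "v \<in> K" using uv by auto
      moreover have "K \<subseteq> ball x (d x)" using uv xN by (simp add: \<gamma>_def)
      ultimately have "u \<in> ball x (d x)" "v \<in> ball x (d x)" by blast+
      then have "\<bar>f u - f x\<bar> \<le> e * \<bar>u - x\<bar>" "\<bar>f v - f x\<bar> \<le> e * \<bar>v - x\<bar>"
        using d(2)[OF xN] by (auto simp: dist_real_def abs_minus_commute)
      then have "\<bar>f v - f u\<bar> \<le> e * (v - u)"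
        using uv by (simp add: algebra_simps)
      then show "?D K \<le> e * measure lborel K" using uv by simp
    qed
    also have "\<dots> \<le> (\<Sum>(x,K)\<in>p. e * measure lborel K)"
      by (rule sum_mono2) (use finp e in \<open>auto simp: case_prod_unfold\<close>)
    also have "\<dots> = e * (\<Sum>(x,K)\<in>p. measure lborel K)"
      by (simp add: sum_distrib_left case_prod_unfold)
    also have "\<dots> = e * (b - a)"
      using additive_content_tagged_division[of p a b] p(1) ab by simp
    also have "\<dots> \<le> \<epsilon> / 2"
      using \<open>\<epsilon> > 0\<close> ab by (simp add: e_def field_simps)
    also have "(\<Sum>(x,K)\<in>p1. ?D K) = (\<Sum>K\<in>snd ` p1. ?D K)"
      by (rule tagged_subdivision_interval_sum[OF pp1]) auto
    also have "\<dots> < \<epsilon> / 2"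
    proof (rule ac')
      show dv: "snd ` p1 division_of \<Union> (snd ` p1)"
        using pp1 by (rule partial_division_of_tagged_division)
      show "\<Union> (snd ` p1) \<subseteq> {a..b}" using K p1p by fastforce
      have sub: "\<Union> (snd ` p1) \<subseteq> G"
        using K by (fastforce simp: p1_def \<gamma>_def)
      have fin1: "finite p1" using finp p1p finite_subset by blast
      have cl: "closed (\<Union> (snd ` p1))" using fin1 K p1p by (fastforce intro!: closed_Union)
      have "(\<Sum>K\<in>snd ` p1. Sup K - Inf K) = (\<Sum>K\<in>snd ` p1. measure lebesgue K)"
        by (rule sum.cong) (use K p1p in fastforce)+
      also have "\<dots> = measure lebesgue (\<Union> (snd ` p1))" by (rule content_division[OF dv])
      also have "\<dots> \<le> measure lebesgue G"
        using sub cl G(1) Gm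
        by (intro measure_mono_fmeasurable) (auto simp: fmeasurable_def intro: order_less_trans)
      also have "\<dots> < \<delta>"
        unfolding measure_def using Gm by (subst enn2real_less_iff) (auto intro: order_less_trans)
      finally show "(\<Sum>K\<in>snd ` p1. Sup K - Inf K) < \<delta>" .
    qed
    finally show ?thesis by simp
  qed
  then have "\<bar>f b - f a\<bar> \<le> 0" by (rule field_le_epsilon) simp
  then show ?thesis by simp
qed

text \<open>A point at which the difference quotient deviates from \<open>f\<close> by more than \<open>1 / (n + 1)\<close> at
arbitrarily small distances is an endpoint of arbitrarily short bad intervals. A disjoint Vitali subfamily of them is a fine
tagged partial division, whose total length the Henstock lemma makes arbitrarily small.\<close>

theorem lebesgue_differentiation:
  fixes f :: "real \<Rightarrow> real"
  assumes f: "f integrable_on {a..b}"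
  shows "negligible {t \<in> {a<..<b}. \<not> ((\<lambda>u. integral {a..u} f) has_real_derivative f t) (at t)}"
proof -
  define F where "F u = integral {a..u} f" for u
  define B where "B n = {t \<in> {a<..<b}. \<forall>d>0. \<exists>u. u \<noteq> t \<and> \<bar>u - t\<bar> < d \<and>
      \<bar>u - t\<bar> < real (Suc n) * \<bar>F u - F t - f t * (u - t)\<bar>}" for n
  have F_diff: "F v - F u = integral {u..v} f" if "a \<le> u" "u \<le> v" "v \<le> b" for u v
  proof -
    have "f integrable_on {a..v}" by (rule integrable_subinterval_real[OF f]) (use that in auto)
    from Henstock_Kurzweil_Integration.integral_combine[OF that(1,2) this] show ?thesis unfolding F_def by simp
  qed
  have neg: "negligible (B n)" for n
  proof -
    have "\<exists>T. B n \<subseteq> T \<and> T \<in> lmeasurable \<and> measure lebesgue T \<le> \<epsilon>" if "\<epsilon> > 0" for \<epsilon>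
    proof -
      have e: "\<epsilon> / real (Suc n) > 0" using that by simp
      have "f integrable_on cbox a b" using f by simp
      from Henstock_lemma[OF this e] obtain \<gamma> where \<gamma>: "gauge \<gamma>" and hen:
        "\<And>p. \<lbrakk>p tagged_partial_division_of cbox a b; \<gamma> fine p\<rbrakk> \<Longrightarrow>
           (\<Sum>(x,K)\<in>p. norm (measure lborel K *\<^sub>R f x - integral K f)) < \<epsilon> / real (Suc n)"
        by blast
      define c where "c i = (fst i + snd i) / 2" for i :: "real \<times> real"
      define r where "r i = \<bar>snd i - fst i\<bar> / 2" for i :: "real \<times> real"
      have cb: "cball (c i) (r i) = {min (fst i) (snd i)..max (fst i) (snd i)}" for i
        by (auto simp: c_def r_def cball_eq_atLeastAtMost min_def max_def abs_if field_simps)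
      define A where "A = {i. snd i \<noteq> fst i \<and> cball (c i) (r i) \<subseteq> \<gamma> (fst i) \<and> cball (c i) (r i) \<subseteq> {a..b} \<and>
         \<bar>snd i - fst i\<bar> < real (Suc n) * \<bar>F (snd i) - F (fst i) - f (fst i) * (snd i - fst i)\<bar>}"
      obtain C where C: "countable C" "C \<subseteq> A"
        "pairwise (\<lambda>i j. disjnt (cball (c i) (r i)) (cball (c j) (r j))) C"
        "negligible (B n - (\<Union>i \<in> C. cball (c i) (r i)))"
      proof (rule Vitali_covering_theorem_cballs[of A r "B n" c])
        show "0 < r i" if "i \<in> A" for i using that by (auto simp: A_def r_def)
        show "\<exists>i. i \<in> A \<and> t \<in> cball (c i) (r i) \<and> r i < d" if t: "t \<in> B n" and "d > 0" for t d
        proof -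
          have "open (\<gamma> t \<inter> {a<..<b})" "t \<in> \<gamma> t \<inter> {a<..<b}"
            using \<gamma> t by (auto simp: gauge_def B_def)
          then obtain \<rho> where \<rho>: "\<rho> > 0" "ball t \<rho> \<subseteq> \<gamma> t \<inter> {a<..<b}"
            by (meson openE)
          have "min \<rho> d > 0" using \<rho> \<open>d > 0\<close> by simp
          then obtain u where u: "u \<noteq> t" "\<bar>u - t\<bar> < min \<rho> d"
              "\<bar>u - t\<bar> < real (Suc n) * \<bar>F u - F t - f t * (u - t)\<bar>"
            using t unfolding B_def by blast
          have "cball (c (t,u)) (r (t,u)) \<subseteq> ball t \<rho>"
            unfolding cb using u by (auto simp: dist_real_def)
          then have "cball (c (t,u)) (r (t,u)) \<subseteq> \<gamma> t \<inter> {a<..<b}" using \<rho> by blast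
          then have "cball (c (t,u)) (r (t,u)) \<subseteq> \<gamma> t" "cball (c (t,u)) (r (t,u)) \<subseteq> {a..b}" by fastforce+
          then have "(t,u) \<in> A" using u unfolding A_def by simp
          moreover have "t \<in> cball (c (t,u)) (r (t,u))" unfolding cb by simp
          moreover have "\<bar>u - t\<bar> < d" using u by simp
          then have "r (t,u) < d" using \<open>d > 0\<close> unfolding r_def by simp
          ultimately show ?thesis by blast
        qed
      qed
      let ?U = "\<Union>i \<in> C. cball (c i) (r i)"
      have bound: "measure lebesgue (\<Union>i\<in>J. cball (c i) (r i)) \<le> \<epsilon>" if J: "J \<subseteq> C" "finite J" for J
      proof -
        define p where "p = (\<lambda>i. (fst i, cball (c i) (r i))) ` J"
        have JA: "i \<in> A" if "i \<in> J" for i using J C that by blast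
        have mem: "fst i \<in> cball (c i) (r i)" for i unfolding cb by simp
        have disj: "disjnt (cball (c i) (r i)) (cball (c j) (r j))" if "i \<in> J" "j \<in> J" "i \<noteq> j" for i j
          using C(3) J that by (auto simp: pairwise_def)
        have inj: "inj_on (\<lambda>i. (fst i, cball (c i) (r i))) J"
        proof (rule inj_onI, rule ccontr)
          fix i j assume ij: "i \<in> J" "j \<in> J" "i \<noteq> j"
            "(fst i, cball (c i) (r i)) = (fst j, cball (c j) (r j))"
          then show False using disj[OF ij(1-3)] mem[of i] by (auto simp: disjnt_def)
        qed
        have "p tagged_partial_division_of cbox a b"
          unfolding tagged_partial_division_of_def
        proof (intro conjI allI impI)
          show "finite p" using J by (simp add: p_def)
          fix x K assume xK: "(x,K) \<in> p"
          then obtain i where i: "i \<in> J" "x = fst i" "K = cball (c i) (r i)" by (auto simp: p_def)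
          show "x \<in> K" using i mem by simp
          show "K \<subseteq> cbox a b" using JA[OF i(1)] i by (auto simp: A_def)
          show "\<exists>a b. K = cbox a b" unfolding i cb by (metis box_real(2))
        next
          fix x K x' K' assume xK': "(x,K) \<in> p \<and> (x',K') \<in> p \<and> (x, K) \<noteq> (x', K')"
          then obtain i where i: "i \<in> J" "x = fst i" "K = cball (c i) (r i)" by (auto simp: p_def)
          from xK' obtain j where j: "j \<in> J" "x' = fst j" "K' = cball (c j) (r j)" by (auto simp: p_def)
          then have "i \<noteq> j" using i xK' by blast
          then have "K \<inter> K' = {}" using disj i j by (auto simp: disjnt_def)
          then show "interior K \<inter> interior K' = {}" using interior_subset by blast
        qed
        moreover have "\<gamma> fine p"
          using JA by (auto simp: fine_def p_def A_def)
        ultimately have "(\<Sum>(x,K)\<in>p. norm (measure lborel K *\<^sub>R f x - integral K f)) < \<epsilon> / real (Suc n)"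
          by (rule hen)
        also have "(\<Sum>(x,K)\<in>p. norm (measure lborel K *\<^sub>R f x - integral K f))
           = (\<Sum>i\<in>J. \<bar>F (snd i) - F (fst i) - f (fst i) * (snd i - fst i)\<bar>)"
          unfolding p_def
        proof (subst sum.reindex[OF inj], rule sum.cong)
          fix i assume i: "i \<in> J"
          have sub: "{min (fst i) (snd i)..max (fst i) (snd i)} \<subseteq> {a..b}"
            using JA[OF i] unfolding A_def cb by simp
          show "((\<lambda>(x,K). norm (measure lborel K *\<^sub>R f x - integral K f)) \<circ> (\<lambda>i. (fst i, cball (c i) (r i)))) i
              = \<bar>F (snd i) - F (fst i) - f (fst i) * (snd i - fst i)\<bar>"
          proof (cases "fst i \<le> snd i")
            case True
            then show ?thesis using sub F_diff[of "fst i" "snd i"]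
              by (simp add: cb algebra_simps abs_minus_commute)
          next
            case False
            then show ?thesis using sub F_diff[of "snd i" "fst i"]
              by (simp add: cb algebra_simps)
          qed
        qed simp
        finally have S: "real (Suc n) * (\<Sum>i\<in>J. \<bar>F (snd i) - F (fst i) - f (fst i) * (snd i - fst i)\<bar>) \<le> \<epsilon>"
          by (simp add: field_simps)
        have "measure lebesgue (\<Union>i\<in>J. cball (c i) (r i)) \<le> (\<Sum>i\<in>J. measure lebesgue (cball (c i) (r i)))"
          by (rule measure_UNION_le) (use J in auto)
        also have "\<dots> \<le> (\<Sum>i\<in>J. real (Suc n) * \<bar>F (snd i) - F (fst i) - f (fst i) * (snd i - fst i)\<bar>)"
        proof (rule sum_mono)
          fix i assume i: "i \<in> J"
          have "measure lebesgue (cball (c i) (r i)) = \<bar>snd i - fst i\<bar>" unfolding cb by auto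
          then show "measure lebesgue (cball (c i) (r i)) \<le> real (Suc n) * \<bar>F (snd i) - F (fst i) - f (fst i) * (snd i - fst i)\<bar>"
            using JA[OF i] by (simp add: A_def)
        qed
        also have "\<dots> \<le> \<epsilon>" using S by (simp add: sum_distrib_left)
        finally show ?thesis .
      qed
      have U: "?U \<in> lmeasurable" "measure lebesgue ?U \<le> \<epsilon>"
        using fmeasurable_UN_bound[OF C(1) _ bound] measure_UN_bound[OF C(1) _ bound] by auto
      let ?N = "B n - ?U"
      have N: "?N \<in> null_sets lebesgue" using C(4) by (simp add: negligible_iff_null_sets)
      have "?U \<union> ?N \<in> lmeasurable"
        by (rule fmeasurable.Un[OF U(1) fmeasurableI_null_sets[OF N]])
      moreover have "measure lebesgue (?U \<union> ?N) \<le> \<epsilon>"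
        using U N measure_Un_null_set[of ?U lebesgue ?N] by (simp add: fmeasurableD)
      moreover have "B n \<subseteq> ?U \<union> ?N" by blast
      ultimately show ?thesis by blast
    qed
    then show ?thesis unfolding negligible_outer_le by blast
  qed
  have "{t \<in> {a<..<b}. \<not> (F has_real_derivative f t) (at t)} \<subseteq> (\<Union>n. B n)"
  proof (rule subsetI, rule ccontr)
    fix t assume t: "t \<in> {t \<in> {a<..<b}. \<not> (F has_real_derivative f t) (at t)}" and n: "t \<notin> (\<Union>n. B n)"
    have "(F has_real_derivative f t) (at t)"
      unfolding has_field_derivative_def has_derivative_at_alt
    proof (intro conjI allI impI)
      show "bounded_linear ((*) (f t))" by (rule bounded_linear_mult_right)
      fix e :: real assume "e > 0"
      then obtain m where m: "inverse (real (Suc m)) < e" using reals_Archimedean by blast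
      have "t \<notin> B m" "t \<in> {a<..<b}" using n t by auto
      then obtain d where d: "d > 0"
        "\<And>u. u \<noteq> t \<Longrightarrow> \<bar>u - t\<bar> < d \<Longrightarrow> real (Suc m) * \<bar>F u - F t - f t * (u - t)\<bar> \<le> \<bar>u - t\<bar>"
        unfolding B_def by force
      have "norm (F u - F t - f t * (u - t)) \<le> e * norm (u - t)" if u: "norm (u - t) < d" for u
      proof (cases "u = t")
        case False
        have "\<bar>F u - F t - f t * (u - t)\<bar> \<le> inverse (real (Suc m)) * \<bar>u - t\<bar>"
          using d(2)[OF False] u by (simp add: field_simps)
        also have "\<dots> \<le> e * \<bar>u - t\<bar>" using m by (intro mult_right_mono) auto
        finally show ?thesis by simp
      qed simp
      then show "\<exists>d>0. \<forall>y. norm (y - t) < d \<longrightarrow> norm (F y - F t - f t * (y - t)) \<le> e * norm (y - t)"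
        using d(1) by blast
    qed
    then show False using t by simp
  qed
  moreover have "negligible (\<Union>n. B n)" using neg by (intro negligible_countable_Union) auto
  ultimately show ?thesis unfolding F_def using negligible_subset by blast
qed

lemma abs_continuous_on_lipschitz:
  assumes L: "\<And>u v. u \<in> {a..b} \<Longrightarrow> v \<in> {a..b} \<Longrightarrow> \<bar>x u - x v\<bar> \<le> L * \<bar>u - v\<bar>"
  shows "abs_continuous_on a b x"
  unfolding abs_continuous_on_def
proof (intro allI impI)
  fix \<epsilon> :: real assume \<epsilon>: "\<epsilon> > 0"
  show "\<exists>\<delta>>0. \<forall>\<D> T. \<D> division_of T \<and> T \<subseteq> {a..b} \<and> (\<Sum>K\<in>\<D>. Sup K - Inf K) < \<delta>
        \<longrightarrow> (\<Sum>K\<in>\<D>. \<bar>x (Sup K) - x (Inf K)\<bar>) < \<epsilon>"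
  proof (intro exI conjI allI impI)
    show "\<epsilon> / (\<bar>L\<bar> + 1) > 0" using \<epsilon> by simp
    fix \<D> T assume D: "\<D> division_of T \<and> T \<subseteq> {a..b} \<and> (\<Sum>K\<in>\<D>. Sup K - Inf K) < \<epsilon> / (\<bar>L\<bar> + 1)"
    have "(\<Sum>K\<in>\<D>. \<bar>x (Sup K) - x (Inf K)\<bar>) \<le> (\<Sum>K\<in>\<D>. (\<bar>L\<bar> + 1) * (Sup K - Inf K))"
    proof (rule sum_mono)
      fix K assume K: "K \<in> \<D>"
      obtain u v where uv: "K = {u..v}" "K \<noteq> {}" "K \<subseteq> T"
        using D K by (metis division_ofD(2-4) box_real(2))
      then have "u \<le> v" by auto
      have "{u..v} \<subseteq> {a..b}" using uv D by blast
      then have "u \<in> {a..b}" "v \<in> {a..b}" using \<open>u \<le> v\<close> by auto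
      then have "\<bar>x v - x u\<bar> \<le> L * \<bar>v - u\<bar>" by (intro L) auto
      also have "\<dots> \<le> (\<bar>L\<bar> + 1) * (v - u)" using \<open>u \<le> v\<close> by (intro mult_mono) auto
      finally show "\<bar>x (Sup K) - x (Inf K)\<bar> \<le> (\<bar>L\<bar> + 1) * (Sup K - Inf K)"
        using uv \<open>u \<le> v\<close> by simp
    qed
    also have "\<dots> = (\<bar>L\<bar> + 1) * (\<Sum>K\<in>\<D>. Sup K - Inf K)" by (simp add: sum_distrib_left)
    also have "\<dots> < \<epsilon>" using D by (simp add: field_simps add_pos_nonneg)
    finally show "(\<Sum>K\<in>\<D>. \<bar>x (Sup K) - x (Inf K)\<bar>) < \<epsilon>" .
  qed
qed

lemma abs_continuous_on_diff:
  assumes "abs_continuous_on a b x" "abs_continuous_on a b y"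
  shows "abs_continuous_on a b (\<lambda>t. x t - y t)"
  unfolding abs_continuous_on_def
proof (intro allI impI)
  fix \<epsilon> :: real assume \<epsilon>: "\<epsilon> > 0"
  obtain d1 where d1: "d1 > 0" "\<And>\<D> T. \<D> division_of T \<Longrightarrow> T \<subseteq> {a..b} \<Longrightarrow> (\<Sum>K\<in>\<D>. Sup K - Inf K) < d1
        \<Longrightarrow> (\<Sum>K\<in>\<D>. \<bar>x (Sup K) - x (Inf K)\<bar>) < \<epsilon> / 2"
    using assms(1) \<epsilon> unfolding abs_continuous_on_def by (meson half_gt_zero)
  obtain d2 where d2: "d2 > 0" "\<And>\<D> T. \<D> division_of T \<Longrightarrow> T \<subseteq> {a..b} \<Longrightarrow> (\<Sum>K\<in>\<D>. Sup K - Inf K) < d2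
        \<Longrightarrow> (\<Sum>K\<in>\<D>. \<bar>y (Sup K) - y (Inf K)\<bar>) < \<epsilon> / 2"
    using assms(2) \<epsilon> unfolding abs_continuous_on_def by (meson half_gt_zero)
  show "\<exists>\<delta>>0. \<forall>\<D> T. \<D> division_of T \<and> T \<subseteq> {a..b} \<and> (\<Sum>K\<in>\<D>. Sup K - Inf K) < \<delta>
        \<longrightarrow> (\<Sum>K\<in>\<D>. \<bar>x (Sup K) - y (Sup K) - (x (Inf K) - y (Inf K))\<bar>) < \<epsilon>"
  proof (intro exI conjI allI impI)
    show "min d1 d2 > 0" using d1 d2 by simp
    fix \<D> T assume D: "\<D> division_of T \<and> T \<subseteq> {a..b} \<and> (\<Sum>K\<in>\<D>. Sup K - Inf K) < min d1 d2"
    have "(\<Sum>K\<in>\<D>. \<bar>x (Sup K) - y (Sup K) - (x (Inf K) - y (Inf K))\<bar>)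
      \<le> (\<Sum>K\<in>\<D>. \<bar>x (Sup K) - x (Inf K)\<bar> + \<bar>y (Sup K) - y (Inf K)\<bar>)"
      by (rule sum_mono) linarith
    also have "\<dots> < \<epsilon>"
      using d1(2)[of \<D> T] d2(2)[of \<D> T] D by (simp add: sum.distrib)
    finally show "(\<Sum>K\<in>\<D>. \<bar>x (Sup K) - y (Sup K) - (x (Inf K) - y (Inf K))\<bar>) < \<epsilon>" .
  qed
qed

lemma abs_continuous_on_imp_continuous_on:
  assumes "abs_continuous_on a b x"
  shows "continuous_on {a..b} x"
  unfolding continuous_on_iff
proof (intro ballI allI impI)
  fix t \<epsilon> :: real assume t: "t \<in> {a..b}" and \<epsilon>: "\<epsilon> > 0"
  obtain d where d: "d > 0" "\<And>\<D> T. \<D> division_of T \<Longrightarrow> T \<subseteq> {a..b} \<Longrightarrow> (\<Sum>K\<in>\<D>. Sup K - Inf K) < d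
        \<Longrightarrow> (\<Sum>K\<in>\<D>. \<bar>x (Sup K) - x (Inf K)\<bar>) < \<epsilon>"
    using assms \<epsilon> unfolding abs_continuous_on_def by meson
  have step: "\<bar>x v - x u\<bar> < \<epsilon>" if "u \<in> {a..b}" "v \<in> {a..b}" "u \<le> v" "v - u < d" for u v
    using d(2)[of "{{u..v}}" "{u..v}"] that division_of_self[of u v] by auto
  then have "\<bar>x s - x t\<bar> < \<epsilon>" if "s \<in> {a..b}" "\<bar>s - t\<bar> < d" for s
    using that t step[of s t] step[of t s] by (cases "s \<le> t") (auto simp: abs_minus_commute)
  then show "\<exists>d>0. \<forall>s\<in>{a..b}. dist s t < d \<longrightarrow> dist (x s) (x t) < \<epsilon>"
    using d(1) by (auto simp: dist_real_def)
qed

lemma continuous_on_Icc_bounded: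
  fixes q :: "real \<Rightarrow> real"
  assumes "continuous_on {a..b} q"
  obtains B where "\<And>s. s \<in> {a..b} \<Longrightarrow> \<bar>q s\<bar> \<le> B"
proof -
  have "bounded (q ` {a..b})"
    using assms by (intro compact_imp_bounded compact_continuous_image) auto
  then obtain B where "\<forall>y\<in>q ` {a..b}. norm y \<le> B" unfolding bounded_iff by blast
  then show thesis by (intro that[of B]) auto
qed

section \<open>Caratheodory solutions as classical solutions of a shifted equation\<close>

text \<open>The right-hand side \<open>lam - h(t) - x\<^sup>2\<close> for a general forcing term \<open>h\<close>.\<close>

definition riccati :: "real \<Rightarrow> (real \<Rightarrow> real) \<Rightarrow> real \<Rightarrow> real \<Rightarrow> real" where
  "riccati lam h t x = lam - h t - x\<^sup>2"

text \<open>The tail integral \<open>\<integral>\<^sub>t\<^sup>\<infinity> h\<close>, taken in the Henstock-Kurzweil sense; for the integrable functions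
considered here it agrees with the Lebesgue integral. Almost everywhere its derivative is \<open>- h\<close>.\<close>

definition tail :: "(real \<Rightarrow> real) \<Rightarrow> real \<Rightarrow> real" where
  "tail h t = integral {t..} h"

lemma in_S_absolutely_integrable:
  assumes "in_S UNIV h" shows "h absolutely_integrable_on UNIV"
  using assms unfolding in_S_def set_integrable_def by (simp add: lebesgue_on_UNIV_eq)

lemma in_S_integrable_on:
  assumes "in_S UNIV h" "S \<in> sets lebesgue" shows "h absolutely_integrable_on S" "h integrable_on S"
proof -
  show "h absolutely_integrable_on S"
    using set_integrable_subset[OF in_S_absolutely_integrable[OF assms(1)]] assms(2) by auto
  then show "h integrable_on S" by (rule absolutely_integrable_on_def[THEN iffD1, THEN conjunct1])
qed

lemma tail_diff:
  assumes h: "in_S UNIV h" and ab: "a \<le> b"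
  shows "tail h a - tail h b = integral {a..b} h"
proof -
  have i: "h integrable_on {a..b}" "h integrable_on {b..}" using in_S_integrable_on[OF h] by auto
  have "{a..b} \<inter> {b..} = {b}" "{a..b} \<union> {b..} = {a..}" using ab by auto
  then have "integral {a..} h = integral {a..b} h + integral {b..} h"
    using integral_Un[OF i] by simp
  then show ?thesis by (simp add: tail_def)
qed

lemma tail_lipschitz:
  assumes h: "in_S UNIV h"
  obtains C where "\<And>a b. \<bar>tail h a - tail h b\<bar> \<le> C * \<bar>a - b\<bar>"
proof -
  obtain C where "AE t in lebesgue. \<bar>h t\<bar> \<le> C" using h unfolding in_S_def lebesgue_on_UNIV_eq by blast
  then obtain N where "N \<in> null_sets lebesgue" and C: "\<And>t. t \<notin> N \<Longrightarrow> \<bar>h t\<bar> \<le> C"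
    by (elim AE_E3) auto
  then have neg: "negligible N" by (simp add: negligible_iff_null_sets)
  have "\<not> negligible (UNIV :: real set)" by (rule non_negligible_UNIV)
  then obtain t where "t \<notin> N" using neg by (metis UNIV_eq_I)
  then have C0: "C \<ge> 0" using C[of t] by linarith
  have 1: "\<bar>tail h a - tail h b\<bar> \<le> C * (b - a)" if "a \<le> b" for a b
  proof -
    let ?g = "\<lambda>t. if t \<in> N then 0 else h t"
    have "(h has_integral integral {a..b} h) {a..b}"
      using in_S_integrable_on[OF h] by (auto intro: integrable_integral)
    then have "(?g has_integral integral {a..b} h) {a..b}"
      by (rule has_integral_spike[OF neg, rotated]) simp
    then have g: "(?g has_integral integral {a..b} h) (cbox a b)" by simp
    have "norm (?g t) \<le> C" for t using C[of t] C0 by simp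
    from has_integral_bound[OF C0 g this] have "\<bar>integral {a..b} h\<bar> \<le> C * (b - a)"
      using that by simp
    then show ?thesis using tail_diff[OF h that] by simp
  qed
  show ?thesis
  proof (rule that)
    fix a b show "\<bar>tail h a - tail h b\<bar> \<le> C * \<bar>a - b\<bar>"
      using 1[of a b] 1[of b a] by (cases "a \<le> b") (auto simp: abs_minus_commute)
  qed
qed

lemma continuous_on_tail:
  assumes h: "in_S UNIV h" shows "continuous_on S (tail h)"
proof -
  obtain C where "\<And>a b. \<bar>tail h a - tail h b\<bar> \<le> C * \<bar>a - b\<bar>" using tail_lipschitz[OF h] by blast
  then have C: "\<bar>tail h a - tail h b\<bar> \<le> (\<bar>C\<bar> + 1) * \<bar>a - b\<bar>" for a b
    by (rule order_trans) (intro mult_right_mono, auto)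
  have "(\<bar>C\<bar> + 1)-lipschitz_on S (tail h)"
    by (rule lipschitz_onI) (use C in \<open>auto simp: dist_real_def\<close>)
  then show ?thesis by (rule lipschitz_on_continuous_on)
qed

lemma tail_tendsto_0:
  assumes h: "in_S UNIV h" shows "(tail h \<longlongrightarrow> 0) at_top"
proof -
  have s: "h absolutely_integrable_on {0..}" using in_S_integrable_on[OF h] by auto
  have "((\<lambda>b. set_lebesgue_integral lebesgue {0..b} h) \<longlongrightarrow> set_lebesgue_integral lebesgue {0..} h) at_top"
    by (rule tendsto_set_lebesgue_integral_at_top[OF _ s]) auto
  then have "((\<lambda>b. integral {0..b} h) \<longlongrightarrow> tail h 0) at_top"
    using in_S_integrable_on(1)[OF h] by (simp add: set_lebesgue_integral_eq_integral(2) tail_def)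
  then have "((\<lambda>b. tail h 0 - integral {0..b} h) \<longlongrightarrow> tail h 0 - tail h 0) at_top"
    by (intro tendsto_intros)
  moreover have "eventually (\<lambda>b. tail h 0 - integral {0..b} h = tail h b) at_top"
    using eventually_ge_at_top[of 0] by eventually_elim (use tail_diff[OF h] in force)
  ultimately have "(tail h \<longlongrightarrow> tail h 0 - tail h 0) at_top"
    by (rule Lim_transform_eventually)
  then show ?thesis by simp
qed

lemma tail_bounded:
  assumes h: "in_S UNIV h" obtains M where "\<And>t. \<bar>tail h t\<bar> \<le> M"
proof (rule that)
  fix t
  have "\<bar>tail h t\<bar> \<le> integral {t..} (\<lambda>t. \<bar>h t\<bar>)"
    unfolding tail_def using absolutely_integrable_on_def in_S_integrable_on[OF h, of "{t..}"]
    by (auto intro!: integral_norm_bound_integral[where f=h, unfolded real_norm_def] simp: absolutely_integrable_on_def)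
  also have "\<dots> \<le> integral UNIV (\<lambda>t. \<bar>h t\<bar>)"
    using in_S_integrable_on[OF h, of "{t..}"] in_S_integrable_on[OF h, of UNIV]
    by (intro integral_subset_le) (auto simp: absolutely_integrable_on_def)
  finally show "\<bar>tail h t\<bar> \<le> integral UNIV (\<lambda>t. \<bar>h t\<bar>)" .
qed

lemma tail_has_derivative_ae:
  assumes h: "in_S UNIV h"
  shows "negligible {t. \<not> (tail h has_real_derivative - h t) (at t)}"
proof -
  let ?B = "\<lambda>n::nat. {t \<in> {- real n<..<real n}. \<not> ((\<lambda>u. integral {- real n..u} h) has_real_derivative h t) (at t)}"
  have "negligible (\<Union>n. ?B n)"
    using lebesgue_differentiation in_S_integrable_on[OF h] by (intro negligible_countable_Union) auto
  moreover have "{t. \<not> (tail h has_real_derivative - h t) (at t)} \<subseteq> (\<Union>n. ?B n)"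
  proof clarify
    fix t assume t: "\<not> (tail h has_real_derivative - h t) (at t)"
    obtain n :: nat where n: "\<bar>t\<bar> < real n" using reals_Archimedean2 by blast
    have "t \<in> ?B n"
    proof (rule ccontr)
      assume "t \<notin> ?B n"
      then have "((\<lambda>u. integral {- real n..u} h) has_real_derivative h t) (at t)" using n by auto
      then have "((\<lambda>u. tail h (- real n) - integral {- real n..u} h) has_real_derivative - h t) (at t)"
        by (auto intro!: derivative_eq_intros)
      then have "(tail h has_real_derivative - h t) (at t)"
      proof (rule has_field_derivative_transform_within_open[where S = "{- real n<..<real n}"])
        show "tail h (- real n) - integral {- real n..u} h = tail h u" if "u \<in> {- real n<..<real n}" for u
          using tail_diff[OF h, of "- real n" u] that by auto
      qed (use n in auto)
      then show False using t by simp
    qed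
    then show "t \<in> (\<Union>n. ?B n)" by blast
  qed
  ultimately show ?thesis using negligible_subset by blast
qed

text \<open>From left to right, \<open>x - tail h\<close> minus a primitive of the continuous function \<open>lam - x\<^sup>2\<close> is
absolutely continuous with derivative zero almost everywhere, hence constant.\<close>

theorem solution_riccati_iff:
  assumes h: "in_S UNIV h"
  shows "solution (riccati lam h) x I \<longleftrightarrow> open I \<and> is_interval I \<and> I \<noteq> {} \<and>
     (\<forall>t\<in>I. ((\<lambda>t. x t - tail h t) has_real_derivative lam - (x t)\<^sup>2) (at t))"
proof
  obtain C where C: "\<And>a b. \<bar>tail h a - tail h b\<bar> \<le> C * \<bar>a - b\<bar>" using tail_lipschitz[OF h] by blast
  let ?N = "{t. \<not> (tail h has_real_derivative - h t) (at t)}"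
  note N = tail_has_derivative_ae[OF h]
  {
    assume sol: "solution (riccati lam h) x I"
    then have I: "open I" "is_interval I" "I \<noteq> {}" and ac: "locally_abs_continuous_on I x"
      and ae: "AE t\<in>I in lebesgue. (x has_real_derivative lam - h t - (x t)\<^sup>2) (at t)"
      by (auto simp: solution_def riccati_def)
    from ae obtain M where "M \<in> null_sets lebesgue"
      and M2: "\<And>t. t \<in> I - M \<Longrightarrow> (x has_real_derivative lam - h t - (x t)\<^sup>2) (at t)"
      by (elim AE_E3) auto
    then have M1: "negligible M" by (simp add: negligible_iff_null_sets)
    note M = M1 M2
    have "((\<lambda>t. x t - tail h t) has_real_derivative lam - (x t)\<^sup>2) (at t)" if t: "t \<in> I" for t
    proof -
      obtain e where e: "e > 0" "cball t e \<subseteq> I" using I(1) t open_contains_cball by blast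
      define a b where "a = t - e" and "b = t + e"
      have ab: "{a..b} \<subseteq> I" "a < t" "t < b" using e by (auto simp: a_def b_def cball_eq_atLeastAtMost)
      have acx: "abs_continuous_on a s x" if "s \<in> {a..b}" for s
      proof -
        have "a \<le> s" "{a..s} \<subseteq> {a..b}" using that by auto
        then show ?thesis using ac ab(1) unfolding locally_abs_continuous_on_def by blast
      qed
      have cx: "continuous_on {a..b} x" using acx[of b] ab abs_continuous_on_imp_continuous_on by auto
      then have cq: "continuous_on {a..b} (\<lambda>s. lam - (x s)\<^sup>2)" by (intro continuous_intros)
      define F where "F s = integral {a..s} (\<lambda>s. lam - (x s)\<^sup>2)" for s
      have F: "(F has_real_derivative lam - (x s)\<^sup>2) (at s within {a..b})" if "s \<in> {a..b}" for s
        unfolding F_def using integral_has_real_derivative[OF cq that] .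
      have F': "(F has_real_derivative lam - (x s)\<^sup>2) (at s)" if "s \<in> {a<..<b}" for s
        using F[of s] that by (simp add: at_within_Icc_at)
      obtain B where B: "\<And>s. s \<in> {a..b} \<Longrightarrow> \<bar>lam - (x s)\<^sup>2\<bar> \<le> B"
        using continuous_on_Icc_bounded[OF cq] by blast
      have FL: "\<bar>F u - F v\<bar> \<le> B * \<bar>u - v\<bar>" if "u \<in> {a..b}" "v \<in> {a..b}" for u v
        using field_differentiable_bound[of "{a..b}" F "\<lambda>s. lam - (x s)\<^sup>2" B u v] F B that by auto
      have const: "x s - tail h s - F s = x a - tail h a - F a" if s: "s \<in> {a..b}" for s
      proof (rule abs_continuous_zero_derivative_imp_eq[where f = "\<lambda>s. x s - tail h s - F s"])
        show "a \<le> s" using s by simp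
        show "abs_continuous_on a s (\<lambda>s. x s - tail h s - F s)"
          by (intro abs_continuous_on_diff acx s abs_continuous_on_lipschitz[OF C] abs_continuous_on_lipschitz[where L=B] FL)
             (use s in auto)
        show "negligible (M \<union> ?N \<union> {a,b})" using M N by (intro negligible_Un) auto
        fix r assume r: "r \<in> {a..s} - (M \<union> ?N \<union> {a,b})"
        then have rr: "r \<in> {a<..<b}" "r \<in> I - M" "(tail h has_real_derivative - h r) (at r)"
          using s ab by auto
        show "((\<lambda>s. x s - tail h s - F s) has_real_derivative 0) (at r)"
          by (rule derivative_eq_intros F'[OF rr(1)] M(2)[OF rr(2)] rr(3) refl)+ simp
      qed
      have eq: "F s + (x a - tail h a - F a) = x s - tail h s" if "s \<in> {a<..<b}" for s
        using const[of s] that by (simp add: algebra_simps)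
      have "((\<lambda>s. F s + (x a - tail h a - F a)) has_real_derivative lam - (x t)\<^sup>2) (at t)"
        using F'[of t] ab by (auto intro!: derivative_eq_intros)
      then show ?thesis
        by (rule has_field_derivative_transform_within_open[where S = "{a<..<b}"]) (use ab eq in auto)
    qed
    then show "open I \<and> is_interval I \<and> I \<noteq> {} \<and>
     (\<forall>t\<in>I. ((\<lambda>t. x t - tail h t) has_real_derivative lam - (x t)\<^sup>2) (at t))" using I by blast
  }
  {
    assume *: "open I \<and> is_interval I \<and> I \<noteq> {} \<and>
     (\<forall>t\<in>I. ((\<lambda>t. x t - tail h t) has_real_derivative lam - (x t)\<^sup>2) (at t))"
    let ?y = "\<lambda>t. x t - tail h t"
    have D: "(?y has_real_derivative lam - (x t)\<^sup>2) (at t)" if "t \<in> I" for t using * that by blast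
    then have cy: "continuous_on I ?y"
      by (auto intro!: continuous_at_imp_continuous_on DERIV_isCont)
    have "continuous_on I (\<lambda>t. ?y t + tail h t)" by (intro continuous_intros cy continuous_on_tail h)
    then have cx: "continuous_on I x" by simp
    have "abs_continuous_on a b x" if "a \<le> b" "{a..b} \<subseteq> I" for a b
    proof -
      have "continuous_on {a..b} (\<lambda>s. lam - (x s)\<^sup>2)"
        using continuous_on_subset[OF cx that(2)] by (intro continuous_intros)
      then obtain B where B: "\<And>s. s \<in> {a..b} \<Longrightarrow> \<bar>lam - (x s)\<^sup>2\<bar> \<le> B"
        using continuous_on_Icc_bounded by blast
      have Dw: "(?y has_real_derivative lam - (x s)\<^sup>2) (at s within {a..b})" if "s \<in> {a..b}" for s
        using D[of s] that \<open>{a..b} \<subseteq> I\<close> by (blast intro: has_field_derivative_at_within)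
      have "\<bar>?y u - ?y v\<bar> \<le> B * \<bar>u - v\<bar>" if "u \<in> {a..b}" "v \<in> {a..b}" for u v
        using field_differentiable_bound[OF convex_real_interval(5) Dw, of B u v] B that
        by simp
      then have a1: "abs_continuous_on a b ?y" by (rule abs_continuous_on_lipschitz)
      have a2: "abs_continuous_on a b (\<lambda>t. - tail h t)"
      proof (rule abs_continuous_on_lipschitz)
        show "\<bar>- tail h u - - tail h v\<bar> \<le> C * \<bar>u - v\<bar>" for u v using C[of u v] by simp
      qed
      show ?thesis using abs_continuous_on_diff[OF a1 a2] by simp
    qed
    moreover have "AE t in lebesgue. t \<notin> ?N"
      using N by (intro AE_not_in) (simp add: negligible_iff_null_sets)
    then have ae: "AE t\<in>I in lebesgue. (x has_real_derivative riccati lam h t (x t)) (at t)"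
    proof (rule AE_mp, intro AE_I2 impI)
      fix t assume t: "t \<notin> ?N" "t \<in> I"
      have "((\<lambda>t. ?y t + tail h t) has_real_derivative (lam - (x t)\<^sup>2) + - h t) (at t)"
        using t D by (intro DERIV_add) auto
      then show "(x has_real_derivative riccati lam h t (x t)) (at t)" by (simp add: riccati_def algebra_simps)
    qed
    ultimately have "locally_abs_continuous_on I x" unfolding locally_abs_continuous_on_def by simp
    then show "solution (riccati lam h) x I"
      using * ae by (simp add: solution_def)
  }
qed

section \<open>Barriers, comparison and blow-up for scalar equations\<close>

text \<open>The level \<open>c\<close> cannot be crossed downwards, because the function increases wherever it takes the
value \<open>c\<close>. Derivatives are needed only in the open interval, so the left endpoint may be the end
of the domain of differentiability.\<close>

lemma barrier_below:
  fixes y :: "real \<Rightarrow> real"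
  assumes st: "s \<le> t" and cont: "continuous_on {s..t} y" and y0: "y s > c"
    and der: "\<And>r. s < r \<Longrightarrow> r < t \<Longrightarrow> y r = c \<Longrightarrow> \<exists>D>0. (y has_real_derivative D) (at r)"
  shows "y t \<ge> c"
proof (rule ccontr)
  assume "\<not> y t \<ge> c"
  then have yt: "y t < c" by simp
  define A where "A = {r \<in> {s..t}. y r \<ge> c}"
  have clA: "closed A" unfolding A_def
    using continuous_closed_preimage[OF cont closed_atLeastAtMost, of "{c..}"]
    by (simp add: vimage_def Int_def conj_commute)
  have sA: "s \<in> A" using st y0 by (simp add: A_def)
  have bA: "bdd_above A" by (rule bdd_aboveI[of _ t]) (simp add: A_def)
  define \<tau> where "\<tau> = Sup A"
  have \<tau>A: "\<tau> \<in> A" unfolding \<tau>_def using closed_contains_Sup[OF _ bA clA] sA by blast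
  have up: "r \<le> \<tau>" if "r \<in> A" for r unfolding \<tau>_def by (rule cSup_upper[OF that bA])
  have \<tau>t: "\<tau> < t" using \<tau>A yt by (cases "\<tau> = t") (auto simp: A_def)
  have "continuous_on {\<tau>..t} y" using \<tau>A by (intro continuous_on_subset[OF cont]) (auto simp: A_def)
  then obtain r where r: "\<tau> \<le> r" "r \<le> t" "y r = c"
    using IVT2'[of y t c \<tau>] yt \<tau>A \<tau>t by (auto simp: A_def)
  then have "r \<in> A" using \<tau>A by (auto simp: A_def)
  then have "r = \<tau>" using up r by force
  then have y\<tau>: "y \<tau> = c" using r by simp
  then have "s < \<tau>" using \<tau>A y0 by (cases "\<tau> = s") (auto simp: A_def)
  then obtain D where "D > 0" "(y has_real_derivative D) (at \<tau>)" using der[of \<tau>] \<tau>t y\<tau> by blast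
  then obtain d where d: "d > 0" "\<And>h. h > 0 \<Longrightarrow> h < d \<Longrightarrow> y \<tau> < y (\<tau> + h)"
    using DERIV_pos_inc_right by blast
  define h where "h = min (d / 2) (t - \<tau>)"
  have h: "h > 0" "h < d" "\<tau> + h \<le> t" using d \<tau>t by (auto simp: h_def min_def)
  have "\<tau> + h \<in> A" using d(2)[OF h(1,2)] y\<tau> h \<tau>A by (auto simp: A_def)
  then show False using up h by force
qed

text \<open>Gronwall's inequality in differential form, for \<open>d' \<ge> - c d\<close>.\<close>

lemma linear_comparison:
  fixes d c :: "real \<Rightarrow> real"
  assumes pq: "p \<le> q" and d: "continuous_on {p..q} d" and c: "continuous_on {p..q} c"
    and der: "\<And>t. p < t \<Longrightarrow> t < q \<Longrightarrow> \<exists>D. (d has_real_derivative D) (at t) \<and> D \<ge> - c t * d t"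
  shows "d q \<ge> d p * exp (- integral {p..q} c)"
proof -
  define C where "C t = integral {p..t} c" for t
  have C: "(C has_real_derivative c t) (at t within {p..q})" if "t \<in> {p..q}" for t
    unfolding C_def using integral_has_real_derivative[OF c that] .
  then have "continuous_on {p..q} C" using DERIV_continuous_on by blast
  then have ce: "continuous_on {p..q} (\<lambda>t. d t * exp (C t))" by (intro continuous_intros d)
  have "d p * exp (C p) \<le> d q * exp (C q)"
  proof (rule DERIV_nonneg_imp_increasing_open[OF pq _ ce])
    fix t assume t: "p < t" "t < q"
    then have C': "(C has_real_derivative c t) (at t)" using C[of t] by (simp add: at_within_Icc_at)
    obtain D where D: "(d has_real_derivative D) (at t)" "D \<ge> - c t * d t" using der[OF t] by blast
    have "((\<lambda>t. d t * exp (C t)) has_real_derivative (D + c t * d t) * exp (C t)) (at t)"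
      by (rule derivative_eq_intros D(1) C' refl)+ (simp add: algebra_simps)
    moreover have "(D + c t * d t) * exp (C t) \<ge> 0" using D by simp
    ultimately show "\<exists>y. ((\<lambda>t. d t * exp (C t)) has_real_derivative y) (at t) \<and> y \<ge> 0" by blast
  qed
  then have "d p \<le> d q * exp (C q)" by (simp add: C_def)
  then have "d p * exp (- C q) \<le> d q * exp (C q) * exp (- C q)" by (intro mult_right_mono) auto
  also have "\<dots> = d q" by (simp add: exp_minus)
  finally show ?thesis by (simp add: C_def)
qed

corollary linear_comparison_nonneg:
  fixes d c :: "real \<Rightarrow> real"
  assumes "p \<le> q" "continuous_on {p..q} d" "continuous_on {p..q} c"
    and "\<And>t. p < t \<Longrightarrow> t < q \<Longrightarrow> \<exists>D. (d has_real_derivative D) (at t) \<and> D \<ge> - c t * d t"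
  shows "d p \<ge> 0 \<Longrightarrow> d q \<ge> 0" "d p > 0 \<Longrightarrow> d q > 0"
  using linear_comparison[OF assms] by (meson exp_ge_zero mult_nonneg_nonneg order_trans) 
   (use linear_comparison[OF assms] in \<open>meson exp_gt_zero mult_pos_pos less_le_trans\<close>)

text \<open>A subsolution \<open>z\<close> stays below a supersolution \<open>w\<close> of \<open>y' = lam + G' - \<mu> y\<^sup>2\<close>, the equation being
understood through the derivative of \<open>y - G\<close>.\<close>

lemma scaled_comparison:
  fixes z w G :: "real \<Rightarrow> real"
  assumes q: "0 \<le> q" and cont: "continuous_on {0..q} z" "continuous_on {0..q} w"
    and z: "\<And>s. 0 < s \<Longrightarrow> s < q \<Longrightarrow> \<exists>A. ((\<lambda>s. z s - G s) has_real_derivative A) (at s) \<and> A \<le> lam - \<mu> * (z s)\<^sup>2"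
    and w: "\<And>s. 0 < s \<Longrightarrow> s < q \<Longrightarrow> \<exists>A. ((\<lambda>s. w s - G s) has_real_derivative A) (at s) \<and> A \<ge> lam - \<mu> * (w s)\<^sup>2"
    and le: "z 0 \<le> w 0"
  shows "z q \<le> w q"
proof -
  have "w q - z q \<ge> 0"
  proof (rule linear_comparison_nonneg(1)[where d = "\<lambda>s. w s - z s" and p = 0 and q = q and c = "\<lambda>s. \<mu> * (w s + z s)"])
    fix s assume s: "0 < s" "s < q"
    obtain A where A: "((\<lambda>s. z s - G s) has_real_derivative A) (at s)" "A \<le> lam - \<mu> * (z s)\<^sup>2" using z[OF s] by blast
    obtain B where B: "((\<lambda>s. w s - G s) has_real_derivative B) (at s)" "B \<ge> lam - \<mu> * (w s)\<^sup>2" using w[OF s] by blast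
    have "((\<lambda>s. (w s - G s) - (z s - G s)) has_real_derivative B - A) (at s)"
      by (rule DERIV_diff[OF B(1) A(1)])
    then have "((\<lambda>s. w s - z s) has_real_derivative B - A) (at s)" by simp
    moreover have "B - A \<ge> - (\<mu> * (w s + z s)) * (w s - z s)"
      using A(2) B(2) by (simp add: algebra_simps power2_eq_square)
    ultimately show "\<exists>D. ((\<lambda>s. w s - z s) has_real_derivative D) (at s) \<and> D \<ge> - (\<mu> * (w s + z s)) * (w s - z s)"
      by blast
  qed (use q le in \<open>auto intro!: continuous_intros cont\<close>)
  then show ?thesis by simp
qed

text \<open>A solution that exists for all later times cannot be far below zero: otherwise \<open>v = - Y\<close> satisfies
\<open>v' \<ge> (\<mu> / 4) v\<^sup>2\<close>, and \<open>1 / v\<close> would become negative in finite time.\<close>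

lemma riccati_forward_lower_bound:
  fixes Y G :: "real \<Rightarrow> real"
  assumes mu: "\<mu> > 0" and lam: "lam > 0" and cont: "continuous_on {s..} Y"
    and der: "\<And>t. t > s \<Longrightarrow> (Y has_real_derivative lam - \<mu> * (Y t + G t)\<^sup>2) (at t)"
    and G: "\<And>t. t \<ge> s \<Longrightarrow> \<bar>G t\<bar> \<le> S" and st: "t0 \<ge> s"
  shows "Y t0 \<ge> - (2 * S + 2 * sqrt (lam / \<mu>) + 1)"
proof (rule ccontr)
  assume neg: "\<not> ?thesis"
  define B where "B = 2 * S + 2 * sqrt (lam / \<mu>) + 1"
  have S0: "S \<ge> 0" using G[OF st] by linarith
  define q where "q = sqrt (lam / \<mu>)"
  have q: "q \<ge> 0" "\<mu> * q\<^sup>2 = lam" using mu lam by (auto simp: q_def)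
  have "B = 2 * S + 2 * q + 1" by (simp add: B_def q_def)
  then have B: "B > 0" "B \<ge> 2 * S + 2 * q" using S0 q by simp_all
  define v where "v t = - Y t" for t
  have v: "(v has_real_derivative \<mu> * (G t - v t)\<^sup>2 - lam) (at t)" if "t > s" for t
  proof -
    have "(v has_real_derivative - (lam - \<mu> * (Y t + G t)\<^sup>2)) (at t)"
      unfolding v_def by (rule DERIV_minus[OF der[OF that]])
    then show ?thesis by (simp add: v_def add.commute)
  qed
  have grow: "\<mu> * (G t - v t)\<^sup>2 - lam \<ge> \<mu> / 4 * (v t)\<^sup>2" if "t \<ge> s" "v t \<ge> B" for t
  proof -
    have "v t - G t \<ge> v t / 2 + q" using G[OF that(1)] that(2) B by (simp add: abs_le_iff)
    moreover have "v t / 2 + q \<ge> 0" using that B q by simp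
    ultimately have "(v t - G t)\<^sup>2 \<ge> (v t / 2 + q)\<^sup>2" by (intro power_mono) auto
    moreover have "(v t / 2 + q)\<^sup>2 \<ge> (v t)\<^sup>2 / 4 + q\<^sup>2"
      using that B q by (simp add: power2_eq_square algebra_simps)
    ultimately have "\<mu> * (v t - G t)\<^sup>2 \<ge> \<mu> * ((v t)\<^sup>2 / 4 + q\<^sup>2)" using mu by (intro mult_left_mono) auto
    then show ?thesis using q(2) by (simp add: algebra_simps power2_commute)
  qed
  have contv: "continuous_on {s..} v" unfolding v_def by (intro continuous_intros cont)
  have vt0: "v t0 > B" using neg by (simp add: v_def B_def)
  have vB: "v t \<ge> B" if "t \<ge> t0" for t
  proof (rule barrier_below[where y = v and s = t0 and c = B, OF that _ vt0])
    show "continuous_on {t0..t} v" by (rule continuous_on_subset[OF contv]) (use st in auto)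
    fix r assume r: "t0 < r" "r < t" "v r = B"
    have "\<mu> / 4 * (v r)\<^sup>2 > 0" using mu B r by simp
    then have "\<mu> * (G r - v r)\<^sup>2 - lam > 0" using grow[of r] r st by simp
    then show "\<exists>D>0. (v has_real_derivative D) (at r)"
      using v[of r] r st by (intro exI[of _ "\<mu> * (G r - v r)\<^sup>2 - lam"]) auto
  qed
  define c where "c = \<mu> / 4"
  have c: "c > 0" using mu by (simp add: c_def)
  \<comment> \<open>a time after which \<open>- 1 / v\<close>, increasing at rate \<open>c\<close> from at least \<open>- 1 / B\<close>, would be positive\<close>
  define t1 where "t1 = t0 + 1 / (c * B) + 1"
  have t1: "t0 \<le> t1" using c B by (auto simp: t1_def)
  have "- inverse (v t0) - c * t0 \<le> - inverse (v t1) - c * t1"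
  proof (rule DERIV_nonneg_imp_increasing_open[OF t1])
    fix r assume r: "t0 < r" "r < t1"
    have vr: "v r \<noteq> 0" "v r \<ge> B" using vB[of r] B r by auto
    define A where "A = \<mu> * (G r - v r)\<^sup>2 - lam"
    have A: "(v has_real_derivative A) (at r)" "c * (v r)\<^sup>2 \<le> A"
      using v[of r] grow[of r] r st vr by (auto simp: A_def c_def)
    have "((\<lambda>t. - inverse (v t) - c * t) has_real_derivative A * (inverse (v r))\<^sup>2 - c) (at r)"
      using A(1) vr by (auto intro!: derivative_eq_intros simp: power2_eq_square)
    moreover have "(c * (v r)\<^sup>2) * (inverse (v r))\<^sup>2 \<le> A * (inverse (v r))\<^sup>2"
      by (intro mult_right_mono A) simp
    moreover have "(c * (v r)\<^sup>2) * (inverse (v r))\<^sup>2 = c" using vr by (simp add: field_simps)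
    ultimately show "\<exists>y. ((\<lambda>t. - inverse (v t) - c * t) has_real_derivative y) (at r) \<and> 0 \<le> y"
      by (intro exI[of _ "A * (inverse (v r))\<^sup>2 - c"]) simp
  next
    show "continuous_on {t0..t1} (\<lambda>t. - inverse (v t) - c * t)"
      using st vB B(1) by (intro continuous_intros continuous_on_subset[OF contv]) (auto, fastforce)
  qed
  moreover have "inverse (v t1) > 0" using vB[OF t1] B by simp
  moreover have "inverse (v t0) \<le> 1 / B" using vt0 B(1) by (simp add: field_simps)
  moreover have "c * t1 = c * t0 + 1 / B + c" using c B by (simp add: t1_def field_simps)
  ultimately show False using c by linarith
qed

text \<open>A function that starts above \<open>l\<close> and increases at least at rate \<open>c\<close> while it is between \<open>l\<close> and
\<open>m\<close> eventually stays at or above \<open>m\<close>.\<close>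

lemma eventually_above:
  fixes Y D :: "real \<Rightarrow> real"
  assumes der: "\<And>t. t \<ge> T \<Longrightarrow> (Y has_real_derivative D t) (at t)" and YT: "Y T > l" and lm: "l < m"
    and c: "c > 0" and D: "\<And>t. t \<ge> T \<Longrightarrow> l \<le> Y t \<Longrightarrow> Y t \<le> m \<Longrightarrow> D t \<ge> c"
  shows "eventually (\<lambda>t. Y t \<ge> m) at_top"
proof -
  have cont: "continuous_on {a..b} Y" if "T \<le> a" for a b
    using that by (auto intro!: continuous_at_imp_continuous_on DERIV_isCont der)
  have l: "Y t \<ge> l" if "t \<ge> T" for t
  proof (rule barrier_below[where y = Y, OF that cont[OF order_refl] YT])
    fix r assume "T < r" "r < t" "Y r = l"
    then show "\<exists>D>0. (Y has_real_derivative D) (at r)" using der[of r] D[of r] c lm by (intro exI[of _ "D r"]) auto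
  qed
  have "\<exists>t1\<ge>T. Y t1 > m"
  proof (rule ccontr)
    assume "\<not> (\<exists>t1\<ge>T. Y t1 > m)"
    then have m: "Y t \<le> m" if "t \<ge> T" for t using that by force
    define t1 where "t1 = T + \<bar>m - Y T\<bar> / c + 1"
    have t1: "T \<le> t1" using c by (simp add: t1_def)
    have "Y T - c * T \<le> Y t1 - c * t1"
    proof (rule DERIV_nonneg_imp_nondecreasing[OF t1])
      fix r assume r: "T \<le> r" "r \<le> t1"
      have "((\<lambda>t. Y t - c * t) has_real_derivative D r - c) (at r)"
        using der[OF r(1)] by (auto intro!: derivative_eq_intros)
      then show "\<exists>y. ((\<lambda>t. Y t - c * t) has_real_derivative y) (at r) \<and> 0 \<le> y"
        using D[OF r(1) l m] r by (intro exI[of _ "D r - c"]) auto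
    qed
    moreover have "c * t1 = c * T + \<bar>m - Y T\<bar> + c" using c by (simp add: t1_def field_simps)
    ultimately show False using m[OF t1] c by linarith
  qed
  then obtain t1 where t1: "t1 \<ge> T" "Y t1 > m" by blast
  have "Y t \<ge> m" if "t \<ge> t1" for t
  proof (rule barrier_below[where y = Y, OF that cont[OF t1(1)] t1(2)])
    fix r assume "t1 < r" "r < t" "Y r = m"
    then show "\<exists>D>0. (Y has_real_derivative D) (at r)" using der[of r] D[of r] c lm t1 by (intro exI[of _ "D r"]) auto
  qed
  then show ?thesis unfolding eventually_at_top_linorder by blast
qed

section \<open>Linear planar systems\<close>

lemma antiderivative_power_bound:
  fixes F f :: "real \<Rightarrow> real"
  assumes F: "\<And>t. (F has_real_derivative f t) (at t)" and F0: "F s = 0"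
    and b: "\<And>t. \<bar>f t\<bar> \<le> K * \<bar>t - s\<bar> ^ n"
  shows "\<bar>F t\<bar> \<le> K * \<bar>t - s\<bar> ^ Suc n / real (Suc n)"
proof -
  have main: "\<bar>G u\<bar> \<le> K * u ^ Suc n / real (Suc n)"
    if u: "u \<ge> 0" and G: "\<And>r. (G has_real_derivative g r) (at r)" "G 0 = 0"
      and gb: "\<And>r. r \<ge> 0 \<Longrightarrow> \<bar>g r\<bar> \<le> K * r ^ n" for G g :: "real \<Rightarrow> real" and u
  proof -
    let ?P = "\<lambda>r::real. K * r ^ Suc n / real (Suc n)"
    have P: "(?P has_real_derivative K * r ^ n) (at r)" for r
      using DERIV_cdivide[OF DERIV_cmult[OF DERIV_pow[of "Suc n" r]], of K "real (Suc n)"] by simp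
    have "?P 0 - G 0 \<le> ?P u - G u"
    proof (rule DERIV_nonneg_imp_nondecreasing[OF u])
      fix r :: real assume "0 \<le> r"
      then have "K * r ^ n - g r \<ge> 0" using gb[of r] by linarith
      then show "\<exists>y. ((\<lambda>r. ?P r - G r) has_real_derivative y) (at r) \<and> 0 \<le> y"
        using DERIV_diff[OF P G(1)] by blast
    qed
    moreover have "?P 0 + G 0 \<le> ?P u + G u"
    proof (rule DERIV_nonneg_imp_nondecreasing[OF u])
      fix r :: real assume "0 \<le> r"
      then have "K * r ^ n + g r \<ge> 0" using gb[of r] by linarith
      then show "\<exists>y. ((\<lambda>r. ?P r + G r) has_real_derivative y) (at r) \<and> 0 \<le> y"
        using DERIV_add[OF P G(1)] by blast
    qed
    ultimately show ?thesis using G(2) by simp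
  qed
  show ?thesis
  proof (cases "t \<ge> s")
    case True
    have "((\<lambda>r. F (s + r)) has_real_derivative f (s + r)) (at r)" for r
    proof -
      have "((\<lambda>r. s + r) has_real_derivative 1) (at r)" by (auto intro!: derivative_eq_intros)
      from DERIV_chain2[where f = F and g = "\<lambda>r. s + r", OF F this] show ?thesis by simp
    qed
    moreover have "\<bar>f (s + r)\<bar> \<le> K * r ^ n" if "0 \<le> r" for r using b[of "s + r"] that by simp
    ultimately show ?thesis using main[of "t - s" "\<lambda>r. F (s + r)" "\<lambda>r. f (s + r)"] True F0 by simp
  next
    case False
    have "((\<lambda>r. F (s - r)) has_real_derivative - f (s - r)) (at r)" for r
    proof -
      have "((\<lambda>r. s - r) has_real_derivative - 1) (at r)" by (auto intro!: derivative_eq_intros)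
      from DERIV_chain2[where f = F and g = "\<lambda>r. s - r", OF F this] show ?thesis by simp
    qed
    moreover have "\<bar>- f (s - r)\<bar> \<le> K * r ^ n" if "0 \<le> r" for r using b[of "s - r"] that by simp
    ultimately show ?thesis using main[of "s - t" "\<lambda>r. F (s - r)" "\<lambda>r. - f (s - r)"] False F0
      by (simp add: abs_minus_commute)
  qed
qed

lemma antiderivative_exists:
  fixes f :: "real \<Rightarrow> real"
  assumes "continuous_on UNIV f"
  shows "\<exists>F. F s = 0 \<and> (\<forall>t. (F has_real_derivative f t) (at t))"
proof -
  have "\<And>x. isCont f x" using assms by (simp add: continuous_on_eq_continuous_at)
  then obtain F where F: "\<And>t. (F has_real_derivative f t) (at t)"
    using einterval_antiderivative[of "-\<infinity>" "\<infinity>" f] by (auto simp: has_real_derivative_iff_has_vector_derivative)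
  have "((\<lambda>t. F t - F s) has_real_derivative f t) (at t)" for t
    using DERIV_diff[OF F DERIV_const] by simp
  then show ?thesis by (intro exI[of _ "\<lambda>t. F t - F s"]) auto
qed

text \<open>The solution is the sum of the Picard increments \<open>U n\<close>, \<open>W n\<close>, which are bounded by
\<open>C (2 L |t - s|)\<^sup>n / n!\<close> and may therefore be summed and differentiated termwise.\<close>

theorem planar_linear_system_exists:
  fixes a b c d :: "real \<Rightarrow> real"
  assumes cont: "continuous_on UNIV a" "continuous_on UNIV b" "continuous_on UNIV c" "continuous_on UNIV d"
    and bd: "\<And>t. \<bar>a t\<bar> \<le> L" "\<And>t. \<bar>b t\<bar> \<le> L" "\<And>t. \<bar>c t\<bar> \<le> L" "\<And>t. \<bar>d t\<bar> \<le> L"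
  shows "\<exists>u w. u s = u0 \<and> w s = w0 \<and>
     (\<forall>t. (u has_real_derivative a t * u t + b t * w t) (at t)) \<and>
     (\<forall>t. (w has_real_derivative c t * u t + d t * w t) (at t))"
proof -
  define J where "J f = (SOME F. F s = 0 \<and> (\<forall>t. (F has_real_derivative f t) (at t)))" for f :: "real \<Rightarrow> real"
  have J: "J f s = 0" "(J f has_real_derivative f t) (at t)" if "continuous_on UNIV f" for f t
    using someI_ex[OF antiderivative_exists[OF that, of s]] unfolding J_def by auto
  define Z where "Z = rec_nat (\<lambda>t. u0, \<lambda>t. w0)
     (\<lambda>n Z. (J (\<lambda>t. a t * fst Z t + b t * snd Z t), J (\<lambda>t. c t * fst Z t + d t * snd Z t)))"
  define U where "U n = fst (Z n)" for n
  define W where "W n = snd (Z n)" for n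
  define U' where "U' n = (\<lambda>t. a t * U n t + b t * W n t)" for n
  define W' where "W' n = (\<lambda>t. c t * U n t + d t * W n t)" for n
  have Z0: "U 0 = (\<lambda>t. u0)" "W 0 = (\<lambda>t. w0)" by (auto simp: U_def W_def Z_def)
  have ZS: "U (Suc n) = J (U' n)" "W (Suc n) = J (W' n)" for n
    by (auto simp: U_def W_def U'_def W'_def Z_def)
  have contZ: "continuous_on UNIV (U n) \<and> continuous_on UNIV (W n)" for n
  proof (induction n)
    case (Suc n)
    then have "continuous_on UNIV (U' n)" "continuous_on UNIV (W' n)"
      unfolding U'_def W'_def by (auto intro!: continuous_intros cont)
    then show ?case unfolding ZS by (auto intro!: continuous_at_imp_continuous_on DERIV_isCont J(2))
  qed (auto simp: Z0)
  then have cZ': "continuous_on UNIV (U' n)" "continuous_on UNIV (W' n)" for n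
    unfolding U'_def W'_def by (auto intro!: continuous_intros cont)
  have L0: "L \<ge> 0" using bd(1)[of 0] by linarith
  define C where "C = \<bar>u0\<bar> + \<bar>w0\<bar>"
  have C0: "C \<ge> 0" by (simp add: C_def)
  have der_bound: "\<bar>U' n t\<bar> \<le> L * (\<bar>U n t\<bar> + \<bar>W n t\<bar>)" "\<bar>W' n t\<bar> \<le> L * (\<bar>U n t\<bar> + \<bar>W n t\<bar>)" for n t
  proof -
    have *: "\<bar>p * x + q * y\<bar> \<le> L * (\<bar>x\<bar> + \<bar>y\<bar>)" if "\<bar>p\<bar> \<le> L" "\<bar>q\<bar> \<le> L" for p q x y
    proof -
      have "\<bar>p * x + q * y\<bar> \<le> \<bar>p\<bar> * \<bar>x\<bar> + \<bar>q\<bar> * \<bar>y\<bar>" by (metis abs_mult abs_triangle_ineq)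
      also have "\<dots> \<le> L * \<bar>x\<bar> + L * \<bar>y\<bar>" using that by (intro add_mono mult_right_mono) auto
      finally show ?thesis by (simp add: algebra_simps)
    qed
    show "\<bar>U' n t\<bar> \<le> L * (\<bar>U n t\<bar> + \<bar>W n t\<bar>)" "\<bar>W' n t\<bar> \<le> L * (\<bar>U n t\<bar> + \<bar>W n t\<bar>)"
      unfolding U'_def W'_def using * bd by auto
  qed
  have Zb: "\<bar>U n t\<bar> + \<bar>W n t\<bar> \<le> C * (2 * L) ^ n / fact n * \<bar>t - s\<bar> ^ n" for n t
  proof (induction n arbitrary: t)
    case (Suc n)
    let ?K = "L * (C * (2 * L) ^ n / fact n)"
    have "L * (\<bar>U n r\<bar> + \<bar>W n r\<bar>) \<le> ?K * \<bar>r - s\<bar> ^ n" for r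
      using mult_left_mono[OF Suc[of r] L0] by (simp add: mult.assoc)
    then have "\<bar>U' n r\<bar> \<le> ?K * \<bar>r - s\<bar> ^ n" "\<bar>W' n r\<bar> \<le> ?K * \<bar>r - s\<bar> ^ n" for r
      using der_bound order_trans by blast+
    note * = antiderivative_power_bound[OF J(2)[OF cZ'(1)] J(1)[OF cZ'(1)] this(1)]
      antiderivative_power_bound[OF J(2)[OF cZ'(2)] J(1)[OF cZ'(2)] this(2)]
    then have "\<bar>U (Suc n) t\<bar> \<le> ?K * \<bar>t - s\<bar> ^ Suc n / real (Suc n)" "\<bar>W (Suc n) t\<bar> \<le> ?K * \<bar>t - s\<bar> ^ Suc n / real (Suc n)"
      unfolding ZS by blast+
    then have "\<bar>U (Suc n) t\<bar> + \<bar>W (Suc n) t\<bar> \<le> 2 * (?K * \<bar>t - s\<bar> ^ Suc n / real (Suc n))" by linarith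
    also have "\<dots> = C * (2 * L) ^ Suc n / fact (Suc n) * \<bar>t - s\<bar> ^ Suc n"
      by (simp add: field_simps)
    finally show ?case .
  qed (simp add: Z0 C_def)
  define U1 where "U1 n = (case n of 0 \<Rightarrow> (\<lambda>t. 0) | Suc m \<Rightarrow> U' m)" for n
  define W1 where "W1 n = (case n of 0 \<Rightarrow> (\<lambda>t. 0) | Suc m \<Rightarrow> W' m)" for n
  have U1: "(U n has_real_derivative U1 n t) (at t)" for n t
    by (cases n) (auto simp: U1_def Z0 ZS intro: J(2)[OF cZ'(1)])
  have W1: "(W n has_real_derivative W1 n t) (at t)" for n t
    by (cases n) (auto simp: W1_def Z0 ZS intro: J(2)[OF cZ'(2)])
  have conv: "summable (\<lambda>n. U n t) \<and> summable (\<lambda>n. W n t) \<and>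
     ((\<lambda>t. \<Sum>n. U n t) has_real_derivative (\<Sum>n. U1 n t)) (at t) \<and>
     ((\<lambda>t. \<Sum>n. W n t) has_real_derivative (\<Sum>n. W1 n t)) (at t)" for t
  proof -
    define R where "R = \<bar>t - s\<bar> + 1"
    define S where "S = {s - R..s + R}"
    define B where "B n = C * (2 * L * R) ^ n / fact n" for n :: nat
    have R0: "R > 0" by (simp add: R_def)
    have sumB: "summable B"
      unfolding B_def using summable_mult[OF summable_exp[of "2 * L * R"], of C] by (simp add: field_simps)
    have UWB: "\<bar>U n r\<bar> + \<bar>W n r\<bar> \<le> B n" if "r \<in> S" for n r
    proof -
      have "\<bar>r - s\<bar> ^ n \<le> R ^ n" using that by (intro power_mono) (auto simp: S_def abs_le_iff)
      then have "C * (2 * L) ^ n / fact n * \<bar>r - s\<bar> ^ n \<le> C * (2 * L) ^ n / fact n * R ^ n"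
        using C0 L0 by (intro mult_left_mono) auto
      also have "\<dots> = B n" by (simp add: B_def power_mult_distrib)
      finally show ?thesis using Zb[of n r] by linarith
    qed
    define B1 where "B1 n = (case n of 0 \<Rightarrow> 0 | Suc m \<Rightarrow> L * B m)" for n
    have sumB1: "summable B1"
      using summable_mult[OF sumB, of L] by (subst summable_Suc_iff[symmetric]) (simp add: B1_def)
    have b1: "\<bar>U1 n r\<bar> \<le> B1 n \<and> \<bar>W1 n r\<bar> \<le> B1 n" if "r \<in> S" for n r
    proof (cases n)
      case (Suc m)
      have "L * (\<bar>U m r\<bar> + \<bar>W m r\<bar>) \<le> L * B m" using UWB[OF that] L0 by (intro mult_left_mono) auto
      then show ?thesis using der_bound[of m r] Suc by (simp add: U1_def W1_def B1_def)
    qed (simp add: U1_def W1_def B1_def)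
    have uc: "uniformly_convergent_on S (\<lambda>n r. \<Sum>i<n. U1 i r)" "uniformly_convergent_on S (\<lambda>n r. \<Sum>i<n. W1 i r)"
      using b1 by (auto intro!: Weierstrass_m_test'[OF _ sumB1])
    have sS: "s \<in> S" using R0 by (simp add: S_def)
    have tS: "t \<in> interior S" "t \<in> S" by (auto simp: S_def R_def abs_real_def)
    have sm: "summable (\<lambda>n. U n r)" "summable (\<lambda>n. W n r)" if "r \<in> S" for r
    proof -
      have "\<bar>U n r\<bar> \<le> B n" "\<bar>W n r\<bar> \<le> B n" for n using UWB[OF that, of n] by linarith+
      then show "summable (\<lambda>n. U n r)" "summable (\<lambda>n. W n r)"
        by (auto intro!: summable_comparison_test'[OF sumB, of 0])
    qed
    have "convex S" by (simp add: S_def)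
    then show ?thesis
      using has_field_derivative_series'[OF \<open>convex S\<close> DERIV_subset[OF U1 subset_UNIV] uc(1) sS sm(1)[OF sS] tS(1)]
       has_field_derivative_series'[OF \<open>convex S\<close> DERIV_subset[OF W1 subset_UNIV] uc(2) sS sm(2)[OF sS] tS(1)]
      by blast
  qed
  define u where "u t = (\<Sum>n. U n t)" for t
  define w where "w t = (\<Sum>n. W n t)" for t
  have sumU1: "(\<Sum>n. U1 n t) = a t * u t + b t * w t" "(\<Sum>n. W1 n t) = c t * u t + d t * w t" for t
  proof -
    have su: "(\<lambda>n. U n t) sums u t" "(\<lambda>n. W n t) sums w t" using conv[of t] by (auto simp: u_def w_def summable_sums)
    have z: "U1 0 t = 0" "W1 0 t = 0" by (simp_all add: U1_def W1_def)
    have "(\<lambda>n. U1 (Suc n) t) sums (a t * u t + b t * w t)" "(\<lambda>n. W1 (Suc n) t) sums (c t * u t + d t * w t)"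
      unfolding U1_def W1_def U'_def W'_def by (auto intro!: sums_add sums_mult su)
    then have "(\<lambda>n. U1 n t) sums (a t * u t + b t * w t)" "(\<lambda>n. W1 n t) sums (c t * u t + d t * w t)"
      using sums_Suc_iff[of "\<lambda>n. U1 n t" "a t * u t + b t * w t"]
        sums_Suc_iff[of "\<lambda>n. W1 n t" "c t * u t + d t * w t"] z by auto
    then show "(\<Sum>n. U1 n t) = a t * u t + b t * w t" "(\<Sum>n. W1 n t) = c t * u t + d t * w t"
      by (auto simp: sums_iff)
  qed
  have "U (Suc n) s = 0" "W (Suc n) s = 0" for n unfolding ZS by (auto intro: J cZ')
  then have "(\<lambda>n. U n s) sums u0" "(\<lambda>n. W n s) sums w0"
    using sums_finite[of "{0}" "\<lambda>n. U n s"] sums_finite[of "{0}" "\<lambda>n. W n s"]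
    by (auto simp: Z0 gr0_conv_Suc)
  then have "u s = u0" "w s = w0" by (auto simp: u_def w_def sums_iff)
  then show ?thesis using conv unfolding sumU1 u_def[symmetric, abs_def] w_def[symmetric, abs_def]
    by (intro exI[of _ u] exI[of _ w]) auto
qed

section \<open>Maximal solutions of the Riccati equation\<close>

lemma is_interval_Icc_subset:
  fixes I :: "real set"
  shows "is_interval I \<Longrightarrow> a \<in> I \<Longrightarrow> b \<in> I \<Longrightarrow> {a..b} \<subseteq> I"
  by (meson atLeastAtMost_iff is_interval_1 subsetI)

lemma open_interval_Sup:
  fixes I :: "real set"
  assumes I: "open I" "is_interval I" "s \<in> I" and ba: "bdd_above I"
  shows "s < Sup I" "Sup I \<notin> I" "\<And>t. s \<le> t \<Longrightarrow> t < Sup I \<Longrightarrow> t \<in> I"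
proof -
  show ni: "Sup I \<notin> I"
  proof
    assume "Sup I \<in> I"
    then obtain e where e: "e > 0" "cball (Sup I) e \<subseteq> I" using I(1) open_contains_cball by blast
    then have "Sup I + e \<in> I" by (auto simp: cball_eq_atLeastAtMost)
    then have "Sup I + e \<le> Sup I" by (rule cSup_upper[OF _ ba])
    then show False using e by simp
  qed
  show "s < Sup I" using I(3) ni cSup_upper[OF I(3) ba] by (cases "s = Sup I") auto
  fix t assume t: "s \<le> t" "t < Sup I"
  have "I \<noteq> {}" using I(3) by blast
  from less_cSupD[OF this t(2)] obtain c where c: "c \<in> I" "t < c" by blast
  then show "t \<in> I" using is_interval_Icc_subset[OF I(2,3) c(1)] t(1) by (simp add: subset_iff)
qed

lemma open_interval_Inf:
  fixes I :: "real set"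
  assumes I: "open I" "is_interval I" "s \<in> I" and ba: "bdd_below I"
  shows "Inf I < s" "Inf I \<notin> I" "\<And>t. t \<le> s \<Longrightarrow> Inf I < t \<Longrightarrow> t \<in> I"
proof -
  show ni: "Inf I \<notin> I"
  proof
    assume "Inf I \<in> I"
    then obtain e where e: "e > 0" "cball (Inf I) e \<subseteq> I" using I(1) open_contains_cball by blast
    then have "Inf I - e \<in> I" by (auto simp: cball_eq_atLeastAtMost)
    then have "Inf I \<le> Inf I - e" by (rule cInf_lower[OF _ ba])
    then show False using e by simp
  qed
  show "Inf I < s" using I(3) ni cInf_lower[OF I(3) ba] by (cases "s = Inf I") auto
  fix t assume t: "t \<le> s" "Inf I < t"
  have "I \<noteq> {}" using I(3) by blast
  from cInf_lessD[OF this t(2)] obtain c where c: "c \<in> I" "c < t" by blast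
  then show "t \<in> I" using is_interval_Icc_subset[OF I(2) c(1) I(3)] t(1) by (simp add: subset_iff)
qed

lemma interval_Ici_subset:
  fixes I :: "real set"
  assumes "is_interval I" "s \<in> I" "\<not> bdd_above I"
  shows "{s..} \<subseteq> I"
proof
  fix t assume t: "t \<in> {s..}"
  obtain c where c: "c \<in> I" "t < c" using assms(3) unfolding bdd_above_def by (meson not_le)
  then show "t \<in> I" using is_interval_Icc_subset[OF assms(1,2) c(1)] t by (simp add: subset_iff)
qed

lemma interval_Iic_subset:
  fixes I :: "real set"
  assumes "is_interval I" "s \<in> I" "\<not> bdd_below I"
  shows "{..s} \<subseteq> I"
proof
  fix t assume t: "t \<in> {..s}"
  obtain c where c: "c \<in> I" "c < t" using assms(3) unfolding bdd_below_def by (meson not_le)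
  then show "t \<in> I" using is_interval_Icc_subset[OF assms(1) c(1) assms(2)] t by (simp add: subset_iff)
qed

lemma interval_missing_right:
  fixes I :: "real set"
  assumes "is_interval I" "s \<in> I" "t \<notin> I" "s < t"
  shows "bdd_above I" "Sup I \<le> t"
proof -
  have *: "r \<le> t" if "r \<in> I" for r
  proof (rule ccontr)
    assume "\<not> r \<le> t"
    then show False using is_interval_Icc_subset[OF assms(1,2) that] assms(3,4) by (simp add: subset_iff)
  qed
  then show "bdd_above I" by (rule bdd_aboveI)
  show "Sup I \<le> t" using * assms(2) by (intro cSup_least) auto
qed

lemma interval_missing_left:
  fixes I :: "real set"
  assumes "is_interval I" "s \<in> I" "t \<notin> I" "t < s"
  shows "bdd_below I" "t \<le> Inf I"
proof -
  have *: "t \<le> r" if "r \<in> I" for r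
  proof (rule ccontr)
    assume "\<not> t \<le> r"
    then show False using is_interval_Icc_subset[OF assms(1) that assms(2)] assms(3,4) by (simp add: subset_iff)
  qed
  then show "bdd_below I" by (rule bdd_belowI)
  show "t \<le> Inf I" using * assms(2) by (intro cInf_greatest) auto
qed

lemma filterlim_at_bot_not_bounded_below:
  fixes x :: "real \<Rightarrow> real"
  assumes "filterlim x at_bot F" "F \<noteq> bot" "eventually (\<lambda>t. m \<le> x t) F" shows False
proof -
  have "eventually (\<lambda>t. x t \<le> m - 1) F" using assms(1) by (simp add: filterlim_at_bot)
  with assms(3) have "eventually (\<lambda>t. False) F" by eventually_elim simp
  then show False using assms(2) by simp
qed

lemma filterlim_at_top_not_bounded_above:
  fixes x :: "real \<Rightarrow> real"
  assumes "filterlim x at_top F" "F \<noteq> bot" "eventually (\<lambda>t. x t \<le> m) F" shows False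
proof -
  have "eventually (\<lambda>t. x t \<ge> m + 1) F" using assms(1) by (simp add: filterlim_at_top)
  with assms(3) have "eventually (\<lambda>t. False) F" by eventually_elim simp
  then show False using assms(2) by simp
qed

text \<open>At a finite right end of its interval the function tends to minus infinity, at a finite left end to
plus infinity. At infinite ends nothing is required.\<close>

definition blows_up :: "(real \<Rightarrow> real) \<Rightarrow> real set \<Rightarrow> bool" where
  "blows_up x I \<longleftrightarrow> (bdd_above I \<longrightarrow> filterlim x at_bot (at_left (Sup I))) \<and>
     (bdd_below I \<longrightarrow> filterlim x at_top (at_right (Inf I)))"

lemma blows_up_cong:
  assumes I: "open I" "is_interval I" "s \<in> I" and eq: "\<And>t. t \<in> I \<Longrightarrow> x t = y t" and b: "blows_up x I"
  shows "blows_up y I"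
  unfolding blows_up_def
proof (intro conjI impI)
  assume ba: "bdd_above I"
  note c = open_interval_Sup[OF I ba]
  have "eventually (\<lambda>t. x t = y t) (at_left (Sup I))"
    using eventually_at_left_real[OF c(1)] by eventually_elim (use c(3) eq in force)
  from filterlim_cong[OF refl refl this] show "filterlim y at_bot (at_left (Sup I))"
    using b ba by (simp add: blows_up_def)
next
  assume ba: "bdd_below I"
  note c = open_interval_Inf[OF I ba]
  have "eventually (\<lambda>t. x t = y t) (at_right (Inf I))"
    using eventually_at_right_real[OF c(1)] by eventually_elim (use c(3) eq in force)
  from filterlim_cong[OF refl refl this] show "filterlim y at_top (at_right (Inf I))"
    using b ba by (simp add: blows_up_def)
qed

text \<open>The equation \<open>x' = lam - h(t) - x\<^sup>2\<close> with a fixed forcing term. Here \<open>f\<close> is its right-hand side, \<open>H\<close>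
the tail integral of \<open>h\<close>, and \<open>k\<close> the positive equilibrium of the limiting equation.\<close>

locale riccati_eq =
  fixes lam :: real and h :: "real \<Rightarrow> real"
  assumes lam: "lam > 0" and h: "in_S UNIV h"
begin

abbreviation "f \<equiv> riccati lam h"
abbreviation "H \<equiv> tail h"
abbreviation "k \<equiv> sqrt lam"

lemma k_pos: "k > 0" using lam by simp

lemma k_sq: "k\<^sup>2 = lam" using lam by simp

text \<open>The classical form of the equation on a set \<open>I\<close>. It makes sense on sets that are not open
intervals; the derivative is always two-sided.\<close>

definition solves :: "(real \<Rightarrow> real) \<Rightarrow> real set \<Rightarrow> bool" where
  "solves x I \<longleftrightarrow> (\<forall>t\<in>I. ((\<lambda>t. x t - H t) has_real_derivative lam - (x t)\<^sup>2) (at t))"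

lemma solution_iff: "solution f x I \<longleftrightarrow> open I \<and> is_interval I \<and> I \<noteq> {} \<and> solves x I"
  using solution_riccati_iff[OF h] by (simp add: solves_def)

lemma solves_subset: "solves x I \<Longrightarrow> J \<subseteq> I \<Longrightarrow> solves x J"
  by (auto simp: solves_def)

lemma isCont_H: "isCont H t"
  using continuous_on_tail[OF h, of UNIV] by (simp add: continuous_on_eq_continuous_at)

lemma solves_isCont: assumes "solves x I" "t \<in> I" shows "isCont x t"
proof -
  have "isCont (\<lambda>t. x t - H t) t" using assms by (auto simp: solves_def intro: DERIV_isCont)
  from isCont_add[OF this isCont_H] show ?thesis by simp
qed

lemma solves_continuous_on: assumes "solves x I" "J \<subseteq> I" shows "continuous_on J x"
  using assms by (meson continuous_at_imp_continuous_on solves_isCont subsetD)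

lemma solves_cong:
  assumes "solves x I" "open I" "\<And>t. t \<in> I \<Longrightarrow> y t = x t" shows "solves y I"
  unfolding solves_def
proof
  fix t assume t: "t \<in> I"
  then have "((\<lambda>t. x t - H t) has_real_derivative lam - (x t)\<^sup>2) (at t)" using assms(1) by (auto simp: solves_def)
  then have "((\<lambda>t. y t - H t) has_real_derivative lam - (x t)\<^sup>2) (at t)"
    by (rule has_field_derivative_transform_within_open[OF _ assms(2) t]) (simp add: assms(3))
  then show "((\<lambda>t. y t - H t) has_real_derivative lam - (y t)\<^sup>2) (at t)" using assms(3)[OF t] by simp
qed

lemma solves_diff:
  assumes "solves x I" "solves z J" "t \<in> I \<inter> J"
  shows "((\<lambda>t. z t - x t) has_real_derivative - (x t + z t) * (z t - x t)) (at t)"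
proof -
  have "((\<lambda>t. z t - H t) has_real_derivative lam - (z t)\<^sup>2) (at t)"
    "((\<lambda>t. x t - H t) has_real_derivative lam - (x t)\<^sup>2) (at t)"
    using assms by (auto simp: solves_def)
  then have "((\<lambda>t. (z t - H t) - (x t - H t)) has_real_derivative (lam - (z t)\<^sup>2) - (lam - (x t)\<^sup>2)) (at t)"
    by (rule DERIV_diff)
  then show ?thesis by (simp add: algebra_simps power2_eq_square)
qed

lemma solves_mono_forward:
  assumes x: "solves x I" and z: "solves z J" and st: "s \<le> t" "{s..t} \<subseteq> I" "{s..t} \<subseteq> J"
  shows "x s \<le> z s \<Longrightarrow> x t \<le> z t" "x s < z s \<Longrightarrow> x t < z t"
proof -
  have c: "continuous_on {s..t} x" "continuous_on {s..t} z"
    using solves_continuous_on[OF x st(2)] solves_continuous_on[OF z st(3)] .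
  have *: "\<exists>D. ((\<lambda>t. z t - x t) has_real_derivative D) (at r) \<and> D \<ge> - (x r + z r) * (z r - x r)"
    if "s < r" "r < t" for r
  proof -
    have "r \<in> I \<inter> J" using st that by (auto simp: subset_iff)
    from solves_diff[OF x z this] show ?thesis by blast
  qed
  have cd: "continuous_on {s..t} (\<lambda>r. z r - x r)" "continuous_on {s..t} (\<lambda>r. x r + z r)"
    by (intro continuous_intros c)+
  show "x s \<le> z s \<Longrightarrow> x t \<le> z t" "x s < z s \<Longrightarrow> x t < z t"
    using linear_comparison_nonneg[OF st(1) cd *] by simp_all
qed

lemma solves_mono:
  assumes x: "solves x I" "is_interval I" and z: "solves z J" "is_interval J"
    and st: "s \<in> I \<inter> J" "t \<in> I \<inter> J"
  shows "x s \<le> z s \<Longrightarrow> x t \<le> z t" "x s < z s \<Longrightarrow> x t < z t"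
proof -
  have sub: "{s..t} \<subseteq> I" "{s..t} \<subseteq> J" "{t..s} \<subseteq> I" "{t..s} \<subseteq> J"
    using st is_interval_Icc_subset[OF x(2)] is_interval_Icc_subset[OF z(2)] by blast+
  show "x t \<le> z t" if "x s \<le> z s"
  proof (cases "s \<le> t")
    case True
    then show ?thesis using solves_mono_forward(1)[OF x(1) z(1) _ sub(1,2)] that by simp
  next
    case False
    show ?thesis
    proof (rule ccontr)
      assume "\<not> x t \<le> z t"
      then show False using solves_mono_forward(2)[OF z(1) x(1) _ sub(4,3)] False that by simp
    qed
  qed
  show "x t < z t" if "x s < z s"
  proof (cases "s \<le> t")
    case True
    then show ?thesis using solves_mono_forward(2)[OF x(1) z(1) _ sub(1,2)] that by simp
  next
    case False
    show ?thesis
    proof (rule ccontr)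
      assume "\<not> x t < z t"
      then show False using solves_mono_forward(1)[OF z(1) x(1) _ sub(4,3)] False that by simp
    qed
  qed
qed

lemma solves_unique:
  assumes "solves x I" "is_interval I" "solves z J" "is_interval J"
    and "s \<in> I \<inter> J" "t \<in> I \<inter> J" "x s = z s"
  shows "x t = z t"
  using solves_mono(1)[OF assms(1-6)] solves_mono(1)[OF assms(3,4,1,2), of s t] assms(5-7) by simp

text \<open>The substitution \<open>x = w / u + H\<close> with \<open>u' = H u + w\<close> and \<open>w' = (lam - H\<^sup>2) u - H w\<close>. The solution
through \<open>(s, x0)\<close> lives on the component of \<open>{u > 0}\<close> around \<open>s\<close>. At a boundary point \<open>u\<close> vanishes
while \<open>w\<close> does not, and the sign of \<open>w = u'\<close> there gives the direction of the blow-up.\<close>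

lemma solution_through_exists:
  "\<exists>x I. open I \<and> is_interval I \<and> s \<in> I \<and> x s = x0 \<and> solves x I \<and> blows_up x I"
proof -
  obtain M where M: "\<And>t. \<bar>H t\<bar> \<le> M" using tail_bounded[OF h] by blast
  have M0: "M \<ge> 0" using M[of 0] by linarith
  define L where "L = 1 + M + lam + M\<^sup>2"
  have H2: "\<bar>lam - (H t)\<^sup>2\<bar> \<le> lam + M\<^sup>2" for t
  proof -
    have "(H t)\<^sup>2 \<le> M\<^sup>2" using M[of t] by (simp add: abs_le_square_iff[symmetric] M0)
    moreover have "(H t)\<^sup>2 \<ge> 0" by simp
    ultimately show ?thesis using lam by linarith
  qed
  have HL: "\<bar>H t\<bar> \<le> L" "\<bar>1\<bar> \<le> L" "\<bar>lam - (H t)\<^sup>2\<bar> \<le> L" "\<bar>- H t\<bar> \<le> L" for t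
    using M[of t] M0 lam H2[of t] by (auto simp: L_def)
  have cH: "continuous_on UNIV H" by (rule continuous_on_tail[OF h])
  have "\<exists>u w. u s = 1 \<and> w s = x0 - H s \<and>
    (\<forall>t. (u has_real_derivative H t * u t + 1 * w t) (at t)) \<and>
    (\<forall>t. (w has_real_derivative (lam - (H t)\<^sup>2) * u t + (- H t) * w t) (at t))"
    by (rule planar_linear_system_exists[where L = L]) (use HL cH in \<open>auto intro!: continuous_intros\<close>)
  then obtain u w where uw: "u s = 1" "w s = x0 - H s"
    "\<And>t. (u has_real_derivative H t * u t + 1 * w t) (at t)"
    "\<And>t. (w has_real_derivative (lam - (H t)\<^sup>2) * u t + (- H t) * w t) (at t)"
    by blast
  have cu: "isCont u t" "isCont w t" for t using uw(3,4) by (auto intro: DERIV_isCont)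
  \<comment> \<open>\<open>N\<close> satisfies \<open>|N'| \<le> 4 L N\<close> and hence never vanishes\<close>
  define N where "N t = (u t)\<^sup>2 + (w t)\<^sup>2" for t
  define N' where "N' t = 2 * u t * (H t * u t + 1 * w t) + 2 * w t * ((lam - (H t)\<^sup>2) * u t + (- H t) * w t)" for t
  have N: "(N has_real_derivative N' t) (at t)" for t
    unfolding N_def[abs_def] N'_def by (rule derivative_eq_intros uw(3,4) refl)+ simp
  have N'b: "\<bar>N' t\<bar> \<le> 4 * L * N t" for t
  proof -
    have uw2: "2 * \<bar>u t * w t\<bar> \<le> N t" 
      using sum_squares_bound[of "\<bar>u t\<bar>" "\<bar>w t\<bar>"] by (simp add: N_def abs_mult)
    have "N' t = 2 * (H t * (u t)\<^sup>2) + (1 + (lam - (H t)\<^sup>2)) * (2 * (u t * w t)) - 2 * (H t * (w t)\<^sup>2)"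
      by (simp add: N'_def power2_eq_square algebra_simps)
    also have "\<bar>\<dots>\<bar> \<le> 2 * (\<bar>H t\<bar> * (u t)\<^sup>2) + \<bar>1 + (lam - (H t)\<^sup>2)\<bar> * (2 * \<bar>u t * w t\<bar>) + 2 * (\<bar>H t\<bar> * (w t)\<^sup>2)"
      by (rule order_trans[OF abs_triangle_ineq4] add_mono order_trans[OF abs_triangle_ineq])+ (auto simp: abs_mult)
    also have "\<dots> \<le> 2 * (L * (u t)\<^sup>2) + (2 * L) * N t + 2 * (L * (w t)\<^sup>2)"
    proof (intro add_mono mult_left_mono mult_right_mono mult_mono uw2)
      show "\<bar>1 + (lam - (H t)\<^sup>2)\<bar> \<le> 2 * L" using HL(2) HL(3)[of t] by linarith
    qed (use HL(2) HL(1)[of t] in \<open>auto simp: N_def\<close>)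
    also have "\<dots> = 4 * L * N t" by (simp add: N_def algebra_simps)
    finally show ?thesis .
  qed
  have Ns: "N s > 0" using uw(1) by (simp add: N_def add_pos_nonneg)
  have Npos: "N t > 0" for t
  proof (cases "s \<le> t")
    case True
    have "\<exists>D. (N has_real_derivative D) (at r) \<and> D \<ge> - (4 * L) * N r" for r
      using N N'b[of r] by (intro exI[of _ "N' r"]) (auto simp: abs_le_iff)
    then show ?thesis using linear_comparison_nonneg(2)[where p = s and q = t and d = N and c = "\<lambda>_. 4 * L"] True Ns
        continuous_at_imp_continuous_on[of "{s..t}" N] DERIV_isCont[OF N] by simp
  next
    case False
    have d: "((\<lambda>r. N (- r)) has_real_derivative - N' (- r)) (at r)" for r
      using N[of "- r"] by (simp add: DERIV_mirror)
    have "\<exists>D. ((\<lambda>r. N (- r)) has_real_derivative D) (at r) \<and> D \<ge> - (4 * L) * N (- r)" for r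
      using d N'b[of "- r"] by (intro exI[of _ "- N' (- r)"]) (auto simp: abs_le_iff)
    then have "N (- (- t)) > 0"
      using linear_comparison_nonneg(2)[where p = "- s" and q = "- t" and d = "\<lambda>r. N (- r)" and c = "\<lambda>_. 4 * L"]
        Ns False continuous_at_imp_continuous_on[of "{- s..- t}" "\<lambda>r. N (- r)"] DERIV_isCont[OF d] by simp
    then show ?thesis by simp
  qed
  define P where "P = {t. u t > 0}"
  have oP: "open P" unfolding P_def
    using cu(1) by (intro open_Collect_less continuous_at_imp_continuous_on) auto
  have sP: "s \<in> P" using uw(1) by (simp add: P_def)
  define I where "I = connected_component_set P s"
  have I: "open I" "is_interval I" "s \<in> I" "I \<subseteq> P"
    using open_connected_component[OF oP] sP connected_component_subset
    by (auto simp: I_def is_interval_connected_1)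
  have I_max: "C \<subseteq> I" if "connected C" "s \<in> C" "C \<subseteq> P" for C
    unfolding I_def by (rule connected_component_maximal[OF that(2,1,3)])
  have upos: "u t > 0" if "t \<in> I" for t using I that by (auto simp: P_def)
  have bdry: "u b = 0" if b: "b \<notin> I" "b \<in> closure I" for b
  proof -
    have "closure I \<subseteq> {t. u t \<ge> 0}"
    proof (rule closure_minimal)
      show "I \<subseteq> {t. u t \<ge> 0}" using upos less_imp_le by blast
      show "closed {t. u t \<ge> 0}" using cu(1) by (intro closed_Collect_le continuous_at_imp_continuous_on) auto
    qed
    then have "u b \<ge> 0" using b by blast
    moreover have "\<not> u b > 0"
    proof
      assume "u b > 0"
      then have "b \<in> P" by (simp add: P_def)
      then obtain e where e: "e > 0" "ball b e \<subseteq> P" using oP open_contains_ball by blast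
      obtain y where "y \<in> I" "dist y b < e" using b(2) e(1) unfolding closure_approachable by blast
      then have "ball b e \<inter> I \<noteq> {}" by (auto simp: dist_commute)
      moreover have "connected I" using I(2) by (simp add: is_interval_connected_1)
      ultimately have "connected (I \<union> ball b e)" by (intro connected_Un) auto
      then have "I \<union> ball b e \<subseteq> I" by (rule I_max) (use I e in auto)
      then have "b \<in> I" using centre_in_ball[of b e] e(1) by blast
      then show False using b(1) by simp
    qed
    ultimately show ?thesis by simp
  qed
  define x where "x t = w t / u t + H t" for t
  have "solves x I"
    unfolding solves_def
  proof
    fix t assume "t \<in> I"
    then have ut: "u t \<noteq> 0" using upos by force
    have "((\<lambda>t. w t / u t) has_real_derivative
       (((lam - (H t)\<^sup>2) * u t + (- H t) * w t) * u t - w t * (H t * u t + 1 * w t)) / (u t * u t)) (at t)"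
      by (rule DERIV_divide[OF uw(4) uw(3) ut])
    moreover have "(((lam - (H t)\<^sup>2) * u t + (- H t) * w t) * u t - w t * (H t * u t + 1 * w t)) / (u t * u t) = lam - (x t)\<^sup>2"
      using ut unfolding x_def by (simp add: field_simps power2_eq_square)
    ultimately show "((\<lambda>t. x t - H t) has_real_derivative lam - (x t)\<^sup>2) (at t)" by (simp add: x_def)
  qed
  moreover have "x s = x0" using uw(1,2) by (simp add: x_def)
  moreover have "filterlim x at_bot (at_left (Sup I))" if ba: "bdd_above I"
  proof -
    define b where "b = Sup I"
    have cl: "b \<in> closure I" unfolding b_def using closure_contains_Sup[OF _ ba] I by blast
    have bI: "b \<notin> I" and sb: "s < b" and inI: "\<And>t. s \<le> t \<Longrightarrow> t < b \<Longrightarrow> t \<in> I"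
      using open_interval_Sup[OF I(1-3) ba] by (simp_all add: b_def)
    have ub: "u b = 0" using bdry[OF bI cl] .
    have "w b \<noteq> 0" using Npos[of b] ub by (auto simp: N_def)
    moreover have "\<not> w b > 0"
    proof
      assume "w b > 0"
      then obtain d where d: "d > 0" "\<And>h. h > 0 \<Longrightarrow> h < d \<Longrightarrow> u (b - h) < u b"
        using DERIV_pos_inc_left[OF uw(3)[of b]] ub by auto
      define h' where "h' = min (d / 2) (b - s)"
      have "h' > 0" "h' < d" "s \<le> b - h'" using d sb by (auto simp: h'_def)
      then show False using d(2)[of h'] upos[OF inI[of "b - h'"]] ub by auto
    qed
    ultimately have wb: "w b < 0" by simp
    have ev: "eventually (\<lambda>t. t \<in> {s<..<b}) (at_left b)"
      using eventually_at_left_real[OF sb] .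
    have "filterlim (\<lambda>t. w t * inverse (u t)) at_bot (at_left b)"
    proof (rule filterlim_tendsto_neg_mult_at_bot[OF _ wb])
      show "(w \<longlongrightarrow> w b) (at_left b)" using cu(2)[of b] by (simp add: isCont_def filterlim_at_split)
      have "(u \<longlongrightarrow> 0) (at_left b)" using cu(1)[of b] ub by (simp add: isCont_def filterlim_at_split)
      moreover have "eventually (\<lambda>t. 0 < u t) (at_left b)"
        using ev by eventually_elim (use upos inI in auto)
      ultimately show "filterlim (\<lambda>t. inverse (u t)) at_top (at_left b)"
        by (rule filterlim_inverse_at_top)
    qed
    then have ev': "eventually (\<lambda>t. w t * inverse (u t) \<le> Z - M) (at_left b)" for Z by (simp add: filterlim_at_bot)
    have "eventually (\<lambda>t. x t \<le> Z) (at_left b)" for Z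
      using ev'[of Z]
    proof eventually_elim
      case (elim t)
      then show ?case using M[of t] by (simp add: x_def divide_inverse abs_le_iff)
    qed
    then show ?thesis unfolding b_def by (simp add: filterlim_at_bot)
  qed
  moreover have "filterlim x at_top (at_right (Inf I))" if ba: "bdd_below I"
  proof -
    define b where "b = Inf I"
    have cl: "b \<in> closure I" unfolding b_def using closure_contains_Inf[OF _ ba] I by blast
    have bI: "b \<notin> I" and sb: "b < s" and inI: "\<And>t. t \<le> s \<Longrightarrow> b < t \<Longrightarrow> t \<in> I"
      using open_interval_Inf[OF I(1-3) ba] by (simp_all add: b_def)
    have ub: "u b = 0" using bdry[OF bI cl] .
    have "w b \<noteq> 0" using Npos[of b] ub by (auto simp: N_def)
    moreover have "\<not> w b < 0"
    proof
      assume "w b < 0"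
      then obtain d where d: "d > 0" "\<And>h. h > 0 \<Longrightarrow> h < d \<Longrightarrow> u b > u (b + h)"
        using DERIV_neg_dec_right[OF uw(3)[of b]] ub by auto
      define h' where "h' = min (d / 2) (s - b)"
      have "h' > 0" "h' < d" "b + h' \<le> s" using d sb by (auto simp: h'_def)
      then show False using d(2)[of h'] upos[OF inI[of "b + h'"]] ub by auto
    qed
    ultimately have wb: "w b > 0" by simp
    have ev: "eventually (\<lambda>t. t \<in> {b<..<s}) (at_right b)"
      using eventually_at_right_real[OF sb] .
    have "filterlim (\<lambda>t. w t * inverse (u t)) at_top (at_right b)"
    proof (rule filterlim_tendsto_pos_mult_at_top[OF _ wb])
      show "(w \<longlongrightarrow> w b) (at_right b)" using cu(2)[of b] by (simp add: isCont_def filterlim_at_split)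
      have "(u \<longlongrightarrow> 0) (at_right b)" using cu(1)[of b] ub by (simp add: isCont_def filterlim_at_split)
      moreover have "eventually (\<lambda>t. 0 < u t) (at_right b)"
        using ev by eventually_elim (use upos inI in auto)
      ultimately show "filterlim (\<lambda>t. inverse (u t)) at_top (at_right b)"
        by (rule filterlim_inverse_at_top)
    qed
    then have ev': "eventually (\<lambda>t. w t * inverse (u t) \<ge> Z + M) (at_right b)" for Z by (simp add: filterlim_at_top)
    have "eventually (\<lambda>t. x t \<ge> Z) (at_right b)" for Z
      using ev'[of Z]
    proof eventually_elim
      case (elim t)
      then show ?case using M[of t] by (simp add: x_def divide_inverse abs_le_iff)
    qed
    then show ?thesis unfolding b_def by (simp add: filterlim_at_top)
  qed
  ultimately show ?thesis using I by (intro exI[of _ x] exI[of _ I]) (auto simp: blows_up_def)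
qed

lemma blows_up_no_extension:
  assumes x: "open I" "is_interval I" "s \<in> I" "blows_up x I"
    and y: "solves y J" "is_interval J" and IJ: "I \<subseteq> J" "\<And>t. t \<in> I \<Longrightarrow> y t = x t"
  shows "J = I"
proof (rule ccontr)
  assume "J \<noteq> I"
  then obtain t where t: "t \<in> J" "t \<notin> I" using IJ by blast
  have sJ: "s \<in> J" using x(3) IJ by blast
  have "t \<noteq> s" using t x(3) by blast
  then consider "s < t" | "t < s" by linarith
  then show False
  proof cases
    case 1
    note ba = interval_missing_right[OF x(2,3) t(2) 1]
    let ?b = "Sup I"
    note b = open_interval_Sup[OF x(1-3) ba(1)]
    have "?b \<in> J" using is_interval_Icc_subset[OF y(2) sJ t(1)] b(1) ba(2) by (simp add: subset_iff)
    then have "isCont y ?b" using solves_isCont[OF y(1)] by blast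
    then have "(y \<longlongrightarrow> y ?b) (at_left ?b)" by (simp add: isCont_def filterlim_at_split)
    then have "eventually (\<lambda>t. y ?b - 1 < y t) (at_left ?b)" by (rule order_tendstoD) simp
    moreover have "eventually (\<lambda>t. t \<in> {s<..<?b}) (at_left ?b)"
      using eventually_at_left_real[OF b(1)] .
    ultimately have "eventually (\<lambda>t. y ?b - 1 \<le> x t) (at_left ?b)"
      by eventually_elim (use b(3) IJ(2) in force)
    then show False using filterlim_at_bot_not_bounded_below[of x "at_left ?b"] x(4) ba(1)
      by (auto simp: blows_up_def)
  next
    case 2
    note ba = interval_missing_left[OF x(2,3) t(2) 2]
    let ?b = "Inf I"
    note b = open_interval_Inf[OF x(1-3) ba(1)]
    have "?b \<in> J" using is_interval_Icc_subset[OF y(2) t(1) sJ] b(1) ba(2) by (simp add: subset_iff)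
    then have "isCont y ?b" using solves_isCont[OF y(1)] by blast
    then have "(y \<longlongrightarrow> y ?b) (at_right ?b)" by (simp add: isCont_def filterlim_at_split)
    then have "eventually (\<lambda>t. y t < y ?b + 1) (at_right ?b)" by (rule order_tendstoD) simp
    moreover have "eventually (\<lambda>t. t \<in> {?b<..<s}) (at_right ?b)"
      using eventually_at_right_real[OF b(1)] .
    ultimately have "eventually (\<lambda>t. x t \<le> y ?b + 1) (at_right ?b)"
      by eventually_elim (use b(3) IJ(2) in force)
    then show False using filterlim_at_top_not_bounded_above[of x "at_right ?b"] x(4) ba(1)
      by (auto simp: blows_up_def)
  qed
qed

text \<open>A maximal solution is extended by the one from \<open>solution_through_exists\<close> with the same value at one
point, hence coincides with it.\<close>

theorem maximal_solution_iff:
  "maximal_solution f x I \<longleftrightarrow> open I \<and> is_interval I \<and> I \<noteq> {} \<and> solves x I \<and> blows_up x I"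
proof
  assume R: "open I \<and> is_interval I \<and> I \<noteq> {} \<and> solves x I \<and> blows_up x I"
  then obtain s where s: "s \<in> I" by blast
  have "\<not> (\<exists>y J. I \<subset> J \<and> solution f y J \<and> (\<forall>t\<in>I. y t = x t))"
  proof
    assume "\<exists>y J. I \<subset> J \<and> solution f y J \<and> (\<forall>t\<in>I. y t = x t)"
    then obtain y J where "I \<subset> J" "solves y J" "is_interval J" "\<forall>t\<in>I. y t = x t"
      by (auto simp: solution_iff)
    then show False using blows_up_no_extension[of I s x y J] R s by blast
  qed
  then show "maximal_solution f x I" using R by (simp add: maximal_solution_def solution_iff)
next
  assume L: "maximal_solution f x I"
  then have x: "open I" "is_interval I" "I \<noteq> {}" "solves x I" 
    and mx: "\<And>y J. I \<subset> J \<Longrightarrow> solution f y J \<Longrightarrow> \<forall>t\<in>I. y t = x t \<Longrightarrow> False"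
    unfolding maximal_solution_def solution_iff by blast+
  from x(3) obtain s where s: "s \<in> I" by blast
  obtain x' I' where x': "open I'" "is_interval I'" "s \<in> I'" "x' s = x s" "solves x' I'" "blows_up x' I'"
    using solution_through_exists[of s "x s"] by blast
  define z where "z t = (if t \<in> I then x t else x' t)" for t
  have eq: "x' t = x t" if "t \<in> I \<inter> I'" for t
    by (rule solves_unique[OF x'(5,2) x(4,2), of s]) (use s x' that in auto)
  have "solves z I" by (rule solves_cong[OF x(4,1)]) (simp add: z_def)
  moreover have "solves z I'" by (rule solves_cong[OF x'(5,1)]) (use eq in \<open>auto simp: z_def\<close>)
  ultimately have "solves z (I \<union> I')" by (auto simp: solves_def)
  moreover have "is_interval (I \<union> I')"
    using x(2) x'(2,3) s unfolding is_interval_connected_1 by (intro connected_Un) auto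
  ultimately have "solution f z (I \<union> I')" using x x' by (auto simp: solution_iff)
  then have "\<not> I \<subset> I \<union> I'" using mx[of "I \<union> I'" z] by (auto simp: z_def)
  then have sub: "I' \<subseteq> I" by blast
  then have "x t = x' t" if "t \<in> I'" for t using eq[of t] that by auto
  then have "I = I'" using blows_up_no_extension[OF x'(1-3,6) x(4,2) sub] by blast
  then have "blows_up x I" using blows_up_cong[OF x'(1-3) _ x'(6), of x] eq by auto
  then show "open I \<and> is_interval I \<and> I \<noteq> {} \<and> solves x I \<and> blows_up x I" using x by blast
qed

end

section \<open>Forward asymptotics and the lower solution\<close>

context riccati_eq
begin

lemma H_bound: obtains M where "M \<ge> 0" "\<And>t. \<bar>H t\<bar> \<le> M"
proof -
  obtain M where M: "\<And>t. \<bar>H t\<bar> \<le> M" using tail_bounded[OF h] by blast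
  then show thesis using that[of M] M[of 0] by fastforce
qed

lemma H_small_eventually:
  assumes "e > 0" shows "eventually (\<lambda>t. \<bar>H t\<bar> < e) at_top"
  using tendstoD[OF tail_tendsto_0[OF h] assms] by (simp add: dist_real_def)

lemma forward_global_if_bounded_below:
  assumes x: "open I" "is_interval I" "s \<in> I" "blows_up x I"
    and m: "\<And>t. t \<in> I \<Longrightarrow> s \<le> t \<Longrightarrow> m \<le> x t"
  shows "{s..} \<subseteq> I"
proof (rule ccontr)
  assume "\<not> {s..} \<subseteq> I"
  then have ba: "bdd_above I" using interval_Ici_subset[OF x(2,3)] by metis
  note c = open_interval_Sup[OF x(1-3) ba]
  have "eventually (\<lambda>t. m \<le> x t) (at_left (Sup I))"
    using eventually_at_left_real[OF c(1)] by eventually_elim (use c(3) m in simp)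
  then show False using filterlim_at_bot_not_bounded_below[of x "at_left (Sup I)"] x(4) ba
    by (auto simp: blows_up_def)
qed

text \<open>A solution starting above one that survives forward survives as well, since its only possible
forward blow-up is towards minus infinity.\<close>

lemma above_solution_global:
  assumes x: "open I" "is_interval I" "s \<in> I" "blows_up x I" "solves x I"
    and z: "solves z J" "{s..} \<subseteq> J" "z s \<le> x s"
  shows "{s..} \<subseteq> I" "\<And>t. t \<ge> s \<Longrightarrow> z t \<le> x t"
proof -
  have le: "z t \<le> x t" if "t \<in> I" "s \<le> t" for t
  proof (rule solves_mono_forward(1)[OF z(1) x(5) that(2) _ _ z(3)])
    show "{s..t} \<subseteq> J" using z(2) by auto
    show "{s..t} \<subseteq> I" using is_interval_Icc_subset[OF x(2,3) that(1)] .
  qed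
  show sub: "{s..} \<subseteq> I"
  proof (rule ccontr)
    assume "\<not> {s..} \<subseteq> I"
    then obtain c where c: "c \<ge> s" "c \<notin> I" by auto
    then have "s \<noteq> c" using x(3) by blast
    then have sc: "s < c" using c by simp
    have "continuous_on {s..c} z" by (rule solves_continuous_on[OF z(1)]) (use z(2) in auto)
    then obtain B where B: "\<And>r. r \<in> {s..c} \<Longrightarrow> \<bar>z r\<bar> \<le> B" using continuous_on_Icc_bounded by blast
    note ba = interval_missing_right[OF x(2,3) c(2) sc]
    note S = open_interval_Sup[OF x(1-3) ba(1)]
    have "eventually (\<lambda>t. - B \<le> x t) (at_left (Sup I))"
      using eventually_at_left_real[OF S(1)]
    proof eventually_elim
      case (elim t)
      then have "t \<in> I" using S(3) by simp
      moreover have "t \<in> {s..c}" using elim ba(2) by simp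
      ultimately show ?case using le[of t] B[of t] elim by (simp add: abs_le_iff)
    qed
    then show False using filterlim_at_bot_not_bounded_below[of x "at_left (Sup I)"] x(4) ba(1)
      by (auto simp: blows_up_def)
  qed
  show "z t \<le> x t" if "t \<ge> s" for t using le sub that by auto
qed

lemma solves_Y:
  assumes "solves x I" "t \<in> I"
  shows "((\<lambda>t. x t - H t) has_real_derivative lam - ((x t - H t) + H t)\<^sup>2) (at t)"
  using assms by (simp add: solves_def)

lemma forward_lower_bound:
  assumes x: "solves x I" "{s..} \<subseteq> I" and M: "\<And>t. \<bar>H t\<bar> \<le> M" and "s \<le> t"
  shows "x t \<ge> - (3 * M + 2 * k + 1)"
proof -
  have "x t - H t \<ge> - (2 * M + 2 * sqrt (lam / 1) + 1)"
  proof (rule riccati_forward_lower_bound[where Y = "\<lambda>t. x t - H t" and G = H and s = s and \<mu> = 1])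
    show "continuous_on {s..} (\<lambda>t. x t - H t)"
      by (intro continuous_intros solves_continuous_on[OF x] continuous_on_tail h)
    show "((\<lambda>t. x t - H t) has_real_derivative lam - 1 * ((x t - H t) + H t)\<^sup>2) (at t)" if "t > s" for t
      using solves_Y[OF x(1), of t] x(2) that by (simp add: subset_iff)
  qed (use M lam assms(4) in auto)
  then show ?thesis using M[of t] by (simp add: abs_le_iff)
qed

lemma forward_upper_bound:
  assumes x: "solves x I" "{s..} \<subseteq> I" and M: "\<And>t. \<bar>H t\<bar> \<le> M" and st: "s \<le> t"
  shows "x t \<le> max (x s - H s) (k + M) + M + 1"
proof -
  define c where "c = - (max (x s - H s) (k + M) + 1)"
  have M0: "M \<ge> 0" using M[of 0] by linarith
  have "- (x t - H t) \<ge> c"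
  proof (rule barrier_below[where y = "\<lambda>t. - (x t - H t)", OF st])
    show "continuous_on {s..t} (\<lambda>t. - (x t - H t))"
      by (intro continuous_intros solves_continuous_on[OF x(1)] continuous_on_tail h) (use x(2) in auto)
    show "- (x s - H s) > c" by (simp add: c_def)
    fix r assume r: "s < r" "r < t" "- (x r - H r) = c"
    then have "x r - H r \<ge> k + M + 1" by (simp add: c_def)
    then have "x r \<ge> k + 1" using M[of r] by (simp add: abs_le_iff)
    then have "(x r)\<^sup>2 > k\<^sup>2" using k_pos by (intro power_strict_mono) auto
    moreover have "((\<lambda>t. - (x t - H t)) has_real_derivative - (lam - (x r)\<^sup>2)) (at r)"
      using x r by (intro DERIV_minus) (auto simp: solves_def subset_iff)
    ultimately show "\<exists>D>0. ((\<lambda>t. - (x t - H t)) has_real_derivative D) (at r)"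
      using k_sq by (intro exI[of _ "- (lam - (x r)\<^sup>2)"]) auto
  qed
  then show ?thesis using M[of t] by (simp add: c_def abs_le_iff)
qed

lemma forward_global_bounded:
  assumes x: "solves x I" "{s..} \<subseteq> I"
  shows "bounded (x ` {s..})"
proof -
  obtain M where M: "M \<ge> 0" "\<And>t. \<bar>H t\<bar> \<le> M" using H_bound by blast
  have "norm (x t) \<le> max (3 * M + 2 * k + 1) (max (x s - H s) (k + M) + M + 1)" if "t \<in> {s..}" for t
    using forward_lower_bound[OF x M(2), of t] forward_upper_bound[OF x M(2), of t] that by auto
  then show ?thesis unfolding bounded_iff by blast
qed

text \<open>For \<open>Y = x - H\<close> one has \<open>Y' = k\<^sup>2 - (Y + H)\<^sup>2\<close> with \<open>H\<close> tending to zero: eventually \<open>Y \<le> k + \<epsilon>\<close>;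
also \<open>Y \<ge> - k - \<epsilon>\<close>, as otherwise \<open>Y\<close> would be unbounded below; and if \<open>Y\<close> is above \<open>- k + \<epsilon>\<close> at
some late time, it climbs to \<open>k - \<epsilon>\<close> and stays above it.\<close>

lemma forward_dichotomy:
  assumes x: "solves x I" "{s..} \<subseteq> I"
  shows "(x \<longlongrightarrow> k) at_top \<or> (x \<longlongrightarrow> - k) at_top"
proof -
  define Y where "Y t = x t - H t" for t
  have Y: "(Y has_real_derivative lam - (Y t + H t)\<^sup>2) (at t)" if "t \<ge> s" for t
    unfolding Y_def using solves_Y[OF x(1)] x(2) that by auto
  have Y_neg: "((\<lambda>t. - Y t) has_real_derivative (Y t + H t)\<^sup>2 - lam) (at t)" if "t \<ge> s" for t
    using DERIV_minus[OF Y[OF that]] by simp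
  obtain M where M: "M \<ge> 0" "\<And>t. \<bar>H t\<bar> \<le> M" using H_bound by blast
  define B where "B = 4 * M + 2 * k + 1"
  have YB: "Y t \<ge> - B" if "t \<ge> s" for t
    using forward_lower_bound[OF x M(2) that] M(2)[of t] by (simp add: Y_def B_def abs_le_iff)
  have T: "\<exists>T\<ge>s. \<forall>t\<ge>T. \<bar>H t\<bar> < \<epsilon> / 2" if "\<epsilon> > 0" for \<epsilon>
  proof -
    obtain T where "\<And>t. t \<ge> T \<Longrightarrow> \<bar>H t\<bar> < \<epsilon> / 2"
      using H_small_eventually[of "\<epsilon> / 2"] \<open>\<epsilon> > 0\<close> unfolding eventually_at_top_linorder by auto
    then show ?thesis by (intro exI[of _ "max s T"]) auto
  qed
  have big: "k * \<epsilon> \<le> (y + e)\<^sup>2 - lam" if "k + \<epsilon> \<le> \<bar>y\<bar>" "\<bar>e\<bar> < \<epsilon> / 2" "\<epsilon> > 0" for y e \<epsilon>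
  proof -
    have "k + \<epsilon> / 2 \<le> \<bar>y + e\<bar>" using that by linarith
    then have "(k + \<epsilon> / 2)\<^sup>2 \<le> \<bar>y + e\<bar>\<^sup>2" using k_pos that by (intro power_mono) auto
    moreover have "(k + \<epsilon> / 2)\<^sup>2 = lam + k * \<epsilon> + \<epsilon>\<^sup>2 / 4"
      using k_sq by (simp add: power2_eq_square field_simps)
    moreover have "\<epsilon>\<^sup>2 / 4 \<ge> 0" by simp
    ultimately show ?thesis unfolding power2_abs by linarith
  qed
  have small: "k * \<epsilon> / 2 \<le> lam - (y + e)\<^sup>2" if "\<bar>y\<bar> \<le> k - \<epsilon>" "\<bar>e\<bar> < \<epsilon> / 2" "\<epsilon> > 0" "\<epsilon> < k" for y e \<epsilon>
  proof -
    have "\<bar>y + e\<bar> \<le> k - \<epsilon> / 2" using that by linarith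
    then have "\<bar>y + e\<bar>\<^sup>2 \<le> (k - \<epsilon> / 2)\<^sup>2" by (intro power_mono) auto
    moreover have "(k - \<epsilon> / 2)\<^sup>2 = lam - k * \<epsilon> + \<epsilon> * \<epsilon> / 4"
      using k_sq by (simp add: power2_eq_square field_simps)
    moreover have "\<epsilon> * \<epsilon> \<le> k * \<epsilon>" using that by (intro mult_right_mono) auto
    moreover have "k * \<epsilon> > 0" using that k_pos by simp
    ultimately show ?thesis unfolding power2_abs by linarith
  qed
  have up: "eventually (\<lambda>t. Y t \<le> k + \<epsilon>) at_top" if \<epsilon>: "\<epsilon> > 0" for \<epsilon>
  proof -
    obtain T where T: "T \<ge> s" "\<And>t. t \<ge> T \<Longrightarrow> \<bar>H t\<bar> < \<epsilon> / 2" using T[OF \<epsilon>] by blast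
    have "eventually (\<lambda>t. - Y t \<ge> - (k + \<epsilon>)) at_top"
    proof (rule eventually_above[where Y = "\<lambda>t. - Y t" and T = T and l = "min (- Y T) (- (k + \<epsilon>)) - 1" and c = "k * \<epsilon>"])
      show "k * \<epsilon> \<le> (Y t + H t)\<^sup>2 - lam" if "t \<ge> T" "- Y t \<le> - (k + \<epsilon>)" for t
        using big[OF _ T(2)[OF that(1)] \<epsilon>, of "Y t"] that by simp
    qed (use Y_neg T k_pos \<epsilon> in auto)
    then show ?thesis by eventually_elim simp
  qed
  have lo: "\<exists>T\<ge>s. \<forall>t\<ge>T. Y t \<ge> - (k + \<epsilon>)" if \<epsilon>: "\<epsilon> > 0" for \<epsilon>
  proof -
    obtain T where T: "T \<ge> s" "\<And>t. t \<ge> T \<Longrightarrow> \<bar>H t\<bar> < \<epsilon> / 2" using T[OF \<epsilon>] by blast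
    have "Y t1 \<ge> - (k + \<epsilon>)" if t1: "t1 \<ge> T" for t1
    proof (rule ccontr)
      assume "\<not> Y t1 \<ge> - (k + \<epsilon>)"
      then have neg: "- Y t1 > k + \<epsilon>" by simp
      have "eventually (\<lambda>t. - Y t \<ge> max B (k + \<epsilon>) + 1) at_top"
      proof (rule eventually_above[where Y = "\<lambda>t. - Y t" and T = t1 and l = "k + \<epsilon>" and c = "k * \<epsilon>"])
        show "k * \<epsilon> \<le> (Y t + H t)\<^sup>2 - lam" if "t \<ge> t1" "k + \<epsilon> \<le> - Y t" for t
          using big[OF _ T(2) \<epsilon>, of "Y t" t] that t1 by simp
      qed (use Y_neg T t1 k_pos \<epsilon> neg in auto)
      then have "eventually (\<lambda>t. t \<ge> s \<and> - Y t \<ge> B + 1) at_top"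
        using eventually_ge_at_top[of s] by eventually_elim auto
      then obtain t where "t \<ge> s" "- Y t \<ge> B + 1"
        by (metis (mono_tags, lifting) eventually_happens trivial_limit_at_top_linorder)
      then show False using YB[of t] by simp
    qed
    then show ?thesis using T(1) by blast
  qed
  have mid: "eventually (\<lambda>t. Y t \<ge> k - \<epsilon>) at_top"
    if \<epsilon>: "0 < \<epsilon>" "\<epsilon> < k" and fr: "\<exists>\<^sub>F t in at_top. Y t > - k + \<epsilon>" for \<epsilon>
  proof -
    obtain T where T: "T \<ge> s" "\<And>t. t \<ge> T \<Longrightarrow> \<bar>H t\<bar> < \<epsilon> / 2" using T[OF \<epsilon>(1)] by blast
    have "\<exists>\<^sub>F t in at_top. Y t > - k + \<epsilon> \<and> t \<ge> T"
      using frequently_eventually_conj[OF fr eventually_ge_at_top[of T]] by (simp add: conj_commute)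
    then obtain t1 where t1: "t1 \<ge> T" "Y t1 > - k + \<epsilon>" using frequently_ex by blast
    show ?thesis
    proof (rule eventually_above[where T = t1 and l = "- k + \<epsilon>" and c = "k * \<epsilon> / 2"])
      show "k * \<epsilon> / 2 \<le> lam - (Y t + H t)\<^sup>2" if "t \<ge> t1" "- k + \<epsilon> \<le> Y t" "Y t \<le> k - \<epsilon>" for t
        using small[OF _ T(2) \<epsilon>, of "Y t" t] that t1 by (simp add: abs_le_iff)
    qed (use Y T t1 k_pos \<epsilon> in auto)
  qed
  have conv: "(x \<longlongrightarrow> c) at_top" if "(Y \<longlongrightarrow> c) at_top" for c
    using tendsto_add[OF that tail_tendsto_0[OF h]] by (simp add: Y_def)
  show ?thesis
  proof (cases "\<exists>\<epsilon>0. 0 < \<epsilon>0 \<and> \<epsilon>0 < k \<and> (\<exists>\<^sub>F t in at_top. Y t > - k + \<epsilon>0)")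
    case True
    then obtain \<epsilon>0 where e0: "0 < \<epsilon>0" "\<epsilon>0 < k" "\<exists>\<^sub>F t in at_top. Y t > - k + \<epsilon>0" by blast
    have "(Y \<longlongrightarrow> k) at_top"
    proof (rule tendstoI)
      fix e :: real assume e: "e > 0"
      define \<epsilon> where "\<epsilon> = min \<epsilon>0 e / 2"
      have \<epsilon>: "0 < \<epsilon>" "\<epsilon> < k" "\<epsilon> < e" "\<epsilon> < \<epsilon>0" using e0 e by (auto simp: \<epsilon>_def min_def)
      have "\<exists>\<^sub>F t in at_top. Y t > - k + \<epsilon>"
        by (rule frequently_elim1[OF e0(3)]) (use \<epsilon> in linarith)
      from mid[OF \<epsilon>(1,2) this] up[OF \<epsilon>(1)]
      show "eventually (\<lambda>t. dist (Y t) k < e) at_top"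
        by eventually_elim (use \<epsilon> in \<open>auto simp: dist_real_def abs_less_iff\<close>)
    qed
    then show ?thesis using conv by blast
  next
    case False
    have "(Y \<longlongrightarrow> - k) at_top"
    proof (rule tendstoI)
      fix e :: real assume e: "e > 0"
      define \<epsilon> where "\<epsilon> = min k e / 2"
      have \<epsilon>: "0 < \<epsilon>" "\<epsilon> < k" "\<epsilon> < e" using k_pos e by (auto simp: \<epsilon>_def min_def)
      have "eventually (\<lambda>t. \<not> Y t > - k + \<epsilon>) at_top" using False \<epsilon> by (auto simp: not_frequently)
      moreover have "eventually (\<lambda>t. Y t \<ge> - (k + \<epsilon>)) at_top"
        using lo[OF \<epsilon>(1)] unfolding eventually_at_top_linorder by blast
      ultimately show "eventually (\<lambda>t. dist (Y t) (- k) < e) at_top"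
        by eventually_elim (use \<epsilon> in \<open>auto simp: dist_real_def abs_less_iff\<close>)
    qed
    then show ?thesis using conv by blast
  qed
qed

text \<open>The difference \<open>d\<close> of two solutions satisfies \<open>d' = - (x + z) d\<close>. It grows once \<open>x + z < 0\<close>, and so
cannot tend to zero unless it vanishes.\<close>

lemma tendsto_minus_k_unique:
  assumes x: "solves x I" "{s..} \<subseteq> I" "(x \<longlongrightarrow> - k) at_top"
    and z: "solves z J" "{s..} \<subseteq> J" "(z \<longlongrightarrow> - k) at_top"
  shows "x s = z s"
proof -
  have main: False if x: "solves x I" "{s..} \<subseteq> I" "(x \<longlongrightarrow> - k) at_top"
    and z: "solves z J" "{s..} \<subseteq> J" "(z \<longlongrightarrow> - k) at_top" and lt: "x s < z s" for x z I J
  proof -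
    have pos: "x t < z t" if "t \<ge> s" for t
      by (rule solves_mono_forward(2)[OF x(1) z(1) that _ _ lt]) (use x(2) z(2) in auto)
    have "((\<lambda>t. x t + z t) \<longlongrightarrow> - k + - k) at_top" by (intro tendsto_add x z)
    then have "eventually (\<lambda>t. x t + z t < 0) at_top"
      by (rule order_tendstoD) (use k_pos in simp)
    then obtain T0 where T0: "\<And>t. t \<ge> T0 \<Longrightarrow> x t + z t < 0" unfolding eventually_at_top_linorder by blast
    define T where "T = max s T0"
    have "z T - x T \<le> z t - x t" if "t \<ge> T" for t
    proof (rule DERIV_nonneg_imp_nondecreasing[OF that])
      fix r assume r: "T \<le> r" "r \<le> t"
      then have rr: "r \<ge> s" "r \<ge> T0" by (auto simp: T_def)
      have "((\<lambda>t. z t - x t) has_real_derivative - (x r + z r) * (z r - x r)) (at r)"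
        by (rule solves_diff[OF x(1) z(1)]) (use rr x(2) z(2) in auto)
      moreover have "- (x r + z r) * (z r - x r) \<ge> 0"
        using T0[OF rr(2)] pos[OF rr(1)] by (intro mult_nonneg_nonneg) auto
      ultimately show "\<exists>y. ((\<lambda>t. z t - x t) has_real_derivative y) (at r) \<and> 0 \<le> y" by blast
    qed
    then have "eventually (\<lambda>t. z T - x T \<le> z t - x t) at_top"
      unfolding eventually_at_top_linorder by blast
    moreover have "((\<lambda>t. z t - x t) \<longlongrightarrow> - k - - k) at_top" by (intro tendsto_diff x z)
    ultimately have "z T - x T \<le> - k - - k" by (intro tendsto_lowerbound) auto
    then show False using pos[of T] by (simp add: T_def)
  qed
  show ?thesis using main[OF x z] main[OF z x] by (cases "x s" "z s" rule: linorder_cases) auto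
qed

lemma attracting_solution_exists:
  "\<exists>x I s. open I \<and> is_interval I \<and> {s..} \<subseteq> I \<and> solves x I \<and> (x \<longlongrightarrow> k) at_top"
proof -
  obtain s where s: "\<And>t. t \<ge> s \<Longrightarrow> \<bar>H t\<bar> < k / 2"
    using H_small_eventually[of "k / 2"] k_pos unfolding eventually_at_top_linorder by auto
  obtain x I where x: "open I" "is_interval I" "s \<in> I" "x s = H s + 1" "solves x I" "blows_up x I"
    using solution_through_exists[of s "H s + 1"] by blast
  have Y0: "x t - H t \<ge> 0" if t: "t \<in> I" "s \<le> t" for t
  proof (rule barrier_below[where y = "\<lambda>t. x t - H t", OF t(2)])
    have sub: "{s..t} \<subseteq> I" by (rule is_interval_Icc_subset[OF x(2,3) t(1)])
    show "continuous_on {s..t} (\<lambda>t. x t - H t)"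
      by (intro continuous_intros solves_continuous_on[OF x(5) sub] continuous_on_tail h)
    show "x s - H s > 0" using x(4) by simp
    fix r assume r: "s < r" "r < t" "x r - H r = 0"
    then have "\<bar>x r\<bar> < k" using s[of r] k_pos by simp
    then have "\<bar>x r\<bar>\<^sup>2 < k\<^sup>2" by (intro power_strict_mono) auto
    then have "(x r)\<^sup>2 < k\<^sup>2" by simp
    moreover have "r \<in> I" using sub r by (auto simp: subset_iff)
    ultimately show "\<exists>D>0. ((\<lambda>t. x t - H t) has_real_derivative D) (at r)"
      using x(5) k_sq by (intro exI[of _ "lam - (x r)\<^sup>2"]) (auto simp: solves_def)
  qed
  have xm: "- (k / 2) \<le> x t" if "t \<in> I" "s \<le> t" for t
    using Y0[OF that] s[OF that(2)] by (simp add: abs_less_iff)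
  have sub: "{s..} \<subseteq> I" by (rule forward_global_if_bounded_below[OF x(1-3,6) xm])
  have "\<not> (x \<longlongrightarrow> - k) at_top"
  proof
    assume "(x \<longlongrightarrow> - k) at_top"
    moreover have "eventually (\<lambda>t. - (k / 2) \<le> x t) at_top"
      using eventually_ge_at_top[of s] by eventually_elim (use xm sub in auto)
    ultimately have "- (k / 2) \<le> - k" by (intro tendsto_lowerbound) auto
    then show False using k_pos by simp
  qed
  then show ?thesis using forward_dichotomy[OF x(5) sub] x sub by blast
qed

text \<open>Reduction of order: from a solution \<open>xd\<close> tending to \<open>k\<close> put \<open>E = exp (2 \<integral> xd)\<close> and
\<open>p(t) = E(t) \<integral>\<^sub>t\<^sup>\<infinity> 1 / E\<close>. Then \<open>p' = 2 xd p - 1\<close>, so \<open>xd - 1 / p\<close> is a second solution. It stays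
away from \<open>xd\<close> because \<open>p \<le> 1 / k\<close>, and the dichotomy leaves \<open>- k\<close> as its limit.\<close>

lemma repelling_solution_near_infinity:
  "\<exists>r s. solves r {s<..} \<and> (r \<longlongrightarrow> - k) at_top"
proof -
  obtain xd I s0 where xd: "{s0..} \<subseteq> I" "solves xd I" "(xd \<longlongrightarrow> k) at_top"
    using attracting_solution_exists by blast
  have "eventually (\<lambda>t. k / 2 < xd t) at_top" using order_tendstoD(1)[OF xd(3), of "k / 2"] k_pos by simp
  then obtain s1 where s1: "\<And>t. t \<ge> s1 \<Longrightarrow> k / 2 < xd t" unfolding eventually_at_top_linorder by blast
  define s where "s = max s0 s1"
  have s: "t \<in> I" "k / 2 < xd t" if "t \<ge> s" for t using that xd(1) s1 by (auto simp: s_def)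
  have cxd: "continuous_on {a..b} xd" if "a \<ge> s" for a b
    by (rule solves_continuous_on[OF xd(2)]) (use s(1) that in auto)
  have integral_deriv: "((\<lambda>t. integral {s..t} q) has_real_derivative q t) (at t)"
    if "t > s" "\<And>b. continuous_on {s..b} q" for q t
  proof -
    have "((\<lambda>t. integral {s..t} q) has_real_derivative q t) (at t within {s..t + 1})"
      by (rule integral_has_real_derivative[OF that(2)]) (use that in auto)
    then show ?thesis using that(1) by (simp add: at_within_Icc_at)
  qed
  have integral_cont: "continuous_on {s..b} (\<lambda>t. integral {s..t} q)"
    if "\<And>b. continuous_on {s..b} q" for q :: "real \<Rightarrow> real" and b
    using integral_has_real_derivative[OF that[of b]] by (rule DERIV_continuous_on)
  define E where "E t = exp (2 * integral {s..t} xd)" for t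
  have cE: "continuous_on {s..b} E" for b
    unfolding E_def by (intro continuous_intros integral_cont cxd) simp
  have E: "(E has_real_derivative 2 * xd t * E t) (at t)" if "t > s" for t
    unfolding E_def using integral_deriv[OF that cxd] by (auto intro!: derivative_eq_intros)
  have Epos: "E t > 0" for t by (simp add: E_def)
  define F where "F t = integral {s..t} (\<lambda>r. inverse (E r))" for t
  have ciE: "continuous_on {s..b} (\<lambda>r. inverse (E r))" for b
    using Epos by (intro continuous_intros cE) (metis less_irrefl)
  have F: "(F has_real_derivative inverse (E t)) (at t)" if "t > s" for t
    unfolding F_def using integral_deriv[OF that ciE] .
  have cF: "continuous_on {s..b} F" for b unfolding F_def by (rule integral_cont[OF ciE])
  have F_less: "F a < F b" if "s \<le> a" "a < b" for a b
  proof (rule DERIV_pos_imp_increasing_open[OF that(2)])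
    show "\<exists>y. (F has_real_derivative y) (at x) \<and> 0 < y" if "a < x" "x < b" for x
      using F[of x] Epos[of x] that \<open>s \<le> a\<close> by (intro exI[of _ "inverse (E x)"]) auto
    show "continuous_on {a..b} F" by (rule continuous_on_subset[OF cF[of b]]) (use that in auto)
  qed
  have F_bound: "F b - F a \<le> inverse (E a) / k" if "s \<le> a" "a \<le> b" for a b
  proof -
    have "- (F a + inverse (E a) / k) \<le> - (F b + inverse (E b) / k)"
    proof (rule DERIV_nonneg_imp_increasing_open[OF that(2)])
      fix r assume r: "a < r" "r < b"
      then have rs: "r > s" using that by simp
      have "((\<lambda>t. - (F t + inverse (E t) / k)) has_real_derivative
         - (inverse (E r) + - (inverse (E r) * (2 * xd r * E r) * inverse (E r)) / k)) (at r)"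
        using Epos[of r] by (intro DERIV_minus DERIV_add F[OF rs] DERIV_cdivide DERIV_inverse' E[OF rs]) simp
      moreover have "- (inverse (E r) + - (inverse (E r) * (2 * xd r * E r) * inverse (E r)) / k)
         = inverse (E r) * ((2 * xd r - k) / k)"
        using Epos[of r] k_pos by (simp add: field_simps)
      moreover have "\<dots> \<ge> 0" using Epos[of r] k_pos s(2)[of r] rs
        by (intro mult_nonneg_nonneg divide_nonneg_pos) auto
      ultimately show "\<exists>y. ((\<lambda>t. - (F t + inverse (E t) / k)) has_real_derivative y) (at r) \<and> 0 \<le> y"
        by auto
    next
      have c1: "continuous_on {a..b} F" by (rule continuous_on_subset[OF cF[of b]]) (use that in auto)
      have c2: "continuous_on {a..b} (\<lambda>r. inverse (E r))"
        by (rule continuous_on_subset[OF ciE[of b]]) (use that in auto)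
      show "continuous_on {a..b} (\<lambda>t. - (F t + inverse (E t) / k))"
        by (rule continuous_on_minus continuous_on_add continuous_on_divide continuous_on_const c1 c2)+ (use k_pos in auto)
    qed
    moreover have "inverse (E b) / k > 0" using Epos[of b] k_pos by simp
    ultimately show ?thesis by linarith
  qed
  define L where "L = (SUP t\<in>{s..}. F t)"
  have "F t \<le> F s + inverse (E s) / k" if "t \<ge> s" for t using F_bound[of s t] that by simp
  then have bddF: "bdd_above (F ` {s..})" by (intro bdd_aboveI[of _ "F s + inverse (E s) / k"]) auto
  have L1: "F t < L" if "t \<ge> s" for t
  proof -
    have "F t < F (t + 1)" using F_less[of t "t + 1"] that by simp
    also have "\<dots> \<le> L" unfolding L_def by (rule cSUP_upper[OF _ bddF]) (use that in simp)
    finally show ?thesis .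
  qed
  have L2: "L - F a \<le> inverse (E a) / k" if "a \<ge> s" for a
  proof -
    have "L \<le> F a + inverse (E a) / k" unfolding L_def
    proof (rule cSUP_least)
      fix b assume "b \<in> {s..}"
      then show "F b \<le> F a + inverse (E a) / k"
        using F_bound[of a b] F_less[of b a] that Epos[of a] k_pos by (cases "a \<le> b") (auto intro: order_trans[OF less_imp_le])
    qed simp
    then show ?thesis by simp
  qed
  define p where "p t = E t * (L - F t)" for t
  have ppos: "p t > 0" if "t \<ge> s" for t using Epos[of t] L1[OF that] by (simp add: p_def)
  have pk: "p t \<le> 1 / k" if "t \<ge> s" for t
    using mult_left_mono[OF L2[OF that] less_imp_le[OF Epos[of t]]] Epos[of t] by (simp add: p_def)
  have p: "(p has_real_derivative 2 * xd t * p t - 1) (at t)" if "t > s" for t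
  proof -
    have "(p has_real_derivative 2 * xd t * E t * (L - F t) + (0 - inverse (E t)) * E t) (at t)"
      unfolding p_def[abs_def] by (rule DERIV_mult[OF E[OF that] DERIV_diff[OF DERIV_const F[OF that]]])
    then show ?thesis using Epos[of t] by (simp add: p_def field_simps)
  qed
  define r where "r t = xd t - inverse (p t)" for t
  have r: "solves r {s<..}"
    unfolding solves_def
  proof
    fix t assume t: "t \<in> {s<..}"
    then have pt: "p t \<noteq> 0" using ppos[of t] by simp
    have "((\<lambda>t. xd t - H t) has_real_derivative lam - (xd t)\<^sup>2) (at t)"
      using xd(2) s(1)[of t] t by (auto simp: solves_def)
    moreover have "((\<lambda>t. inverse (p t)) has_real_derivative - (inverse (p t) * (2 * xd t * p t - 1) * inverse (p t))) (at t)"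
      by (rule DERIV_inverse'[OF p pt]) (use t in simp)
    ultimately have "((\<lambda>t. (xd t - H t) - inverse (p t)) has_real_derivative
       (lam - (xd t)\<^sup>2) - - (inverse (p t) * (2 * xd t * p t - 1) * inverse (p t))) (at t)"
      by (rule DERIV_diff)
    moreover have "(lam - (xd t)\<^sup>2) - - (inverse (p t) * (2 * xd t * p t - 1) * inverse (p t)) = lam - (r t)\<^sup>2"
      using pt by (simp add: r_def field_simps power2_eq_square)
    moreover have "(\<lambda>t. (xd t - H t) - inverse (p t)) = (\<lambda>t. r t - H t)" by (auto simp: r_def)
    ultimately show "((\<lambda>t. r t - H t) has_real_derivative lam - (r t)\<^sup>2) (at t)" by (simp only:)
  qed
  have "\<not> (r \<longlongrightarrow> k) at_top"
  proof
    assume rk: "(r \<longlongrightarrow> k) at_top"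
    have "eventually (\<lambda>t. xd t - r t \<ge> k) at_top"
      using eventually_ge_at_top[of s]
    proof eventually_elim
      case (elim t)
      have "k * p t \<le> 1" using pk[OF elim] k_pos by (simp add: field_simps)
      then show ?case using ppos[OF elim] by (simp add: r_def field_simps)
    qed
    moreover have "((\<lambda>t. xd t - r t) \<longlongrightarrow> k - k) at_top" by (intro tendsto_diff xd rk)
    ultimately have "k \<le> k - k" by (intro tendsto_lowerbound) auto
    then show False using k_pos by simp
  qed
  moreover have "{s + 1..} \<subseteq> {s<..}" by auto
  ultimately have "(r \<longlongrightarrow> - k) at_top" using forward_dichotomy[OF r] by blast
  then show ?thesis using r by blast
qed

lemma repelling_solution_exists:
  "\<exists>r I s. open I \<and> is_interval I \<and> {s..} \<subseteq> I \<and> solves r I \<and> blows_up r I \<and> (r \<longlongrightarrow> - k) at_top"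
proof -
  obtain r0 s where r0: "solves r0 {s<..}" "(r0 \<longlongrightarrow> - k) at_top"
    using repelling_solution_near_infinity by blast
  obtain r I where r: "open I" "is_interval I" "s + 1 \<in> I" "r (s + 1) = r0 (s + 1)" "solves r I" "blows_up r I"
    using solution_through_exists by blast
  have sub: "{s + 1..} \<subseteq> I" by (rule above_solution_global(1)[OF r(1-3,6,5) r0(1)]) (use r in auto)
  have int: "is_interval {s<..}" by (simp add: is_interval_1)
  have "r t = r0 t" if "t \<ge> s + 1" for t
  proof (rule solves_unique[OF r(5,2) r0(1) int])
    show "s + 1 \<in> I \<inter> {s<..}" using r(3) by simp
    show "t \<in> I \<inter> {s<..}" using sub that by auto
  qed (rule r(4))
  then have "eventually (\<lambda>t. r0 t = r t) at_top" unfolding eventually_at_top_linorder by metis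
  then have "(r \<longlongrightarrow> - k) at_top" using r0(2) by (rule tendsto_cong[THEN iffD1])
  then show ?thesis using r sub by blast
qed

end

text \<open>The maximal solution that tends to \<open>- k\<close> at plus infinity, together with its interval.\<close>

locale riccati_lower = riccati_eq +
  fixes r :: "real \<Rightarrow> real" and J :: "real set"
  assumes J: "open J" "is_interval J" "J \<noteq> {}" "\<exists>s. {s..} \<subseteq> J"
    and r: "solves r J" "blows_up r J" "(r \<longlongrightarrow> - k) at_top"
begin

lemma J_Ici: "s \<in> J \<Longrightarrow> {s..} \<subseteq> J"
proof -
  obtain c where c: "{c..} \<subseteq> J" using J(4) by blast
  assume s: "s \<in> J"
  have "t \<in> J" if "t \<ge> s" for t
    using is_interval_Icc_subset[OF J(2) s, of "max t c"] c that by (auto simp: subset_iff)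
  then show "{s..} \<subseteq> J" by auto
qed

lemma global_ge:
  assumes x: "solves x I" "{s..} \<subseteq> I" and s: "s \<in> J"
  shows "r s \<le> x s"
proof (rule ccontr)
  assume "\<not> r s \<le> x s"
  then have lt: "x s < r s" by simp
  note Js = J_Ici[OF s]
  have pos: "x t < r t" if "t \<ge> s" for t
    by (rule solves_mono_forward(2)[OF x(1) r(1) that _ _ lt]) (use x(2) Js in auto)
  have "\<not> (x \<longlongrightarrow> - k) at_top" using tendsto_minus_k_unique[OF x _ r(1) Js r(3)] lt by auto
  then have xk: "(x \<longlongrightarrow> k) at_top" using forward_dichotomy[OF x] by blast
  have "eventually (\<lambda>t. x t \<le> r t) at_top"
    using eventually_ge_at_top[of s] by eventually_elim (use pos in force)
  then have "k \<le> - k" using tendsto_le[OF _ r(3) xk] by simp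
  then show False using k_pos by simp
qed

lemma above_tendsto_k:
  assumes x: "solves x I" "{s..} \<subseteq> I" and s: "s \<in> J" "r s < x s"
  shows "(x \<longlongrightarrow> k) at_top"
  using forward_dichotomy[OF x] tendsto_minus_k_unique[OF x _ r(1) J_Ici[OF s(1)] r(3)] s(2) by auto

lemma bounded_at_plus_infinity_iff:
  assumes s: "s \<in> J" shows "bounded_at_plus_infinity f s x0 \<longleftrightarrow> r s \<le> x0"
proof
  assume "bounded_at_plus_infinity f s x0"
  then obtain x I T where x: "is_interval I" "solves x I" "s \<in> I" "x s = x0" "{T..} \<subseteq> I"
    unfolding bounded_at_plus_infinity_def maximal_solution_iff by blast
  have "{s..} \<subseteq> I"
  proof
    fix t assume "t \<in> {s..}"
    moreover have "max t T \<in> I" using x(5) by auto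
    ultimately show "t \<in> I" using is_interval_Icc_subset[OF x(1,3), of "max t T"] by (auto simp: subset_iff)
  qed
  from global_ge[OF x(2) this s] x(4) show "r s \<le> x0" by simp
next
  assume le: "r s \<le> x0"
  obtain x I where x: "open I" "is_interval I" "s \<in> I" "x s = x0" "solves x I" "blows_up x I"
    using solution_through_exists by blast
  have sub: "{s..} \<subseteq> I"
    by (rule above_solution_global(1)[OF x(1-3,6,5) r(1) J_Ici[OF s]]) (use le x in simp)
  have "maximal_solution f x I" using x by (auto simp: maximal_solution_iff)
  then show "bounded_at_plus_infinity f s x0"
    unfolding bounded_at_plus_infinity_def using x sub forward_global_bounded[OF x(5) sub] by blast
qed

lemma J_cases: "J = UNIV \<or> (bdd_below J \<and> J = {Inf J<..})"
proof (cases "bdd_below J")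
  case True
  obtain c where c: "c \<in> J" using J(3) by blast
  note i = open_interval_Inf[OF J(1,2) _ True]
  have "{Inf J<..} \<subseteq> J"
  proof
    fix t assume t: "t \<in> {Inf J<..}"
    show "t \<in> J"
    proof (cases "t \<le> c")
      case True then show ?thesis using i(3)[OF c] t by simp
    next
      case False then show ?thesis using J_Ici[OF c] by auto
    qed
  qed
  then show ?thesis using i(1) True by auto
next
  case False
  obtain c where c: "c \<in> J" using J(3) by blast
  have "t \<in> J" for t
    using interval_Iic_subset[OF J(2) c False] J_Ici[OF c] by (cases "t \<le> c") auto
  then show ?thesis by auto
qed

theorem is_lower_solution: "lower_solution f r J"
  unfolding lower_solution_def
proof (intro conjI ballI allI)
  show "maximal_solution f r J" using J r by (simp add: maximal_solution_iff)
  show "J = UNIV \<or> (\<exists>t0. J = {t0<..})" using J_cases by blast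
  obtain M where M: "M \<ge> 0" "\<And>t. \<bar>H t\<bar> \<le> M" using H_bound by blast
  have "r t \<ge> - (3 * M + 2 * k + 1)" if "t \<in> J" for t
    by (rule forward_lower_bound[OF r(1) J_Ici[OF that] M(2) order_refl])
  then show "bdd_below (r ` J)" by (intro bdd_belowI[of _ "- (3 * M + 2 * k + 1)"]) auto
qed (rule bounded_at_plus_infinity_iff)

end

section \<open>Time reversal and the upper solution\<close>

lemma in_S_UNIV_iff: "in_S UNIV h \<longleftrightarrow> integrable lebesgue h \<and> (\<exists>C. AE t in lebesgue. \<bar>h t\<bar> \<le> C)"
  unfolding in_S_def lebesgue_on_UNIV_eq by (rule refl)

lemma in_S_scale:
  assumes h: "in_S UNIV h" and c: "c \<noteq> 0"
  shows "in_S UNIV (\<lambda>t. h (c * t))"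
proof -
  have "integrable lebesgue (\<lambda>t. h (c * t))"
    using h has_bochner_integral_lebesgue_real_affine_iff[OF c, of h _ 0]
    by (auto simp: in_S_UNIV_iff integrable.simps)
  moreover obtain C where "AE t in lebesgue. \<bar>h t\<bar> \<le> C" using h by (auto simp: in_S_UNIV_iff)
  then obtain N where "N \<in> null_sets lebesgue" and N: "\<And>t. t \<notin> N \<Longrightarrow> \<bar>h t\<bar> \<le> C"
    by (elim AE_E3) auto
  then have "negligible N" by (simp add: negligible_iff_null_sets)
  then have "negligible ((\<lambda>t. t / c) ` N)"
    by (rule negligible_locally_Lipschitz_image[rotated])
      (auto intro!: exI[of _ UNIV] exI[of _ "1 / \<bar>c\<bar>"] simp flip: diff_divide_distrib)
  then have "AE t in lebesgue. t \<notin> (\<lambda>t. t / c) ` N"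
    by (intro AE_not_in) (simp add: negligible_iff_null_sets)
  then have "AE t in lebesgue. \<bar>h (c * t)\<bar> \<le> C"
  proof eventually_elim
    case (elim t)
    have "c * t \<notin> N"
    proof
      assume "c * t \<in> N"
      then have "(c * t) / c \<in> (\<lambda>t. t / c) ` N" by blast
      then show False using elim c by simp
    qed
    then show ?case by (rule N)
  qed
  ultimately show ?thesis by (auto simp: in_S_UNIV_iff)
qed

text \<open>If \<open>x\<close> solves the equation with forcing \<open>h(t)\<close>, then \<open>- x(- t)\<close> solves the one with forcing
\<open>h(- t)\<close>. Upper and lower solutions are exchanged.\<close>

definition time_reversal :: "(real \<Rightarrow> real) \<Rightarrow> real \<Rightarrow> real" where
  "time_reversal x t = - x (- t)"

lemma time_reversal_invol [simp]: "time_reversal (time_reversal x) = x"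
  by (auto simp: time_reversal_def)

lemma uminus_image_invol [simp]: "uminus ` (uminus ` I) = (I :: real set)"
  by (simp add: image_image)

lemma mem_uminus_image: "(t :: real) \<in> uminus ` I \<longleftrightarrow> - t \<in> I"
  by (metis add.inverse_inverse image_iff)

lemma blows_up_time_reversal: "blows_up (time_reversal x) (uminus ` I) \<longleftrightarrow> blows_up x I"
proof -
  have *: "blows_up (time_reversal x) (uminus ` I)" if "blows_up x I" for x I
    unfolding blows_up_def
  proof (intro conjI impI)
    assume "bdd_above (uminus ` I)"
    then have "filterlim x at_top (at_right (Inf I))" using that by (simp add: blows_up_def)
    moreover have "Sup (uminus ` I) = - Inf I" by (simp add: Inf_real_def)
    ultimately show "filterlim (time_reversal x) at_bot (at_left (Sup (uminus ` I)))"
      by (simp add: filterlim_at_left_to_right time_reversal_def filterlim_uminus_at_bot)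
  next
    assume "bdd_below (uminus ` I)"
    then have "filterlim x at_bot (at_left (Sup I))" using that by (simp add: blows_up_def)
    moreover have "Inf (uminus ` I) = - Sup I" by (simp add: Inf_real_def image_image)
    ultimately show "filterlim (time_reversal x) at_top (at_right (Inf (uminus ` I)))"
      by (simp add: filterlim_at_left_to_right time_reversal_def filterlim_uminus_at_top)
  qed
  show ?thesis using *[of x I] *[of "time_reversal x" "uminus ` I"] by auto
qed

lemma open_uminus_image: "open (uminus ` I) \<longleftrightarrow> open (I :: real set)"
  using open_negations[of I] open_negations[of "uminus ` I"] by auto

lemma is_interval_uminus_image: "is_interval (uminus ` I) \<longleftrightarrow> is_interval (I :: real set)"
  by simp

lemma Ici_subset_uminus_image:
  assumes "{..s :: real} \<subseteq> I" shows "{- s..} \<subseteq> uminus ` I"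
proof
  fix t assume "t \<in> {- s..}"
  then have "- t \<in> I" using assms by auto
  then show "t \<in> uminus ` I" by (simp add: mem_uminus_image)
qed

lemma Iic_subset_uminus_image:
  assumes "{s :: real..} \<subseteq> I" shows "{..- s} \<subseteq> uminus ` I"
proof
  fix t assume "t \<in> {..- s}"
  then have "- t \<in> I" using assms by auto
  then show "t \<in> uminus ` I" by (simp add: mem_uminus_image)
qed

lemma time_reversal_image: "time_reversal x ` (uminus ` S) = uminus ` (x ` S)"
  by (simp add: image_image time_reversal_def)

lemma time_reversal_image_Ici: "time_reversal x ` {- s..} = uminus ` (x ` {..s})"
  using time_reversal_image[of x "{..s}"] by simp

lemma time_reversal_image_Iic: "time_reversal x ` {..- s} = uminus ` (x ` {s..})"
  using time_reversal_image[of x "{s..}"] by simp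

context riccati_eq
begin

abbreviation "h' \<equiv> (\<lambda>t. h (- t))"

lemma in_S_reversed: "in_S UNIV h'"
  using in_S_scale[OF h, of "-1"] by simp

lemma reversed: "riccati_eq lam h'"
  by unfold_locales (rule lam, rule in_S_reversed)

interpretation rev: riccati_eq lam h'
  by (rule reversed)

lemma tail_reversed: "\<exists>c. \<forall>t. tail h' t = c - H (- t)"
proof -
  have *: "tail h' a + H (- a) = tail h' b + H (- b)" if "a \<le> b" for a b
  proof -
    have "integral {a..b} h' = integral {- b..- a} h" using Henstock_Kurzweil_Integration.integral_reflect_real[of "- a" "- b" h] by simp
    then show ?thesis
      using tail_diff[OF in_S_reversed that] tail_diff[OF h, of "- b" "- a"] that by simp
  qed
  have "tail h' t = (tail h' 0 + H 0) - H (- t)" for t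
    using *[of 0 t] *[of t 0] by (cases "t \<le> 0") auto
  then show ?thesis by blast
qed

lemma solves_time_reversal_imp:
  assumes "solves x I" shows "rev.solves (time_reversal x) (uminus ` I)"
  unfolding rev.solves_def
proof
  fix t assume t: "t \<in> uminus ` I"
  obtain c where c: "\<And>t. tail h' t = c - H (- t)" using tail_reversed by blast
  have "((\<lambda>t. x t - H t) has_real_derivative lam - (x (- t))\<^sup>2) (at (- t))"
    using assms t unfolding solves_def mem_uminus_image by blast
  then have "((\<lambda>t. x (- t) - H (- t)) has_real_derivative - (lam - (x (- t))\<^sup>2)) (at t)"
    by (simp add: DERIV_mirror)
  then have "((\<lambda>t. - c - (x (- t) - H (- t))) has_real_derivative 0 - - (lam - (x (- t))\<^sup>2)) (at t)"
    by (intro DERIV_diff DERIV_const)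
  moreover have "(\<lambda>t. - c - (x (- t) - H (- t))) = (\<lambda>t. time_reversal x t - tail h' t)"
    by (auto simp: time_reversal_def c)
  ultimately show "((\<lambda>t. time_reversal x t - tail h' t) has_real_derivative lam - (time_reversal x t)\<^sup>2) (at t)"
    by (simp add: time_reversal_def)
qed

end

context riccati_eq
begin

interpretation rev: riccati_eq lam h'
  by (rule reversed)

lemma solves_time_reversal: "rev.solves (time_reversal x) (uminus ` I) \<longleftrightarrow> solves x I"
proof
  assume "rev.solves (time_reversal x) (uminus ` I)"
  from rev.solves_time_reversal_imp[OF this] show "solves x I" by simp
qed (rule solves_time_reversal_imp)

lemma maximal_solution_time_reversal:
  "maximal_solution rev.f (time_reversal x) (uminus ` I) \<longleftrightarrow> maximal_solution f x I"
  unfolding maximal_solution_iff rev.maximal_solution_iff solves_time_reversal blows_up_time_reversal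
    open_uminus_image is_interval_uminus_image by simp

lemma bounded_at_minus_infinity_iff:
  "bounded_at_minus_infinity f s x0 \<longleftrightarrow> bounded_at_plus_infinity rev.f (- s) (- x0)"
proof
  assume "bounded_at_minus_infinity f s x0"
  then obtain x I T where x: "maximal_solution f x I" "s \<in> I" "x s = x0" "{..T} \<subseteq> I" "bounded (x ` {..T})"
    unfolding bounded_at_minus_infinity_def by blast
  have "bounded (time_reversal x ` {- T..})" using x(5) by (simp add: time_reversal_image_Ici)
  moreover have "{- T..} \<subseteq> uminus ` I" by (rule Ici_subset_uminus_image[OF x(4)])
  ultimately show "bounded_at_plus_infinity rev.f (- s) (- x0)"
    unfolding bounded_at_plus_infinity_def using x(1-3)
    by (intro exI[of _ "time_reversal x"] exI[of _ "uminus ` I"] conjI exI[of _ "- T"])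
       (auto simp: maximal_solution_time_reversal time_reversal_def)
next
  assume "bounded_at_plus_infinity rev.f (- s) (- x0)"
  then obtain y K T where y: "maximal_solution rev.f y K" "- s \<in> K" "y (- s) = - x0" "{T..} \<subseteq> K" "bounded (y ` {T..})"
    unfolding bounded_at_plus_infinity_def by blast
  have "bounded (time_reversal y ` {..- T})" using y(5) by (simp add: time_reversal_image_Iic)
  moreover have "{..- T} \<subseteq> uminus ` K" by (rule Iic_subset_uminus_image[OF y(4)])
  moreover have "maximal_solution f (time_reversal y) (uminus ` K)"
    using maximal_solution_time_reversal[of "time_reversal y" "uminus ` K"] y(1) by simp
  ultimately show "bounded_at_minus_infinity f s x0"
    unfolding bounded_at_minus_infinity_def using y(2,3)
    by (intro exI[of _ "time_reversal y"] exI[of _ "uminus ` K"] conjI exI[of _ "- T"])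
       (auto simp: time_reversal_def mem_uminus_image)
qed

end

text \<open>The maximal solution that tends to \<open>k\<close> at minus infinity. Its time reversal is an instance of
\<^locale>\<open>riccati_lower\<close>, from which its properties are transported.\<close>

locale riccati_upper = riccati_eq +
  fixes a :: "real \<Rightarrow> real" and I :: "real set"
  assumes I: "open I" "is_interval I" "I \<noteq> {}" "\<exists>s. {..s} \<subseteq> I"
    and a: "solves a I" "blows_up a I" "(a \<longlongrightarrow> k) at_bot"
begin

sublocale rev: riccati_lower lam h' "time_reversal a" "uminus ` I"
proof
  show "0 < lam" by (rule lam)
  show "in_S UNIV h'" by (rule in_S_reversed)
  show "open (uminus ` I)" "is_interval (uminus ` I)" "uminus ` I \<noteq> {}" using I by (auto simp: open_uminus_image)
  show "\<exists>s. {s..} \<subseteq> uminus ` I"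
  proof -
    obtain s where "{..s} \<subseteq> I" using I(4) by blast
    then have "{- s..} \<subseteq> uminus ` I" by (rule Ici_subset_uminus_image)
    then show ?thesis by blast
  qed
  show "riccati_eq.solves lam h' (time_reversal a) (uminus ` I)" using a(1) by (simp add: solves_time_reversal)
  show "blows_up (time_reversal a) (uminus ` I)" using a(2) by (simp add: blows_up_time_reversal)
  show "(time_reversal a \<longlongrightarrow> - k) at_top"
    using tendsto_minus[OF a(3)] by (simp add: time_reversal_def[abs_def] filterlim_at_bot_mirror)
qed

lemma I_Iic: assumes "s \<in> I" shows "{..s} \<subseteq> I"
proof -
  have "{- s..} \<subseteq> uminus ` I" using rev.J_Ici[of "- s"] assms by (simp add: mem_uminus_image)
  from Iic_subset_uminus_image[OF this] show ?thesis by simp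
qed

lemma global_le:
  assumes "solves x K" "{..s} \<subseteq> K" "s \<in> I" shows "x s \<le> a s"
  using rev.global_ge[of "time_reversal x" "uminus ` K" "- s"] Ici_subset_uminus_image[OF assms(2)] assms
  by (simp add: solves_time_reversal mem_uminus_image time_reversal_def)

lemma below_tendsto_minus_k:
  assumes "solves x K" "{..s} \<subseteq> K" "s \<in> I" "x s < a s" shows "(x \<longlongrightarrow> - k) at_bot"
proof -
  have "(time_reversal x \<longlongrightarrow> k) at_top"
    using rev.above_tendsto_k[of "time_reversal x" "uminus ` K" "- s"] Ici_subset_uminus_image[OF assms(2)] assms
    by (simp add: solves_time_reversal mem_uminus_image time_reversal_def)
  from tendsto_minus[OF this] show ?thesis
    by (simp add: time_reversal_def[abs_def] filterlim_at_bot_mirror)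
qed

lemma I_cases: "I = UNIV \<or> (bdd_above I \<and> I = {..<Sup I})"
proof -
  consider "uminus ` I = UNIV" | "bdd_above I" "uminus ` I = {- Sup I<..}"
    using rev.J_cases by (auto simp: Inf_real_def image_image)
  then show ?thesis
  proof cases
    case 1
    then have "uminus ` (uminus ` I) = uminus ` (UNIV :: real set)" by simp
    then show ?thesis by simp
  next
    case 2
    have "t \<in> I \<longleftrightarrow> t < Sup I" for t using 2(2) mem_uminus_image[of "- t" I] by auto
    then show ?thesis using 2(1) by auto
  qed
qed

theorem is_upper_solution: "upper_solution f a I"
  unfolding upper_solution_def
proof (intro conjI ballI allI)
  show "maximal_solution f a I" using I a by (simp add: maximal_solution_iff)
  show "I = UNIV \<or> (\<exists>tf. I = {..<tf})" using I_cases by blast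
  have "bdd_below (time_reversal a ` uminus ` I)" using rev.is_lower_solution by (simp add: lower_solution_def)
  then obtain m where m: "\<And>t. t \<in> uminus ` I \<Longrightarrow> m \<le> time_reversal a t" by (auto simp: bdd_below_def)
  have "a t \<le> - m" if "t \<in> I" for t using m[of "- t"] that by (simp add: time_reversal_def)
  then show "bdd_above (a ` I)" by (intro bdd_aboveI[of _ "- m"]) auto
  fix s x0 assume "s \<in> I"
  then show "bounded_at_minus_infinity f s x0 \<longleftrightarrow> x0 \<le> a s"
    using rev.bounded_at_plus_infinity_iff[of "- s" "- x0"]
    by (simp add: bounded_at_minus_infinity_iff time_reversal_def)
qed

end

context riccati_eq
begin

interpretation rev: riccati_eq lam h'
  by (rule reversed)

lemma pullback_attractor_exists: "\<exists>a I. riccati_upper lam h a I"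
proof -
  obtain r J s where r: "open J" "is_interval J" "{s..} \<subseteq> J" "rev.solves r J" "blows_up r J" "(r \<longlongrightarrow> - k) at_top"
    using rev.repelling_solution_exists by blast
  have "riccati_upper lam h (time_reversal r) (uminus ` J)"
  proof
    show "open (uminus ` J)" "is_interval (uminus ` J)" "uminus ` J \<noteq> {}" using r(1-3) by (auto simp: open_uminus_image)
    have "{..- s} \<subseteq> uminus ` J" by (rule Iic_subset_uminus_image[OF r(3)])
    then show "\<exists>s. {..s} \<subseteq> uminus ` J" by blast
    show "solves (time_reversal r) (uminus ` J)"
      using solves_time_reversal[of "time_reversal r" "uminus ` J"] r(4) by simp
    show "blows_up (time_reversal r) (uminus ` J)" using r(5) by (simp add: blows_up_time_reversal)
    show "(time_reversal r \<longlongrightarrow> k) at_bot"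
      using tendsto_minus[OF r(6)] by (simp add: time_reversal_def[abs_def] filterlim_at_bot_mirror)
  qed
  then show ?thesis by blast
qed

lemma repelling_locale_exists: "\<exists>r J. riccati_lower lam h r J"
proof -
  obtain r J s where r: "open J" "is_interval J" "{s..} \<subseteq> J" "solves r J" "blows_up r J" "(r \<longlongrightarrow> - k) at_top"
    using repelling_solution_exists by blast
  have "riccati_lower lam h r J" by unfold_locales (use r in auto)
  then show ?thesis by blast
qed

lemma backward_global_bounded:
  assumes x: "solves x K" "{..s} \<subseteq> K"
  shows "bounded (x ` {..s})"
proof -
  have "{- s..} \<subseteq> uminus ` K" by (rule Ici_subset_uminus_image[OF x(2)])
  then have "bounded (time_reversal x ` {- s..})"
    using rev.forward_global_bounded[of "time_reversal x" "uminus ` K"] x(1) by (simp add: solves_time_reversal)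
  then show ?thesis by (simp add: time_reversal_image_Ici)
qed

lemma tendsto_k_at_bot_unique:
  assumes x: "solves x K" "{..s} \<subseteq> K" "(x \<longlongrightarrow> k) at_bot"
    and z: "solves z L" "{..s} \<subseteq> L" "(z \<longlongrightarrow> k) at_bot"
  shows "x s = z s"
proof -
  have *: "rev.solves (time_reversal y) (uminus ` M)" "{- s..} \<subseteq> uminus ` M" "(time_reversal y \<longlongrightarrow> - k) at_top"
    if "solves y M" "{..s} \<subseteq> M" "(y \<longlongrightarrow> k) at_bot" for y M
    using that(1) Ici_subset_uminus_image[OF that(2)] tendsto_minus[OF that(3)]
    by (simp_all only: solves_time_reversal) (simp add: time_reversal_def[abs_def] filterlim_at_bot_mirror)
  show ?thesis using rev.tendsto_minus_k_unique[OF *[OF x] *[OF z]] by (simp add: time_reversal_def)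
qed

end

section \<open>Hyperbolicity and the three cases\<close>

lemma interval_integral_lebesgue_FTC:
  fixes g :: "real \<Rightarrow> real"
  assumes g: "continuous_on UNIV g" and Q: "\<And>t. (Q has_real_derivative g t) (at t)"
  shows "(LINT x=ereal s..ereal t|lebesgue. g x) = Q t - Q s"
proof -
  have "g \<in> borel_measurable borel" using g by (rule borel_measurable_continuous_onI)
  then have m: "(\<lambda>x. indicator A x *\<^sub>R g x) \<in> borel_measurable lborel" if "A \<in> sets borel" for A
    using that by (auto intro!: borel_measurable_scaleR)
  have "(LINT x:einterval a b|lebesgue. g x) = (LBINT x:einterval a b. g x)" for a b
    unfolding set_lebesgue_integral_def by (rule integral_completion) (rule m, simp)
  then have "(LINT x=ereal s..ereal t|lebesgue. g x) = (LBINT x=ereal s..ereal t. g x)"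
    by (simp only: interval_lebesgue_integral_def)
  also have "\<dots> = Q t - Q s"
    by (rule interval_integral_FTC_finite)
      (use Q in \<open>auto intro: continuous_on_subset[OF g] has_vector_derivative_at_within
        simp: has_real_derivative_iff_has_vector_derivative\<close>)
  finally show ?thesis .
qed

text \<open>\<open>2 P(t) - c t\<close> is nondecreasing outside a compact interval and bounded on it, so it loses at most a
constant.\<close>

lemma antiderivative_linear_growth:
  fixes b :: "real \<Rightarrow> real"
  assumes b: "continuous_on UNIV b" and lim: "(b \<longlongrightarrow> c) at_top" "(b \<longlongrightarrow> c) at_bot" and c: "c > 0"
    and P: "\<And>t. (P has_real_derivative b t) (at t)"
  obtains C where "C \<ge> 0" "\<And>s t. s \<le> t \<Longrightarrow> 2 * (P t - P s) \<ge> c * (t - s) - C"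
proof -
  have "eventually (\<lambda>t. c / 2 < b t) at_top" "eventually (\<lambda>t. c / 2 < b t) at_bot"
    using order_tendstoD(1)[OF lim(1), of "c / 2"] order_tendstoD(1)[OF lim(2), of "c / 2"] c by auto
  then obtain T1 T2 where T1: "\<And>t. t \<ge> T1 \<Longrightarrow> c / 2 < b t" and T2: "\<And>t. t \<le> T2 \<Longrightarrow> c / 2 < b t"
    unfolding eventually_at_top_linorder eventually_at_bot_linorder by blast
  define T where "T = max \<bar>T1\<bar> \<bar>T2\<bar>"
  have T: "c / 2 < b t" if "t \<le> - T \<or> T \<le> t" for t using that T1[of t] T2[of t] by (auto simp: T_def)
  have T0: "T \<ge> 0" by (auto simp: T_def)
  define Q where "Q t = 2 * P t - c * t" for t
  have Q: "(Q has_real_derivative 2 * b t - c) (at t)" for t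
    unfolding Q_def[abs_def] using P[of t] by (auto intro!: derivative_eq_intros)
  have mono: "Q s \<le> Q t" if "s \<le> t" "t \<le> - T \<or> T \<le> s" for s t
  proof (rule DERIV_nonneg_imp_nondecreasing[OF that(1)])
    fix r assume "s \<le> r" "r \<le> t"
    then have "2 * b r - c \<ge> 0" using T[of r] that by auto
    then show "\<exists>y. (Q has_real_derivative y) (at r) \<and> 0 \<le> y" using Q by blast
  qed
  have "continuous_on {- T..T} Q" using Q by (auto intro!: continuous_at_imp_continuous_on DERIV_isCont)
  then obtain M where M: "\<And>r. r \<in> {- T..T} \<Longrightarrow> \<bar>Q r\<bar> \<le> M" using continuous_on_Icc_bounded by blast
  have M0: "M \<ge> 0" using M[of T] T0 by simp
  have Q_diff: "Q t - Q s \<ge> - (2 * M)" if st: "s \<le> t" for s t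
  proof (cases "t \<le> - T \<or> T \<le> s")
    case True
    then show ?thesis using mono[OF st True] M0 by simp
  next
    case False
    have "Q s \<le> M"
      using mono[of s "- T"] M[of "- T"] M[of s] False T0 by (cases "s \<le> - T") (auto simp: abs_le_iff)
    moreover have "Q t \<ge> - M"
      using mono[of T t] M[of T] M[of t] False T0 by (cases "T \<le> t") (auto simp: abs_le_iff)
    ultimately show ?thesis by simp
  qed
  have "2 * (P t - P s) \<ge> c * (t - s) - 2 * M" if "s \<le> t" for s t
    using Q_diff[OF that] by (simp add: Q_def algebra_simps)
  then show thesis using that[of "2 * M"] M0 by simp
qed

context riccati_eq
begin

lemma deriv_riccati: "deriv (f t) y = - 2 * y"
  unfolding riccati_def[abs_def] by (intro DERIV_imp_deriv) (auto intro!: derivative_eq_intros)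

lemma solves_UNIV_antiderivative:
  assumes "solves b UNIV"
  obtains P where "\<And>t. (P has_real_derivative b t) (at t)"
    and "\<And>s t. (LINT l=ereal s..ereal t|lebesgue. deriv (f l) (b l)) = - 2 * (P t - P s)"
proof -
  have c: "continuous_on UNIV b" using solves_continuous_on[OF assms] by simp
  then obtain P where P: "\<And>t. (P has_real_derivative b t) (at t)" using antiderivative_exists by blast
  have "((\<lambda>t. - 2 * P t) has_real_derivative - 2 * b t) (at t)" for t
    using DERIV_cmult[OF P, of "- 2"] .
  then have "(LINT l=ereal s..ereal t|lebesgue. (- 2 * b l)) = - 2 * P t - - 2 * P s" for s t
    using c by (intro interval_integral_lebesgue_FTC continuous_intros)
  then show thesis using that[OF P] by (simp add: deriv_riccati algebra_simps)
qed

lemma hyperbolic_attractiveI: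
  assumes b: "solves b UNIV" "bounded (range b)" and lim: "(b \<longlongrightarrow> k) at_top" "(b \<longlongrightarrow> k) at_bot"
  shows "hyperbolic_attractive f b"
proof -
  obtain P where P: "\<And>t. (P has_real_derivative b t) (at t)"
    "\<And>s t. (LINT l=ereal s..ereal t|lebesgue. deriv (f l) (b l)) = - 2 * (P t - P s)"
    using solves_UNIV_antiderivative[OF b(1)] by blast
  have "continuous_on UNIV b" using solves_continuous_on[OF b(1)] by simp
  then obtain C where C: "C \<ge> 0" "\<And>s t. s \<le> t \<Longrightarrow> 2 * (P t - P s) \<ge> k * (t - s) - C"
    using antiderivative_linear_growth[OF _ lim k_pos P(1)] by blast
  have "exp (- 2 * (P t - P s)) \<le> exp C * exp (- k * (t - s))" if "s \<le> t" for s t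
  proof -
    have "- 2 * (P t - P s) \<le> C + - (k * (t - s))" using C(2)[OF that] by (simp add: algebra_simps)
    then have "exp (- 2 * (P t - P s)) \<le> exp (C + - (k * (t - s)))" by (simp only: exp_le_cancel_iff)
    then show ?thesis by (simp only: exp_add mult_minus_left)
  qed
  moreover have "bounded_solution f b" using b by (simp add: bounded_solution_def solution_iff)
  moreover have "exp C \<ge> 1" using C(1) by simp
  ultimately show ?thesis unfolding hyperbolic_attractive_def P(2) using k_pos by blast
qed

lemma hyperbolic_repellingI:
  assumes b: "solves b UNIV" "bounded (range b)" and lim: "(b \<longlongrightarrow> - k) at_top" "(b \<longlongrightarrow> - k) at_bot"
  shows "hyperbolic_repelling f b"
proof -
  obtain P where P: "\<And>t. (P has_real_derivative b t) (at t)"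
    "\<And>s t. (LINT l=ereal s..ereal t|lebesgue. deriv (f l) (b l)) = - 2 * (P t - P s)"
    using solves_UNIV_antiderivative[OF b(1)] by blast
  have "continuous_on UNIV (\<lambda>t. - b t)" using solves_continuous_on[OF b(1)] by (intro continuous_intros) simp
  moreover have "((\<lambda>t. - b t) \<longlongrightarrow> k) at_top" "((\<lambda>t. - b t) \<longlongrightarrow> k) at_bot"
    using tendsto_minus[OF lim(1)] tendsto_minus[OF lim(2)] by simp_all
  ultimately obtain C where C: "C \<ge> 0" "\<And>s t. s \<le> t \<Longrightarrow> 2 * (- P t - - P s) \<ge> k * (t - s) - C"
    using antiderivative_linear_growth[OF _ _ _ k_pos DERIV_minus[OF P(1)]] by blast
  have "exp (- 2 * (P t - P s)) \<le> exp C * exp (k * (t - s))" if "t \<le> s" for s t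
  proof -
    have "- 2 * (P t - P s) \<le> C + k * (t - s)" using C(2)[OF that] by (simp add: algebra_simps)
    then have "exp (- 2 * (P t - P s)) \<le> exp (C + k * (t - s))" by (simp only: exp_le_cancel_iff)
    then show ?thesis by (simp only: exp_add)
  qed
  moreover have "bounded_solution f b" using b by (simp add: bounded_solution_def solution_iff)
  moreover have "exp C \<ge> 1" using C(1) by simp
  ultimately show ?thesis unfolding hyperbolic_repelling_def P(2) using k_pos by blast
qed

lemma exp_decay_contradiction:
  assumes "K \<ge> (1::real)" "\<beta> > 0" "\<And>u. u \<ge> 0 \<Longrightarrow> 1 \<le> K * exp (- \<beta> * u)" shows False
proof -
  define u where "u = (ln K + 1) / \<beta>"
  have "ln K \<ge> 0" using assms(1) by simp
  then have u: "u \<ge> 0" "\<beta> * u = ln K + 1" using assms(2) by (auto simp: u_def)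
  have "K * exp (- \<beta> * u) = exp (ln K + - \<beta> * u)" using assms(1) by (subst exp_add) simp
  also have "\<dots> = exp (- 1)" using u(2) by simp
  also have "\<dots> < 1" by simp
  finally show False using assms(3)[OF u(1)] by simp
qed

lemma not_hyperbolicI:
  assumes b: "solves b UNIV" and lim: "(b \<longlongrightarrow> - k) at_top" "(b \<longlongrightarrow> k) at_bot"
  shows "\<not> hyperbolic f b"
proof
  obtain P where P: "\<And>t. (P has_real_derivative b t) (at t)"
    "\<And>s t. (LINT l=ereal s..ereal t|lebesgue. deriv (f l) (b l)) = - 2 * (P t - P s)"
    using solves_UNIV_antiderivative[OF b(1)] by blast
  have "eventually (\<lambda>t. b t < 0) at_top" "eventually (\<lambda>t. b t > 0) at_bot"
    using order_tendstoD(2)[OF lim(1), of 0] order_tendstoD(1)[OF lim(2), of 0] k_pos by auto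
  then obtain T1 T2 where T1: "\<And>t. t \<ge> T1 \<Longrightarrow> b t < 0" and T2: "\<And>t. t \<le> T2 \<Longrightarrow> b t > 0"
    unfolding eventually_at_top_linorder eventually_at_bot_linorder by blast
  assume "hyperbolic f b"
  then consider "hyperbolic_attractive f b" | "hyperbolic_repelling f b" by (auto simp: hyperbolic_def)
  then show False
  proof cases
    case 1
    then obtain K \<beta> where K: "K \<ge> 1" "\<beta> > 0"
      "\<And>s t. t \<ge> s \<Longrightarrow> exp (- 2 * (P t - P s)) \<le> K * exp (- \<beta> * (t - s))"
      unfolding hyperbolic_attractive_def P(2) by blast
    have "1 \<le> K * exp (- \<beta> * u)" if u: "u \<ge> 0" for u
    proof -
      have le: "T1 \<le> T1 + u" using u by simp
      have "- P T1 \<le> - P (T1 + u)"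
      proof (rule DERIV_nonneg_imp_nondecreasing[OF le])
        fix x assume "T1 \<le> x" "x \<le> T1 + u"
        then show "\<exists>y. ((\<lambda>t. - P t) has_real_derivative y) (at x) \<and> 0 \<le> y"
          using DERIV_minus[OF P(1)[of x]] T1[of x] by (intro exI[of _ "- b x"]) auto
      qed
      then have "1 \<le> exp (- 2 * (P (T1 + u) - P T1))" by simp
      from order_trans[OF this K(3)[OF le]] show ?thesis by simp
    qed
    then show False using exp_decay_contradiction[OF K(1,2)] by blast
  next
    case 2
    then obtain K \<beta> where K: "K \<ge> 1" "\<beta> > 0"
      "\<And>s t. t \<le> s \<Longrightarrow> exp (- 2 * (P t - P s)) \<le> K * exp (\<beta> * (t - s))"
      unfolding hyperbolic_repelling_def P(2) by blast
    have "1 \<le> K * exp (- \<beta> * u)" if u: "u \<ge> 0" for u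
    proof -
      have le: "T2 - u \<le> T2" using u by simp
      have "P (T2 - u) \<le> P T2"
      proof (rule DERIV_nonneg_imp_nondecreasing[OF le])
        fix x assume "T2 - u \<le> x" "x \<le> T2"
        then show "\<exists>y. (P has_real_derivative y) (at x) \<and> 0 \<le> y"
          using P(1)[of x] T2[of x] by (intro exI[of _ "b x"]) auto
      qed
      then have "1 \<le> exp (- 2 * (P (T2 - u) - P T2))" by simp
      from order_trans[OF this K(3)[OF le]] show ?thesis by simp
    qed
    then show False using exp_decay_contradiction[OF K(1,2)] by blast
  qed
qed

text \<open>The solution starting at time zero in \<open>x0\<close> exists for all positive times.\<close>

definition global_from :: "real \<Rightarrow> bool" where
  "global_from x0 \<longleftrightarrow> (\<exists>x K. solves x K \<and> {0..} \<subseteq> K \<and> x 0 = x0)"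

lemma solves_UNIV_bounded: assumes "solves b UNIV" shows "bounded (range b)"
proof -
  have "range b = b ` ({..0} \<union> {0..})" by (rule arg_cong[of _ _ "image b"]) auto
  then show ?thesis
    using forward_global_bounded[OF assms, of 0] backward_global_bounded[OF assms, of 0] by (simp add: image_Un)
qed

end

text \<open>Both distinguished solutions of one equation, the upper one \<open>a\<close> being defined at time zero.\<close>

locale riccati_pair = riccati_upper lam h a I + riccati_lower lam h r J for lam h a I r J +
  assumes zero: "0 \<in> I"
begin

lemma attractor_global: assumes "global_from x0" "x0 \<le> a 0" shows "I = UNIV"
proof -
  obtain x K where "solves x K" "{0..} \<subseteq> K" "x 0 = x0" using assms(1) by (auto simp: global_from_def)
  then have "{0..} \<subseteq> I" using above_solution_global(1)[OF I(1,2) zero a(2,1)] assms(2) by simp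
  moreover have "{..0} \<subseteq> I" by (rule I_Iic[OF zero])
  ultimately have "{..0} \<union> {0..} \<subseteq> I" by simp
  moreover have "{..0} \<union> {0..} = (UNIV :: real set)" by auto
  ultimately show ?thesis by auto
qed

text \<open>If \<open>a\<close> is defined everywhere, the lower solution stays below it and so cannot blow up to plus
infinity at a finite left end.\<close>

lemma repeller_global: assumes "I = UNIV" shows "J = UNIV"
proof (rule ccontr)
  assume "J \<noteq> UNIV"
  then have J': "bdd_below J" "J = {Inf J<..}" using J_cases by auto
  let ?b = "Inf J"
  have le: "r t \<le> a t" if "t \<in> J" for t using global_ge[OF a(1) _ that] assms by simp
  have "continuous_on {?b..?b + 1} a" using solves_continuous_on[OF a(1)] assms by simp
  then obtain B where B: "\<And>t. t \<in> {?b..?b + 1} \<Longrightarrow> \<bar>a t\<bar> \<le> B" using continuous_on_Icc_bounded by blast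
  have "eventually (\<lambda>t. t \<in> {?b<..<?b + 1}) (at_right ?b)" by (rule eventually_at_right_real) simp
  then have "eventually (\<lambda>t. r t \<le> B) (at_right ?b)"
  proof eventually_elim
    case (elim t)
    have "t \<in> J" using elim by (subst J'(2)) simp
    then show ?case using le[of t] B[of t] elim by (simp add: abs_le_iff)
  qed
  then show False using filterlim_at_top_not_bounded_above[of r "at_right ?b"] r(2) J'(1)
    by (auto simp: blows_up_def)
qed

text \<open>A solution surviving from below \<open>a 0\<close> gives \<open>r 0 < a 0\<close>, which separates the limits of \<open>a\<close> and \<open>r\<close>
at both ends.\<close>

theorem hyperbolic_case:
  assumes "global_from x0" "x0 < a 0"
  shows "upper_solution f a UNIV" "lower_solution f r UNIV" "hyperbolic_attractive f a" "hyperbolic_repelling f r"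
    "(a \<longlongrightarrow> k) at_top" "(r \<longlongrightarrow> - k) at_bot"
proof -
  have IU: "I = UNIV" using attractor_global assms by simp
  have JU: "J = UNIV" using repeller_global[OF IU] .
  show "upper_solution f a UNIV" "lower_solution f r UNIV"
    using is_upper_solution is_lower_solution IU JU by simp_all
  have sol: "solves a UNIV" "solves r UNIV" using a(1) r(1) IU JU by simp_all
  obtain x K where "solves x K" "{0..} \<subseteq> K" "x 0 = x0" using assms(1) by (auto simp: global_from_def)
  then have "r 0 \<le> x0" using global_ge[of x K 0] JU by simp
  then have lt: "r 0 < a 0" using assms(2) by simp
  show at: "(a \<longlongrightarrow> k) at_top" by (rule above_tendsto_k[OF sol(1)]) (use lt JU in auto)
  show rb: "(r \<longlongrightarrow> - k) at_bot" by (rule below_tendsto_minus_k[OF sol(2)]) (use lt IU in auto)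
  show "hyperbolic_attractive f a"
    by (rule hyperbolic_attractiveI[OF sol(1) solves_UNIV_bounded[OF sol(1)] at a(3)])
  show "hyperbolic_repelling f r"
    by (rule hyperbolic_repellingI[OF sol(2) solves_UNIV_bounded[OF sol(2)] r(3) rb])
qed

text \<open>Every solution defined on the whole line is pinched between \<open>r\<close> and \<open>a\<close>. If nothing below \<open>a 0\<close>
survives, all these solutions coincide.\<close>

theorem nonhyperbolic_case:
  assumes G: "global_from (a 0)" and nG: "\<And>x0. x0 < a 0 \<Longrightarrow> \<not> global_from x0"
  shows "upper_solution f a UNIV" "lower_solution f a UNIV" "(a \<longlongrightarrow> - k) at_top"
    "bounded_solution f b \<longleftrightarrow> b = a" "\<not> hyperbolic f b"
proof -
  have IU: "I = UNIV" using attractor_global G by simp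
  have JU: "J = UNIV" using repeller_global[OF IU] .
  have sol: "solves a UNIV" "solves r UNIV" using a(1) r(1) IU JU by simp_all
  have pinch: "x 0 = a 0" if "solves x UNIV" for x
  proof -
    have "x 0 \<le> a 0" using global_le[OF that _ zero] by simp
    moreover have "global_from (x 0)" using that by (auto simp: global_from_def)
    ultimately show ?thesis using nG[of "x 0"] by force
  qed
  have eq: "x = a" if "solves x UNIV" for x
  proof
    fix t show "x t = a t"
      by (rule solves_unique[OF that _ sol(1), of 0]) (auto simp: pinch[OF that])
  qed
  have "r = a" by (rule eq[OF sol(2)])
  then show "upper_solution f a UNIV" "lower_solution f a UNIV"
    using is_upper_solution is_lower_solution IU JU by simp_all
  show at: "(a \<longlongrightarrow> - k) at_top" using r(3) \<open>r = a\<close> by simp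
  show bs: "bounded_solution f b \<longleftrightarrow> b = a" for b
  proof
    assume "bounded_solution f b"
    then have "solves b UNIV" by (simp add: bounded_solution_def solution_iff)
    then show "b = a" by (rule eq)
  next
    have "bounded_solution f a"
      using sol(1) solves_UNIV_bounded[OF sol(1)] by (simp add: bounded_solution_def solution_iff)
    then show "bounded_solution f b" if "b = a" using that by simp
  qed
  show "\<not> hyperbolic f b"
  proof
    assume hb: "hyperbolic f b"
    then have "bounded_solution f b"
      by (auto simp: hyperbolic_def hyperbolic_attractive_def hyperbolic_repelling_def)
    then have "b = a" using bs by simp
    then show False using hb not_hyperbolicI[OF sol(1) at a(3)] by simp
  qed
qed

lemma global_from_attractor_if_solution:
  assumes "solution f b UNIV" shows "global_from (a 0)"
proof -
  have b: "solves b UNIV" using assms by (simp add: solution_iff)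
  have "b 0 \<le> a 0" using global_le[OF b _ zero] by simp
  moreover have "global_from (b 0)" using b by (auto simp: global_from_def)
  ultimately have "I = UNIV" using attractor_global by simp
  then show ?thesis using a(1) by (auto simp: global_from_def)
qed

theorem escape_case:
  assumes nG: "\<not> global_from (a 0)"
  shows "\<not> (\<exists>b. solution f b UNIV)"
    "\<exists>a tf. upper_solution f a {..<tf} \<and> filterlim a at_bot (at_left tf)"
    "\<exists>r t0. lower_solution f r {t0<..} \<and> filterlim r at_top (at_right t0)"
proof -
  show ns: "\<not> (\<exists>b. solution f b UNIV)" using global_from_attractor_if_solution nG by blast
  have "I \<noteq> UNIV" using ns a(1) by (auto simp: solution_iff)
  then have I': "bdd_above I" "I = {..<Sup I}" using I_cases by auto
  have "J \<noteq> UNIV" using ns r(1) by (auto simp: solution_iff)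
  then have J': "bdd_below J" "J = {Inf J<..}" using J_cases by auto
  have "upper_solution f a {..<Sup I}" using is_upper_solution I'(2) by metis
  moreover have "filterlim a at_bot (at_left (Sup I))" using a(2) I'(1) by (simp add: blows_up_def)
  ultimately show "\<exists>a tf. upper_solution f a {..<tf} \<and> filterlim a at_bot (at_left tf)" by blast
  have "lower_solution f r {Inf J<..}" using is_lower_solution J'(2) by metis
  moreover have "filterlim r at_top (at_right (Inf J))" using r(2) J'(1) by (simp add: blows_up_def)
  ultimately show "\<exists>r t0. lower_solution f r {t0<..} \<and> filterlim r at_top (at_right t0)" by blast
qed

end

section \<open>Rescaling time by the rate\<close>

lemma in_S_extend_zero:
  assumes "in_S {0..} g" shows "in_S UNIV (\<lambda>t. if t \<in> {0..} then g t else 0)"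
proof -
  obtain C where C: "AE t in lebesgue_on {0..}. \<bar>g t\<bar> \<le> C" using assms by (auto simp: in_S_def)
  have "AE t in lebesgue. t \<in> {0..} \<longrightarrow> \<bar>g t\<bar> \<le> C"
    using C by (subst (asm) AE_restrict_space_iff) auto
  then have "AE t in lebesgue. \<bar>if t \<in> {0..} then g t else 0\<bar> \<le> max C 0"
    by eventually_elim auto
  moreover have "(\<lambda>t. if t \<in> {0..} then g t else 0) = (\<lambda>t. indicator {0..} t *\<^sub>R g t)"
    by (auto simp: indicator_def)
  then have "integrable lebesgue (\<lambda>t. if t \<in> {0..} then g t else 0)"
    using assms by (simp add: in_S_def integrable_restrict_space)
  ultimately show ?thesis unfolding in_S_UNIV_iff by blast
qed

lemma in_S_restrict_zero:
  assumes "in_S UNIV h" "A \<in> sets lebesgue" shows "in_S UNIV (\<lambda>t. if t \<in> A then h t else 0)"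
proof -
  obtain C where "AE t in lebesgue. \<bar>h t\<bar> \<le> C" using assms by (auto simp: in_S_UNIV_iff)
  then have "AE t in lebesgue. \<bar>if t \<in> A then h t else 0\<bar> \<le> max C 0"
    by eventually_elim auto
  moreover have "(\<lambda>t. if t \<in> A then h t else 0) = (\<lambda>t. indicator A t *\<^sub>R h t)" by (auto simp: indicator_def)
  then have "integrable lebesgue (\<lambda>t. if t \<in> A then h t else 0)"
    using in_S_integrable_on(1)[OF assms] by (simp add: set_integrable_def)
  ultimately show ?thesis unfolding in_S_UNIV_iff by blast
qed

lemma in_S_add:
  assumes "in_S UNIV p" "in_S UNIV q" shows "in_S UNIV (\<lambda>t. p t + q t)"
proof -
  obtain C D where "AE t in lebesgue. \<bar>p t\<bar> \<le> C" "AE t in lebesgue. \<bar>q t\<bar> \<le> D"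
    using assms by (auto simp: in_S_UNIV_iff)
  then have "AE t in lebesgue. \<bar>p t + q t\<bar> \<le> C + D" by eventually_elim linarith
  then show ?thesis using assms unfolding in_S_UNIV_iff by (blast intro: Bochner_Integration.integrable_add)
qed

lemma integral_dilation:
  fixes q :: "real \<Rightarrow> real"
  assumes c: "c > 0" and q: "q integrable_on {c * a..c * b}"
  shows "c * integral {a..b} (\<lambda>t. q (c * t)) = integral {c * a..c * b} q"
proof -
  have "(q has_integral integral {c * a..c * b} q) (cbox (c * a) (c * b))"
    using integrable_integral[OF q] by simp
  from has_integral_affinity[OF this, of c 0]
  have "((\<lambda>t. q (c * t)) has_integral integral {c * a..c * b} q / c) ((\<lambda>x. x / c) ` {c * a..c * b})"
    using c by (simp add: divide_inverse mult.commute)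
  moreover have "(\<lambda>x. x / c) ` {c * a..c * b} = {a..b}"
    using c by (simp add: image_divide_atLeastAtMost)
  ultimately have "integral {a..b} (\<lambda>t. q (c * t)) = integral {c * a..c * b} q / c"
    by (simp add: integral_unique)
  then show ?thesis using c by simp
qed

context riccati_eq
begin

lemma global_from_mono: assumes "global_from x0" "x0 \<le> x1" shows "global_from x1"
proof -
  obtain z L where z: "solves z L" "{0..} \<subseteq> L" "z 0 = x0" using assms(1) by (auto simp: global_from_def)
  obtain x K where x: "open K" "is_interval K" "0 \<in> K" "x 0 = x1" "solves x K" "blows_up x K"
    using solution_through_exists by blast
  have "{0..} \<subseteq> K" using above_solution_global(1)[OF x(1-3,6,5) z(1,2)] z x assms by simp
  then show ?thesis using x by (auto simp: global_from_def)
qed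

lemma global_from_above_tendsto:
  assumes "global_from x0" "x0 < x1"
  obtains x K where "solves x K" "{0..} \<subseteq> K" "x 0 = x1" "(x \<longlongrightarrow> k) at_top"
proof -
  obtain z L where z: "solves z L" "{0..} \<subseteq> L" "z 0 = x0" using assms(1) by (auto simp: global_from_def)
  obtain x K where x: "open K" "is_interval K" "0 \<in> K" "x 0 = x1" "solves x K" "blows_up x K"
    using solution_through_exists by blast
  have le: "z 0 \<le> x 0" using z x assms by simp
  note g = above_solution_global[OF x(1-3,6,5) z(1,2) le]
  have "\<not> (x \<longlongrightarrow> - k) at_top"
  proof
    assume xk: "(x \<longlongrightarrow> - k) at_top"
    have "\<not> (z \<longlongrightarrow> k) at_top"
    proof
      assume zk: "(z \<longlongrightarrow> k) at_top"
      have "eventually (\<lambda>t. z t \<le> x t) at_top"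
        using eventually_ge_at_top[of 0] by eventually_elim (rule g(2))
      then have "k \<le> - k" using tendsto_le[OF _ xk zk] by simp
      then show False using k_pos by simp
    qed
    then have "(z \<longlongrightarrow> - k) at_top" using forward_dichotomy[OF z(1,2)] by blast
    from tendsto_minus_k_unique[OF x(5) g(1) xk z(1,2) this] show False using x(4) z(3) assms(2) by simp
  qed
  then have "(x \<longlongrightarrow> k) at_top" using forward_dichotomy[OF x(5) g(1)] by blast
  then show thesis using that x(4,5) g(1) by blast
qed

lemma escape_from:
  assumes "\<not> global_from x0"
  obtains x b where "b > 0" "solves x {0..<b}" "x 0 = x0" "\<And>m. \<exists>t\<in>{0..<b}. x t < m"
proof -
  obtain x K where x: "open K" "is_interval K" "0 \<in> K" "x 0 = x0" "solves x K" "blows_up x K"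
    using solution_through_exists by blast
  have "\<not> {0..} \<subseteq> K" using assms x unfolding global_from_def by blast
  then have ba: "bdd_above K" using interval_Ici_subset[OF x(2,3)] by metis
  note b = open_interval_Sup[OF x(1-3) ba]
  have "\<exists>t\<in>{0..<Sup K}. x t < m" for m
  proof -
    have "filterlim x at_bot (at_left (Sup K))" using x(6) ba by (simp add: blows_up_def)
    then have "eventually (\<lambda>t. x t < m) (at_left (Sup K))" by (simp add: filterlim_at_bot_dense)
    moreover have "eventually (\<lambda>t. t \<in> {0<..<Sup K}) (at_left (Sup K))" by (rule eventually_at_left_real[OF b(1)])
    ultimately have "eventually (\<lambda>t. x t < m \<and> t \<in> {0<..<Sup K}) (at_left (Sup K))" by (rule eventually_conj)
    then have "\<exists>t. x t < m \<and> t \<in> {0<..<Sup K}" by (rule eventually_happens'[rotated]) simp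
    then show ?thesis by auto
  qed
  moreover have "solves x {0..<Sup K}" by (rule solves_subset[OF x(5)]) (use b(3) in auto)
  ultimately show thesis using that[OF b(1)] x(4) by blast
qed

end

context riccati_upper
begin

lemma upper_solution_unique:
  assumes b: "upper_solution f b K" "s \<in> K" shows "s \<in> I" "b s = a s"
proof -
  have K: "is_interval K" "solves b K" "K = UNIV \<or> (\<exists>tf. K = {..<tf})"
    and char: "\<And>s x0. s \<in> K \<Longrightarrow> bounded_at_minus_infinity f s x0 \<longleftrightarrow> x0 \<le> b s"
    using b(1) by (auto simp: upper_solution_def maximal_solution_iff)
  have eq: "b t = a t" if "t \<in> K" "t \<in> I" for t
  proof -
    have "x0 \<le> b t \<longleftrightarrow> x0 \<le> a t" for x0
      using char[OF that(1)] is_upper_solution that(2) by (simp add: upper_solution_def)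
    then show ?thesis by (meson order_antisym order_refl)
  qed
  show sI: "s \<in> I"
  proof (rule ccontr)
    assume ns: "s \<notin> I"
    then have I': "bdd_above I" "I = {..<Sup I}" using I_cases by auto
    have "Sup I \<le> s" using ns by (subst (asm) I'(2)) simp
    then have "I \<subseteq> K" using K(3) b(2) by (subst I'(2)) auto
    obtain c where c: "c \<in> I" using I(3) by blast
    have "b t = a t" if "t \<in> I" for t using eq \<open>I \<subseteq> K\<close> that by blast
    then have "K = I" using blows_up_no_extension[OF I(1,2) c a(2) K(2,1) \<open>I \<subseteq> K\<close>] by blast
    then show False using ns b(2) by simp
  qed
  show "b s = a s" by (rule eq[OF b(2) sI])
qed

end

text \<open>The data of the rate-dependent family \<open>x' = lam - h(t; \<kappa>) - x\<^sup>2\<close>.\<close>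

locale rate_problem =
  fixes lam :: real and \<alpha> g :: "real \<Rightarrow> real"
  assumes lam: "lam > 0" and alpha: "in_S UNIV \<alpha>" and g: "in_S {0..} g"
begin

text \<open>The profile \<open>g\<close> extended by zero to the negative half-line, so that its tail integral is a function
on the whole line.\<close>

definition g0 :: "real \<Rightarrow> real" where "g0 t = (if t \<in> {0..} then g t else 0)"

abbreviation "\<Gamma> \<equiv> tail g0"

lemma g0: "in_S UNIV g0"
  using in_S_extend_zero[OF g] by (simp add: g0_def[abs_def])

lemma forcing_eq: "\<kappa> > 0 \<Longrightarrow> forcing \<alpha> g \<kappa> = (\<lambda>t. (if t \<in> {..<0} then \<alpha> t else 0) + g0 (\<kappa> * t))"
  by (rule ext) (auto simp: forcing_def g0_def mult.commute mult_less_0_iff zero_le_mult_iff)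

lemma in_S_forcing: assumes "\<kappa> > 0" shows "in_S UNIV (forcing \<alpha> g \<kappa>)"
  unfolding forcing_eq[OF assms]
  using in_S_restrict_zero[OF alpha, of "{..<0}"] in_S_scale[OF g0, of \<kappa>] assms by (intro in_S_add) auto

lemma riccati_eq_forcing: "\<kappa> > 0 \<Longrightarrow> riccati_eq lam (forcing \<alpha> g \<kappa>)"
  by unfold_locales (auto simp: lam in_S_forcing)

lemma rhs_eq_riccati: "rhs lam \<alpha> g \<kappa> = riccati lam (forcing \<alpha> g \<kappa>)"
  by (intro ext) (simp add: rhs_def riccati_def)

text \<open>At rate \<open>\<kappa>\<close> the solution starting at time zero in \<open>x0\<close> exists for all positive times.\<close>

definition persists :: "real \<Rightarrow> real \<Rightarrow> bool" where
  "persists \<kappa> x0 \<longleftrightarrow> riccati_eq.global_from lam (forcing \<alpha> g \<kappa>) x0"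

text \<open>The rescaled equation \<open>y' = lam - g(s) - y\<^sup>2 / \<kappa>\<^sup>2\<close> for \<open>s > 0\<close>, written with the derivative of
\<open>y - \<Gamma>\<close>. A two-sided derivative at \<open>s = 0\<close> would involve the forcing at negative times, so only
continuity within \<open>S\<close> is required there.\<close>

definition scaled_solves :: "real \<Rightarrow> (real \<Rightarrow> real) \<Rightarrow> real set \<Rightarrow> bool" where
  "scaled_solves \<kappa> y S \<longleftrightarrow> continuous_on S y \<and>
     (\<forall>s\<in>S. s > 0 \<longrightarrow> ((\<lambda>s. y s - \<Gamma> s) has_real_derivative lam - 1 / \<kappa>\<^sup>2 * (y s)\<^sup>2) (at s))"

lemma continuous_\<Gamma>: "continuous_on S \<Gamma>"
  by (rule continuous_on_tail[OF g0])

lemma \<Gamma>_bound: obtains M where "M \<ge> 0" "\<And>s. \<bar>\<Gamma> s\<bar> \<le> M"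
proof -
  obtain M where "\<And>s. \<bar>\<Gamma> s\<bar> \<le> M" using tail_bounded[OF g0] by blast
  then show thesis using that[of M] abs_ge_zero order_trans by blast
qed

text \<open>The constant is irrelevant, as only derivatives of the tail integral enter the equation.\<close>

lemma tail_forcing_scaled:
  assumes \<kappa>: "\<kappa> > 0" obtains c where "\<And>s. s \<ge> 0 \<Longrightarrow> \<kappa> * tail (forcing \<alpha> g \<kappa>) (s / \<kappa>) = \<Gamma> s + c"
proof
  fix s :: real assume s: "s \<ge> 0"
  let ?F = "forcing \<alpha> g \<kappa>"
  have "tail ?F 0 - tail ?F (s / \<kappa>) = integral {0..s / \<kappa>} ?F"
    using tail_diff[OF in_S_forcing[OF \<kappa>], of 0 "s / \<kappa>"] s \<kappa> by simp
  also have "\<dots> = integral {0..s / \<kappa>} (\<lambda>t. g0 (\<kappa> * t))"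
    by (rule integral_cong) (auto simp: forcing_eq[OF \<kappa>])
  finally have "\<kappa> * (tail ?F 0 - tail ?F (s / \<kappa>)) = \<kappa> * integral {0..s / \<kappa>} (\<lambda>t. g0 (\<kappa> * t))" by simp
  also have "\<dots> = integral {\<kappa> * 0..\<kappa> * (s / \<kappa>)} g0"
    by (rule integral_dilation[OF \<kappa> in_S_integrable_on(2)[OF g0]]) simp
  also have "\<dots> = \<Gamma> 0 - \<Gamma> s" using tail_diff[OF g0 s] \<kappa> by simp
  finally show "\<kappa> * tail ?F (s / \<kappa>) = \<Gamma> s + (\<kappa> * tail ?F 0 - \<Gamma> 0)" by (simp add: algebra_simps)
qed

lemma scaled_solves_of_solves:
  assumes \<kappa>: "\<kappa> > 0" and x: "riccati_eq.solves lam (forcing \<alpha> g \<kappa>) x K"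
    and S: "S \<subseteq> {0..}" "\<And>s. s \<in> S \<Longrightarrow> s / \<kappa> \<in> K"
  shows "scaled_solves \<kappa> (\<lambda>s. \<kappa> * x (s / \<kappa>)) S"
proof -
  interpret riccati_eq lam "forcing \<alpha> g \<kappa>" by (rule riccati_eq_forcing[OF \<kappa>])
  obtain c where c: "\<And>s. s \<ge> 0 \<Longrightarrow> \<kappa> * H (s / \<kappa>) = \<Gamma> s + c" using tail_forcing_scaled[OF \<kappa>] by blast
  have "isCont (\<lambda>s. \<kappa> * x (s / \<kappa>)) s" if "s \<in> S" for s
  proof -
    have x': "isCont x (s / \<kappa>)" by (rule solves_isCont[OF x S(2)[OF that]])
    have "isCont (\<lambda>s. s / \<kappa>) s" by (intro continuous_intros) (use \<kappa> in auto)
    from isCont_o2[OF this x'] show ?thesis by (intro continuous_intros)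
  qed
  then have "continuous_on S (\<lambda>s. \<kappa> * x (s / \<kappa>))" by (rule continuous_at_imp_continuous_on[rule_format])
  moreover have "((\<lambda>s. \<kappa> * x (s / \<kappa>) - \<Gamma> s) has_real_derivative lam - 1 / \<kappa>\<^sup>2 * (\<kappa> * x (s / \<kappa>))\<^sup>2) (at s)"
    if s: "s \<in> S" "s > 0" for s
  proof -
    have "((\<lambda>t. x t - H t) has_real_derivative lam - (x (s / \<kappa>))\<^sup>2) (at (s / \<kappa>))"
      using x S(2)[OF s(1)] by (auto simp: solves_def)
    moreover have "((\<lambda>s. s / \<kappa>) has_real_derivative 1 / \<kappa>) (at s)"
      by (rule DERIV_cdivide[OF DERIV_ident])
    ultimately have "((\<lambda>s. x (s / \<kappa>) - H (s / \<kappa>)) has_real_derivative (lam - (x (s / \<kappa>))\<^sup>2) * (1 / \<kappa>)) (at s)"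
      by (rule DERIV_chain2[where g = "\<lambda>s. s / \<kappa>"])
    then have "((\<lambda>s. \<kappa> * (x (s / \<kappa>) - H (s / \<kappa>)) + c) has_real_derivative \<kappa> * ((lam - (x (s / \<kappa>))\<^sup>2) * (1 / \<kappa>)) + 0) (at s)"
      by (intro DERIV_add DERIV_cmult DERIV_const)
    moreover have "\<kappa> * ((lam - (x (s / \<kappa>))\<^sup>2) * (1 / \<kappa>)) + 0 = lam - 1 / \<kappa>\<^sup>2 * (\<kappa> * x (s / \<kappa>))\<^sup>2"
      using \<kappa> by (simp add: field_simps power2_eq_square)
    ultimately have "((\<lambda>s. \<kappa> * (x (s / \<kappa>) - H (s / \<kappa>)) + c) has_real_derivative
        lam - 1 / \<kappa>\<^sup>2 * (\<kappa> * x (s / \<kappa>))\<^sup>2) (at s)"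
      by (simp only:)
    then show ?thesis
    proof (rule has_field_derivative_transform_within_open[where S = "{0<..}"])
      show "\<kappa> * (x (r / \<kappa>) - H (r / \<kappa>)) + c = \<kappa> * x (r / \<kappa>) - \<Gamma> r" if "r \<in> {0<..}" for r
        using c[of r] that by (simp add: algebra_simps)
    qed (use s in auto)
  qed
  ultimately show ?thesis by (auto simp: scaled_solves_def)
qed

lemma scaled_solves_subset: "scaled_solves \<kappa> y S \<Longrightarrow> T \<subseteq> S \<Longrightarrow> scaled_solves \<kappa> y T"
  unfolding scaled_solves_def using continuous_on_subset by blast

lemma persists_scaled:
  assumes "\<kappa> > 0" "persists \<kappa> x0"
  obtains y where "scaled_solves \<kappa> y {0..}" "y 0 = \<kappa> * x0"
proof -
  interpret riccati_eq lam "forcing \<alpha> g \<kappa>" by (rule riccati_eq_forcing[OF assms(1)])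
  obtain x K where x: "solves x K" "{0..} \<subseteq> K" "x 0 = x0" using assms(2) unfolding persists_def global_from_def by blast
  have "scaled_solves \<kappa> (\<lambda>s. \<kappa> * x (s / \<kappa>)) {0..}"
    by (rule scaled_solves_of_solves[OF assms(1) x(1)]) (use x(2) assms(1) in auto)
  then show thesis using that x(3) by force
qed

lemma not_persists_scaled:
  assumes "\<kappa> > 0" "\<not> persists \<kappa> x0"
  obtains y b where "b > 0" "scaled_solves \<kappa> y {0..<b}" "y 0 = \<kappa> * x0" "\<And>m. \<exists>s\<in>{0..<b}. y s < m"
proof -
  interpret riccati_eq lam "forcing \<alpha> g \<kappa>" by (rule riccati_eq_forcing[OF assms(1)])
  obtain x b where x: "b > 0" "solves x {0..<b}" "x 0 = x0" "\<And>m. \<exists>t\<in>{0..<b}. x t < m"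
    using assms(2) escape_from unfolding persists_def by blast
  have "scaled_solves \<kappa> (\<lambda>s. \<kappa> * x (s / \<kappa>)) {0..<\<kappa> * b}"
    by (rule scaled_solves_of_solves[OF assms(1) x(2)]) (use assms(1) in \<open>auto simp: field_simps\<close>)
  moreover have "\<exists>s\<in>{0..<\<kappa> * b}. \<kappa> * x (s / \<kappa>) < m" for m
  proof -
    obtain t where t: "t \<in> {0..<b}" "x t < m / \<kappa>" using x(4) by blast
    then have "\<kappa> * t \<in> {0..<\<kappa> * b}" "\<kappa> * x (\<kappa> * t / \<kappa>) < m" using assms(1) by (auto simp: field_simps)
    then show ?thesis by blast
  qed
  ultimately show thesis using that[of "\<kappa> * b" "\<lambda>s. \<kappa> * x (s / \<kappa>)"] x(1,3) assms(1) by simp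
qed

lemma scaled_solves_compare_sub:
  assumes q: "0 \<le> q" and y: "scaled_solves \<kappa> y {0..q}" and z: "continuous_on {0..q} z"
    "\<And>s. 0 < s \<Longrightarrow> s < q \<Longrightarrow> \<exists>A. ((\<lambda>s. z s - \<Gamma> s) has_real_derivative A) (at s) \<and> A \<le> lam - 1 / \<kappa>\<^sup>2 * (z s)\<^sup>2"
    and le: "z 0 \<le> y 0"
  shows "z q \<le> y q"
  by (rule scaled_comparison[where z = z and w = y and G = \<Gamma> and lam = lam and \<mu> = "1 / \<kappa>\<^sup>2", OF q z(1) _ z(2) _ le])
     (use y in \<open>auto simp: scaled_solves_def intro!: exI\<close>)

lemma scaled_solves_compare_super:
  assumes q: "0 \<le> q" and y: "scaled_solves \<kappa> y {0..q}" and z: "continuous_on {0..q} z"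
    "\<And>s. 0 < s \<Longrightarrow> s < q \<Longrightarrow> \<exists>A. ((\<lambda>s. z s - \<Gamma> s) has_real_derivative A) (at s) \<and> A \<ge> lam - 1 / \<kappa>\<^sup>2 * (z s)\<^sup>2"
    and le: "y 0 \<le> z 0"
  shows "y q \<le> z q"
  by (rule scaled_comparison[where z = y and w = z and G = \<Gamma> and lam = lam and \<mu> = "1 / \<kappa>\<^sup>2", OF q _ z(1) _ z(2) le])
     (use y in \<open>auto simp: scaled_solves_def intro!: exI\<close>)

text \<open>Once \<open>\<Gamma>\<close> is small, the difference \<open>y - \<Gamma>\<close> increases wherever it vanishes.\<close>

lemma scaled_barrier:
  assumes \<kappa>: "\<kappa> > 0" and y: "scaled_solves \<kappa> y {0..<b}" and S: "0 \<le> S" "y S > \<Gamma> S"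
    and small: "\<And>s. s \<ge> S \<Longrightarrow> \<bar>\<Gamma> s\<bar> \<le> \<epsilon>" "\<epsilon>\<^sup>2 < \<kappa>\<^sup>2 * lam" and s: "S \<le> s" "s < b"
  shows "y s \<ge> \<Gamma> s"
proof -
  have "y s - \<Gamma> s \<ge> 0"
  proof (rule barrier_below[where y = "\<lambda>s. y s - \<Gamma> s" and s = S])
    have "continuous_on {S..s} y"
      using y S s unfolding scaled_solves_def by (auto elim!: continuous_on_subset)
    then show "continuous_on {S..s} (\<lambda>s. y s - \<Gamma> s)" by (intro continuous_intros continuous_\<Gamma>)
    fix r assume r: "S < r" "r < s" "y r - \<Gamma> r = 0"
    have "\<bar>y r\<bar> \<le> \<epsilon>" using small(1)[of r] r by simp
    then have "\<bar>y r\<bar>\<^sup>2 \<le> \<epsilon>\<^sup>2" by (intro power_mono) auto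
    then have "(y r)\<^sup>2 < \<kappa>\<^sup>2 * lam" using small(2) by simp
    then have "lam - 1 / \<kappa>\<^sup>2 * (y r)\<^sup>2 > 0" using \<kappa> by (simp add: field_simps)
    moreover have "r \<in> {0..<b}" "r > 0" using r S s by auto
    then have "((\<lambda>s. y s - \<Gamma> s) has_real_derivative lam - 1 / \<kappa>\<^sup>2 * (y r)\<^sup>2) (at r)"
      using y unfolding scaled_solves_def by blast
    ultimately show "\<exists>D>0. ((\<lambda>s. y s - \<Gamma> s) has_real_derivative D) (at r)" by blast
  qed (use S s in auto)
  then show ?thesis by simp
qed

lemma persists_mono: "\<kappa> > 0 \<Longrightarrow> persists \<kappa> x0 \<Longrightarrow> x0 \<le> x1 \<Longrightarrow> persists \<kappa> x1"
  unfolding persists_def using riccati_eq.global_from_mono[OF riccati_eq_forcing] by blast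

text \<open>The rescaled solutions at both rates have the same initial value \<open>\<kappa> x0\<close>, and the one at the larger
rate has the larger right-hand side.\<close>

lemma persists_increase_rate:
  assumes \<kappa>: "0 < \<kappa>" "\<kappa> \<le> \<kappa>'" and p: "persists \<kappa> x0"
  shows "persists \<kappa>' (\<kappa> * x0 / \<kappa>')"
proof (rule ccontr)
  assume np: "\<not> persists \<kappa>' (\<kappa> * x0 / \<kappa>')"
  have \<kappa>': "\<kappa>' > 0" using \<kappa> by simp
  obtain y1 where y1: "scaled_solves \<kappa> y1 {0..}" "y1 0 = \<kappa> * x0" using persists_scaled[OF \<kappa>(1) p] .
  obtain y2 b where y2: "b > 0" "scaled_solves \<kappa>' y2 {0..<b}" "y2 0 = \<kappa>' * (\<kappa> * x0 / \<kappa>')" "\<And>m. \<exists>s\<in>{0..<b}. y2 s < m"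
    using not_persists_scaled[OF \<kappa>' np] by blast
  have c1: "continuous_on {0..c} y1" for c
    using y1(1) unfolding scaled_solves_def by (auto elim!: continuous_on_subset)
  obtain B where B: "\<And>s. s \<in> {0..b} \<Longrightarrow> \<bar>y1 s\<bar> \<le> B" using continuous_on_Icc_bounded[OF c1] by blast
  have "y1 s \<le> y2 s" if s: "s \<in> {0..<b}" for s
  proof (rule scaled_solves_compare_sub[where z = y1 and y = y2 and q = s and \<kappa> = \<kappa>'])
    show "scaled_solves \<kappa>' y2 {0..s}" by (rule scaled_solves_subset[OF y2(2)]) (use s in auto)
    fix r assume r: "0 < r" "r < s"
    have "1 / \<kappa>'\<^sup>2 \<le> 1 / \<kappa>\<^sup>2" using \<kappa> by (intro divide_left_mono power_mono) auto
    then have "1 / \<kappa>'\<^sup>2 * (y1 r)\<^sup>2 \<le> 1 / \<kappa>\<^sup>2 * (y1 r)\<^sup>2" by (rule mult_right_mono) simp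
    moreover have "((\<lambda>s. y1 s - \<Gamma> s) has_real_derivative lam - 1 / \<kappa>\<^sup>2 * (y1 r)\<^sup>2) (at r)"
      using y1(1) r by (auto simp: scaled_solves_def)
    ultimately show "\<exists>A. ((\<lambda>s. y1 s - \<Gamma> s) has_real_derivative A) (at r) \<and> A \<le> lam - 1 / \<kappa>'\<^sup>2 * (y1 r)\<^sup>2"
      by (intro exI[of _ "lam - 1 / \<kappa>\<^sup>2 * (y1 r)\<^sup>2"]) simp
  qed (use s c1 y1(2) y2(3) \<kappa>' in auto)
  moreover obtain s where "s \<in> {0..<b}" "y2 s < - B" using y2(4) by blast
  ultimately show False using B[of s] by (force simp: abs_le_iff)
qed

lemma persists_large_rate:
  assumes "x0 > 0" obtains \<kappa> where "\<kappa> > 0" "persists \<kappa> x0"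
proof -
  obtain M where M: "M \<ge> 0" "\<And>s. \<bar>\<Gamma> s\<bar> \<le> M" using \<Gamma>_bound by blast
  \<comment> \<open>large enough for \<open>\<kappa> x0 > M\<close> and \<open>M\<^sup>2 / \<kappa>\<^sup>2 < lam\<close>\<close>
  define \<kappa> where "\<kappa> = (M + 1) / x0 + (M + 1) / sqrt lam"
  have "(M + 1) / x0 > 0" "(M + 1) / sqrt lam > 0" using M assms lam by simp_all
  then have \<kappa>: "\<kappa> > 0" "(M + 1) / x0 < \<kappa>" "(M + 1) / sqrt lam < \<kappa>" by (auto simp: \<kappa>_def)
  then have k1: "M < \<kappa> * x0" "M < \<kappa> * sqrt lam" using assms lam M by (auto simp: divide_less_eq)
  have "M\<^sup>2 < (\<kappa> * sqrt lam)\<^sup>2" by (rule power_strict_mono[OF k1(2) M(1)]) simp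
  then have k2: "M\<^sup>2 < \<kappa>\<^sup>2 * lam" using lam by (simp add: power_mult_distrib)
  have "persists \<kappa> x0"
  proof (rule ccontr)
    assume "\<not> persists \<kappa> x0"
    then obtain y b where y: "b > 0" "scaled_solves \<kappa> y {0..<b}" "y 0 = \<kappa> * x0" "\<And>m. \<exists>s\<in>{0..<b}. y s < m"
      using not_persists_scaled[OF \<kappa>(1)] by metis
    obtain s where s: "s \<in> {0..<b}" "y s < - M" using y(4) by blast
    have "y 0 > \<Gamma> 0" using k1(1) M(2)[of 0] y(3) by (simp add: abs_le_iff)
    then have "y s \<ge> \<Gamma> s" using scaled_barrier[OF \<kappa>(1) y(2) order_refl _ M(2) k2] s(1) by simp
    then show False using s(2) M(2)[of s] by (simp add: abs_le_iff)
  qed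
  then show thesis using that \<kappa>(1) by blast
qed

end

section \<open>Persistence is an open condition at both ends\<close>

context rate_problem
begin

lemma exponential_derivative:
  "((\<lambda>s. \<eta> * exp (L * s)) has_real_derivative L * (\<eta> * exp (L * s))) (at s)" for \<eta> L s :: real
  by (auto intro!: derivative_eq_intros)

lemma exponential_weight:
  fixes L c S :: real
  assumes "L > 0" "c > 0"
  obtains \<eta> where "\<eta> > 0" "\<And>s. s \<in> {0..S} \<Longrightarrow> \<eta> \<le> \<eta> * exp (L * s) \<and> \<eta> * exp (L * s) \<le> c"
proof
  show "c * exp (- L * S) > 0" using assms by simp
  fix s assume s: "s \<in> {0..S}"
  have "c * exp (- L * S) * 1 \<le> c * exp (- L * S) * exp (L * s)"
    using assms s by (intro mult_left_mono) auto
  moreover have "exp (- L * S) * exp (L * s) \<le> 1"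
    using assms s by (simp add: mult_exp_exp)
  then have "c * (exp (- L * S) * exp (L * s)) \<le> c * 1" using assms by (intro mult_left_mono) auto
  ultimately show "c * exp (- L * S) \<le> c * exp (- L * S) * exp (L * s) \<and> c * exp (- L * S) * exp (L * s) \<le> c"
    by (simp add: mult.assoc)
qed

text \<open>Between \<open>x0\<close> and \<open>a0\<close> there is a surviving solution that tends to \<open>sqrt lam\<close>. Its rescaling \<open>y1\<close>,
lowered by \<open>\<eta> exp (L s)\<close>, is a subsolution at slightly smaller rates up to a time \<open>S\<close>, where it is
still positive and \<open>\<Gamma>\<close> is small. From then on \<open>\<Gamma>\<close> itself is a barrier.\<close>

lemma persists_smaller_rate:
  assumes \<kappa>: "\<kappa> > 0" and p: "persists \<kappa> x0" and x0: "x0 < a0" and a0: "a0 > 0"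
  obtains \<kappa>' where "0 < \<kappa>'" "\<kappa>' < \<kappa>" "persists \<kappa>' a0"
proof -
  let ?k = "sqrt lam"
  have k: "?k > 0" using lam by simp
  define x1 where "x1 = (x0 + a0) / 2"
  have x1: "x0 < x1" "x1 < a0" using x0 by (auto simp: x1_def)
  interpret R: riccati_eq lam "forcing \<alpha> g \<kappa>" by (rule riccati_eq_forcing[OF \<kappa>])
  obtain x K where x: "R.solves x K" "{0..} \<subseteq> K" "x 0 = x1" "(x \<longlongrightarrow> ?k) at_top"
    using R.global_from_above_tendsto[OF _ x1(1)] p unfolding persists_def by blast
  define y1 where "y1 s = \<kappa> * x (s / \<kappa>)" for s
  have y1: "scaled_solves \<kappa> y1 {0..}"
    unfolding y1_def by (rule scaled_solves_of_solves[OF \<kappa> x(1)]) (use x(2) \<kappa> in auto)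
  have y1_0: "y1 0 = \<kappa> * x1" using x(3) by (simp add: y1_def)
  define \<epsilon> where "\<epsilon> = \<kappa> * ?k / 8"
  have \<epsilon>: "\<epsilon> > 0" using \<kappa> k by (simp add: \<epsilon>_def)
  obtain t0 where t0: "\<And>t. t \<ge> t0 \<Longrightarrow> ?k / 2 < x t"
    using order_tendstoD(1)[OF x(4), of "?k / 2"] k unfolding eventually_at_top_linorder by auto
  obtain s0 where s0: "\<And>s. s \<ge> s0 \<Longrightarrow> \<bar>\<Gamma> s\<bar> < \<epsilon>"
    using tendstoD[OF tail_tendsto_0[OF g0] \<epsilon>] unfolding eventually_at_top_linorder by (auto simp: dist_real_def)
  define S where "S = max 1 (max s0 (\<kappa> * t0))"
  have S: "S > 0" "\<And>s. s \<ge> S \<Longrightarrow> \<bar>\<Gamma> s\<bar> \<le> \<epsilon>" using s0 by (force simp: S_def)+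
  have "S / \<kappa> \<ge> t0" using \<kappa> by (simp add: S_def field_simps)
  then have "?k / 2 < x (S / \<kappa>)" by (rule t0)
  then have y1_S: "y1 S > 4 * \<epsilon>" using \<kappa> by (simp add: y1_def \<epsilon>_def field_simps)
  have c1: "continuous_on {0..c} y1" for c
    using y1 unfolding scaled_solves_def by (auto elim!: continuous_on_subset)
  obtain M where M: "\<And>s. s \<in> {0..S} \<Longrightarrow> \<bar>y1 s\<bar> \<le> M" using continuous_on_Icc_bounded[OF c1] by blast
  have M0: "M \<ge> 0" using M[of 0] S by simp
  \<comment> \<open>bounds \<open>1 / \<kappa>'\<^sup>2\<close> for the rates \<open>\<kappa>' \<ge> \<kappa> / 2\<close> considered below\<close>
  define m where "m = 4 / \<kappa>\<^sup>2"
  have m: "m > 0" using \<kappa> by (simp add: m_def)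
  \<comment> \<open>this rate makes \<open>\<delta>' = L \<delta>\<close> dominate the error terms of the shifted function, as \<open>\<delta> \<le> 1\<close>\<close>
  define L where "L = 2 * m * M + m + 1"
  have L0: "L > 0" using m M0 by (simp add: L_def add_nonneg_pos)
  obtain \<eta> where \<eta>: "\<eta> > 0"
    and weight: "\<And>s. s \<in> {0..S} \<Longrightarrow> \<eta> \<le> \<eta> * exp (L * s) \<and> \<eta> * exp (L * s) \<le> min 1 \<epsilon>"
    using exponential_weight[OF L0, of "min 1 \<epsilon>" S] \<epsilon> by auto
  define \<delta> where "\<delta> s = \<eta> * exp (L * s)" for s
  have \<delta>: "\<delta> s \<ge> \<eta>" "\<delta> s \<le> min 1 \<epsilon>" if "s \<in> {0..S}" for s
    using weight[OF that] unfolding \<delta>_def by blast+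
  have "((\<lambda>\<kappa>'. (1 / \<kappa>'\<^sup>2 - 1 / \<kappa>\<^sup>2) * M\<^sup>2) \<longlongrightarrow> (1 / \<kappa>\<^sup>2 - 1 / \<kappa>\<^sup>2) * M\<^sup>2) (at_left \<kappa>)"
    using \<kappa> by (intro tendsto_intros) auto
  then have "eventually (\<lambda>\<kappa>'. (1 / \<kappa>'\<^sup>2 - 1 / \<kappa>\<^sup>2) * M\<^sup>2 < \<eta>) (at_left \<kappa>)"
    by (rule order_tendstoD) (use \<eta> in simp)
  moreover have "((\<lambda>\<kappa>'. \<kappa>' * a0) \<longlongrightarrow> \<kappa> * a0) (at_left \<kappa>)" by (intro tendsto_intros)
  then have "eventually (\<lambda>\<kappa>'. \<kappa> * x1 < \<kappa>' * a0) (at_left \<kappa>)"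
    by (rule order_tendstoD) (use x1(2) \<kappa> in simp)
  moreover have "eventually (\<lambda>\<kappa>'. \<kappa>' \<in> {\<kappa> / 2<..<\<kappa>}) (at_left \<kappa>)"
    using \<kappa> by (intro eventually_at_left_real) simp
  ultimately have "eventually (\<lambda>\<kappa>'. (1 / \<kappa>'\<^sup>2 - 1 / \<kappa>\<^sup>2) * M\<^sup>2 < \<eta> \<and> \<kappa> * x1 < \<kappa>' * a0 \<and> \<kappa>' \<in> {\<kappa> / 2<..<\<kappa>}) (at_left \<kappa>)"
    by eventually_elim simp
  then obtain \<kappa>' where k': "(1 / \<kappa>'\<^sup>2 - 1 / \<kappa>\<^sup>2) * M\<^sup>2 < \<eta>" "\<kappa> * x1 < \<kappa>' * a0" "\<kappa> / 2 < \<kappa>'" "\<kappa>' < \<kappa>"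
    using eventually_happens'[of "at_left \<kappa>"] by fastforce
  have \<kappa>': "\<kappa>' > 0" using k' \<kappa> by simp
  define \<mu> where "\<mu> = 1 / \<kappa>'\<^sup>2"
  have "(\<kappa> / 2)\<^sup>2 \<le> \<kappa>'\<^sup>2" using k' \<kappa> by (intro power_mono) auto
  then have \<mu>: "\<mu> > 0" "\<mu> \<le> m" using \<kappa> \<kappa>' by (auto simp: \<mu>_def m_def field_simps)
  have "1 / \<kappa>\<^sup>2 \<le> \<mu>" unfolding \<mu>_def using k' \<kappa> \<kappa>' by (intro divide_left_mono power_mono) auto
  then have dm: "0 \<le> \<mu> - 1 / \<kappa>\<^sup>2" by simp
  have "persists \<kappa>' a0"
  proof (rule ccontr)
    assume np: "\<not> persists \<kappa>' a0"
    obtain y2 b where y2: "b > 0" "scaled_solves \<kappa>' y2 {0..<b}" "y2 0 = \<kappa>' * a0" "\<And>m. \<exists>s\<in>{0..<b}. y2 s < m"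
      using not_persists_scaled[OF \<kappa>' np] by blast
    have low: "y1 s - \<delta> s \<le> y2 s" if s: "s \<in> {0..<b}" "s \<le> S" for s
    proof (rule scaled_solves_compare_sub[where z = "\<lambda>s. y1 s - \<delta> s" and y = y2 and q = s and \<kappa> = \<kappa>'])
      show "scaled_solves \<kappa>' y2 {0..s}" by (rule scaled_solves_subset[OF y2(2)]) (use s in auto)
      show "continuous_on {0..s} (\<lambda>s. y1 s - \<delta> s)" unfolding \<delta>_def by (intro continuous_intros c1)
      show "y1 0 - \<delta> 0 \<le> y2 0" using y1_0 y2(3) k'(2) \<delta>(1)[of 0] \<eta> S by simp
      fix r assume r: "0 < r" "r < s"
      then have rS: "r \<in> {0..S}" using s by simp
      define Y D where "Y = y1 r" and "D = \<delta> r"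
      have D: "\<eta> \<le> D" "D \<le> 1" "D > 0" using \<delta>[OF rS] \<eta> by (auto simp: D_def)
      have Y: "\<bar>Y\<bar> \<le> M" unfolding Y_def by (rule M[OF rS])
      have "((\<lambda>s. y1 s - \<Gamma> s) has_real_derivative lam - 1 / \<kappa>\<^sup>2 * Y\<^sup>2) (at r)"
        using y1 r by (auto simp: scaled_solves_def Y_def)
      moreover have "(\<delta> has_real_derivative L * D) (at r)"
        unfolding \<delta>_def[abs_def] D_def by (rule exponential_derivative)
      ultimately have "((\<lambda>s. (y1 s - \<Gamma> s) - \<delta> s) has_real_derivative lam - 1 / \<kappa>\<^sup>2 * Y\<^sup>2 - L * D) (at r)"
        by (rule DERIV_diff)
      then have d: "((\<lambda>s. y1 s - \<delta> s - \<Gamma> s) has_real_derivative lam - 1 / \<kappa>\<^sup>2 * Y\<^sup>2 - L * D) (at r)"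
        by (simp add: algebra_simps)
      have "(\<mu> - 1 / \<kappa>\<^sup>2) * Y\<^sup>2 \<le> (\<mu> - 1 / \<kappa>\<^sup>2) * M\<^sup>2"
        using Y dm M0 by (intro mult_left_mono) (auto simp: abs_le_square_iff[symmetric])
      also have "\<dots> \<le> D" using k'(1) D(1) by (simp add: \<mu>_def)
      finally have e1: "(\<mu> - 1 / \<kappa>\<^sup>2) * Y\<^sup>2 \<le> D" .
      have "- (\<mu> * Y * D) \<le> \<mu> * M * D"
        using Y \<mu> D mult_left_mono[of "- Y" M "\<mu> * D"] by (simp add: abs_le_iff mult_ac)
      also have "\<dots> \<le> m * M * D" using \<mu> M0 D by (intro mult_right_mono) auto
      finally have e2: "- (\<mu> * Y * D) \<le> m * M * D" .
      have "\<mu> * D\<^sup>2 \<le> m * D"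
      proof -
        have "\<mu> * (D * D) \<le> m * (1 * D)" using \<mu> D m by (intro mult_mono) auto
        then show ?thesis by (simp add: power2_eq_square)
      qed
      then have "lam - 1 / \<kappa>\<^sup>2 * Y\<^sup>2 - L * D \<le> lam - \<mu> * (Y - D)\<^sup>2"
        using e1 e2 by (simp add: L_def algebra_simps power2_eq_square)
      then show "\<exists>A. ((\<lambda>s. y1 s - \<delta> s - \<Gamma> s) has_real_derivative A) (at r) \<and> A \<le> lam - 1 / \<kappa>'\<^sup>2 * (y1 r - \<delta> r)\<^sup>2"
        using d unfolding \<mu>_def Y_def D_def by blast
    qed (use s in auto)
    have "- (M + 1) - \<epsilon> \<le> y2 s" if s: "s \<in> {0..<b}" for s
    proof (cases "s \<le> S")
      case True
      then have "s \<in> {0..S}" using s by simp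
      then show ?thesis using low[OF s True] M[of s] \<delta>(2)[of s] \<epsilon> by (simp add: abs_le_iff)
    next
      case False
      then have Sb: "S \<in> {0..<b}" "S \<in> {0..S}" using s S by auto
      have "y2 S > \<Gamma> S"
        using low[OF Sb(1)] y1_S \<delta>(2)[OF Sb(2)] S(2)[of S] by (simp add: abs_le_iff)
      moreover have "\<epsilon>\<^sup>2 < \<kappa>'\<^sup>2 * lam"
      proof -
        have "\<kappa> / 2 * ?k < \<kappa>' * ?k" using k'(3) k by simp
        moreover have "\<epsilon> < \<kappa> / 2 * ?k" using \<kappa> k by (simp add: \<epsilon>_def)
        ultimately have "\<epsilon> < \<kappa>' * ?k" by linarith
        then have "\<epsilon>\<^sup>2 < (\<kappa>' * ?k)\<^sup>2" using \<epsilon> by (intro power_strict_mono) auto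
        then show ?thesis using lam by (simp add: power_mult_distrib)
      qed
      ultimately have "y2 s \<ge> \<Gamma> s"
        using scaled_barrier[where S = S and \<epsilon> = \<epsilon> and s = s, OF \<kappa>' y2(2) _ _ S(2)] S(1) False s by simp
      then show ?thesis using S(2)[of s] False M0 by (simp add: abs_le_iff)
    qed
    moreover obtain s where "s \<in> {0..<b}" "y2 s < - (M + 1) - \<epsilon>" using y2(4) by blast
    ultimately show False by force
  qed
  then show thesis using that \<kappa>' k'(4) by blast
qed

text \<open>The escaping rescaled solution \<open>y1\<close>, raised by \<open>\<eta> exp (L s)\<close>, is a supersolution at slightly larger
rates up to a time \<open>S\<close> at which it is below the bound that every surviving solution obeys.\<close>

lemma not_persists_larger_rate:
  assumes \<kappa>: "\<kappa> > 0" and np: "\<not> persists \<kappa> a0"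
  obtains \<kappa>' where "\<kappa> < \<kappa>'" "\<not> persists \<kappa>' a0"
proof -
  let ?k = "sqrt lam"
  have k: "?k > 0" using lam by simp
  obtain y1 b where y1: "b > 0" "scaled_solves \<kappa> y1 {0..<b}" "y1 0 = \<kappa> * a0" "\<And>m. \<exists>s\<in>{0..<b}. y1 s < m"
    using not_persists_scaled[OF \<kappa> np] by blast
  obtain \<Sigma> where \<Sigma>: "\<Sigma> \<ge> 0" "\<And>s. \<bar>\<Gamma> s\<bar> \<le> \<Sigma>" using \<Gamma>_bound by blast
  \<comment> \<open>at rates up to \<open>2 \<kappa>\<close>, surviving rescaled solutions stay above \<open>- B\<close>\<close>
  define B where "B = 3 * \<Sigma> + 4 * \<kappa> * ?k + 1"
  obtain S where S: "S \<in> {0..<b}" "y1 S < - B - 1" using y1(4) by blast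
  have c1: "continuous_on {0..c} y1" if "c < b" for c
    using y1(2) that unfolding scaled_solves_def by (auto elim!: continuous_on_subset)
  have "continuous_on {0..S} y1" using S by (intro c1) simp
  then obtain M where M: "\<And>s. s \<in> {0..S} \<Longrightarrow> \<bar>y1 s\<bar> \<le> M" using continuous_on_Icc_bounded by blast
  have M0: "M \<ge> 0" using M[of 0] S by simp
  define m where "m = 1 / \<kappa>\<^sup>2"
  have m: "m > 0" using \<kappa> by (simp add: m_def)
  \<comment> \<open>this rate makes \<open>\<delta>' = L \<delta>\<close> dominate the error terms of the shifted function\<close>
  define L where "L = 2 * m * M + 1"
  have L0: "L > 0" using m M0 by (simp add: L_def add_nonneg_pos)
  obtain \<eta> where \<eta>: "\<eta> > 0"
    and weight: "\<And>s. s \<in> {0..S} \<Longrightarrow> \<eta> \<le> \<eta> * exp (L * s) \<and> \<eta> * exp (L * s) \<le> 1"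
    using exponential_weight[OF L0, of "1" S] by auto
  define \<delta> where "\<delta> s = \<eta> * exp (L * s)" for s
  have \<delta>: "\<delta> s \<ge> \<eta>" "\<delta> s \<le> 1" if "s \<in> {0..S}" for s
    using weight[OF that] unfolding \<delta>_def by blast+
  have "((\<lambda>\<kappa>'. (1 / \<kappa>\<^sup>2 - 1 / \<kappa>'\<^sup>2) * M\<^sup>2) \<longlongrightarrow> (1 / \<kappa>\<^sup>2 - 1 / \<kappa>\<^sup>2) * M\<^sup>2) (at_right \<kappa>)"
    using \<kappa> by (intro tendsto_intros) auto
  then have "eventually (\<lambda>\<kappa>'. (1 / \<kappa>\<^sup>2 - 1 / \<kappa>'\<^sup>2) * M\<^sup>2 < \<eta>) (at_right \<kappa>)"
    by (rule order_tendstoD) (use \<eta> in simp)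
  moreover have "((\<lambda>\<kappa>'. \<kappa>' * a0) \<longlongrightarrow> \<kappa> * a0) (at_right \<kappa>)" by (intro tendsto_intros)
  then have "eventually (\<lambda>\<kappa>'. \<kappa>' * a0 < \<kappa> * a0 + \<eta>) (at_right \<kappa>)"
    by (rule order_tendstoD) (use \<eta> in simp)
  moreover have "eventually (\<lambda>\<kappa>'. \<kappa>' \<in> {\<kappa><..<2 * \<kappa>}) (at_right \<kappa>)"
    using \<kappa> by (intro eventually_at_right_real) simp
  ultimately have "eventually (\<lambda>\<kappa>'. (1 / \<kappa>\<^sup>2 - 1 / \<kappa>'\<^sup>2) * M\<^sup>2 < \<eta> \<and> \<kappa>' * a0 < \<kappa> * a0 + \<eta> \<and> \<kappa>' \<in> {\<kappa><..<2 * \<kappa>}) (at_right \<kappa>)"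
    by eventually_elim simp
  then obtain \<kappa>' where k': "(1 / \<kappa>\<^sup>2 - 1 / \<kappa>'\<^sup>2) * M\<^sup>2 < \<eta>" "\<kappa>' * a0 < \<kappa> * a0 + \<eta>" "\<kappa> < \<kappa>'" "\<kappa>' < 2 * \<kappa>"
    using eventually_happens'[of "at_right \<kappa>"] by fastforce
  have \<kappa>': "\<kappa>' > 0" using k' \<kappa> by simp
  define \<mu> where "\<mu> = 1 / \<kappa>'\<^sup>2"
  have \<mu>: "\<mu> > 0" using \<kappa>' by (simp add: \<mu>_def)
  have \<mu>m: "\<mu> \<le> m" unfolding \<mu>_def m_def using k' \<kappa> \<kappa>' by (intro divide_left_mono power_mono) auto
  have "\<not> persists \<kappa>' a0"
  proof
    assume p: "persists \<kappa>' a0"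
    obtain y2 where y2: "scaled_solves \<kappa>' y2 {0..}" "y2 0 = \<kappa>' * a0" using persists_scaled[OF \<kappa>' p] by blast
    have "y2 S \<le> y1 S + \<delta> S"
    proof (rule scaled_solves_compare_super[where z = "\<lambda>s. y1 s + \<delta> s" and y = y2 and q = S and \<kappa> = \<kappa>'])
      show "0 \<le> S" using S by simp
      show "scaled_solves \<kappa>' y2 {0..S}" by (rule scaled_solves_subset[OF y2(1)]) auto
      show "continuous_on {0..S} (\<lambda>s. y1 s + \<delta> s)" unfolding \<delta>_def using S by (intro continuous_intros c1) simp
      show "y2 0 \<le> y1 0 + \<delta> 0" using y1(3) y2(2) k'(2) \<delta>(1)[of 0] S by simp
      fix r assume r: "0 < r" "r < S"
      then have rS: "r \<in> {0..S}" by simp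
      define Y D where "Y = y1 r" and "D = \<delta> r"
      have D: "\<eta> \<le> D" "D > 0" using \<delta>[OF rS] \<eta> by (auto simp: D_def)
      have Y: "\<bar>Y\<bar> \<le> M" unfolding Y_def by (rule M[OF rS])
      have "r \<in> {0..<b}" using r S by simp
      then have "((\<lambda>s. y1 s - \<Gamma> s) has_real_derivative lam - m * Y\<^sup>2) (at r)"
        using y1(2) r(1) unfolding scaled_solves_def Y_def m_def by blast
      moreover have "(\<delta> has_real_derivative L * D) (at r)"
        unfolding \<delta>_def[abs_def] D_def by (rule exponential_derivative)
      ultimately have "((\<lambda>s. (y1 s - \<Gamma> s) + \<delta> s) has_real_derivative lam - m * Y\<^sup>2 + L * D) (at r)"
        by (rule DERIV_add)
      then have d: "((\<lambda>s. y1 s + \<delta> s - \<Gamma> s) has_real_derivative lam - m * Y\<^sup>2 + L * D) (at r)"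
        by (simp add: algebra_simps)
      have "(m - \<mu>) * Y\<^sup>2 \<le> (m - \<mu>) * M\<^sup>2"
        using Y \<mu>m M0 by (intro mult_left_mono) (auto simp: abs_le_square_iff[symmetric])
      also have "\<dots> \<le> D" using k'(1) D(1) by (simp add: \<mu>_def m_def)
      finally have e1: "(m - \<mu>) * Y\<^sup>2 \<le> D" .
      have "- (\<mu> * Y * D) \<le> \<mu> * M * D"
        using Y \<mu> D mult_left_mono[of "- Y" M "\<mu> * D"] by (simp add: abs_le_iff mult_ac)
      also have "\<dots> \<le> m * M * D" using \<mu>m M0 D by (intro mult_right_mono) auto
      finally have e2: "- (\<mu> * Y * D) \<le> m * M * D" .
      have "\<mu> * D\<^sup>2 \<ge> 0" using \<mu> by simp
      then have "lam - m * Y\<^sup>2 + L * D \<ge> lam - \<mu> * (Y + D)\<^sup>2"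
        using e1 e2 by (simp add: L_def algebra_simps power2_eq_square)
      then show "\<exists>A. ((\<lambda>s. y1 s + \<delta> s - \<Gamma> s) has_real_derivative A) (at r) \<and> A \<ge> lam - 1 / \<kappa>'\<^sup>2 * (y1 r + \<delta> r)\<^sup>2"
        using d unfolding \<mu>_def Y_def D_def by blast
    qed
    then have "y2 S < - B" using S \<delta>(2)[of S] by simp
    moreover have "y2 S - \<Gamma> S \<ge> - (2 * \<Sigma> + 2 * sqrt (lam / \<mu>) + 1)"
    proof (rule riccati_forward_lower_bound[where Y = "\<lambda>s. y2 s - \<Gamma> s" and G = \<Gamma> and s = 0])
      show "continuous_on {0..} (\<lambda>s. y2 s - \<Gamma> s)"
        using y2(1) unfolding scaled_solves_def by (intro continuous_intros continuous_\<Gamma>) simp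
      show "((\<lambda>s. y2 s - \<Gamma> s) has_real_derivative lam - \<mu> * ((y2 t - \<Gamma> t) + \<Gamma> t)\<^sup>2) (at t)" if "t > 0" for t
        using y2(1) that by (simp add: scaled_solves_def \<mu>_def)
    qed (use \<mu> lam \<Sigma> S in auto)
    moreover have "lam / \<mu> = (\<kappa>' * ?k)\<^sup>2" using lam \<kappa>' by (simp add: \<mu>_def power_mult_distrib)
    then have "sqrt (lam / \<mu>) = \<kappa>' * ?k" using \<kappa>' k by simp
    moreover have "\<kappa>' * ?k \<le> 2 * \<kappa> * ?k" using k'(4) k by (intro mult_right_mono) auto
    ultimately show False using \<Sigma>(2)[of S] by (simp add: B_def abs_le_iff)
  qed
  then show thesis using that k'(3) by blast
qed

end

section \<open>The critical rate\<close>

context rate_problem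
begin

lemma solves_negative_half_line:
  assumes \<kappa>: "\<kappa> > 0" "\<kappa>' > 0" and x: "riccati_eq.solves lam (forcing \<alpha> g \<kappa>) x {..<0}"
  shows "riccati_eq.solves lam (forcing \<alpha> g \<kappa>') x {..<0}"
proof -
  let ?F = "forcing \<alpha> g \<kappa>" and ?F' = "forcing \<alpha> g \<kappa>'"
  interpret R: riccati_eq lam ?F by (rule riccati_eq_forcing[OF \<kappa>(1)])
  interpret R': riccati_eq lam ?F' by (rule riccati_eq_forcing[OF \<kappa>(2)])
  define c where "c = tail ?F 0 - tail ?F' 0"
  have c: "tail ?F' t = tail ?F t - c" if "t \<le> 0" for t
  proof -
    have "integral {t..0} ?F = integral {t..0} ?F'" by (rule integral_cong) (auto simp: forcing_def)
    then show ?thesis using tail_diff[OF R.h that] tail_diff[OF R'.h that] by (simp add: c_def)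
  qed
  show ?thesis unfolding R'.solves_def
  proof
    fix t :: real assume t: "t \<in> {..<0}"
    then have "((\<lambda>t. x t - tail ?F t) has_real_derivative lam - (x t)\<^sup>2) (at t)"
      using x by (simp add: R.solves_def)
    then have "((\<lambda>t. (x t - tail ?F t) + c) has_real_derivative lam - (x t)\<^sup>2 + 0) (at t)"
      by (intro DERIV_add DERIV_const)
    then have "((\<lambda>t. (x t - tail ?F t) + c) has_real_derivative lam - (x t)\<^sup>2) (at t)" by simp
    then show "((\<lambda>t. x t - tail ?F' t) has_real_derivative lam - (x t)\<^sup>2) (at t)"
      by (rule has_field_derivative_transform_within_open[where S = "{..<0}"]) (use t c in auto)
  qed
qed

text \<open>On the negative half-line the equations for the two rates coincide, and a solution is determined
there by its convergence to \<open>sqrt lam\<close> at minus infinity.\<close>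

lemma attractor_independent_of_rate:
  assumes \<kappa>: "\<kappa> > 0" "\<kappa>' > 0" and u: "riccati_upper lam (forcing \<alpha> g \<kappa>) a I" and zero: "0 \<in> I"
    and u': "riccati_upper lam (forcing \<alpha> g \<kappa>') a' I'"
  shows "0 \<in> I'" "a' 0 = a 0"
proof -
  interpret U: riccati_upper lam "forcing \<alpha> g \<kappa>" a I by (rule u)
  interpret U': riccati_upper lam "forcing \<alpha> g \<kappa>'" a' I' by (rule u')
  have I0: "{..0} \<subseteq> I" by (rule U.I_Iic[OF zero])
  have "U.solves a {..<0}" by (rule U.solves_subset[OF U.a(1)]) (use I0 in auto)
  then have sol: "U'.solves a {..<0}" by (rule solves_negative_half_line[OF \<kappa>])
  have eq: "a' s = a s" if "s \<in> I'" "s < 0" for s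
    by (rule U'.tendsto_k_at_bot_unique[OF U'.a(1) U'.I_Iic[OF that(1)] U'.a(3) sol _ U.a(3)]) (use that in auto)
  have conta: "isCont a t" if "t \<le> 0" for t using U.solves_isCont[OF U.a(1)] I0 that by auto
  show zero': "0 \<in> I'"
  proof (rule ccontr)
    assume n: "0 \<notin> I'"
    then have I': "bdd_above I'" "I' = {..<Sup I'}" using U'.I_cases by auto
    let ?b = "Sup I'"
    have b0: "?b \<le> 0" using n by (subst (asm) I'(2)) simp
    have "(a \<longlongrightarrow> a ?b) (at_left ?b)" using conta[OF b0] by (simp add: isCont_def filterlim_at_split)
    then have "eventually (\<lambda>t. a ?b - 1 < a t) (at_left ?b)" by (rule order_tendstoD) simp
    moreover have "eventually (\<lambda>t. t \<in> {?b - 1<..<?b}) (at_left ?b)" by (rule eventually_at_left_real) simp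
    ultimately have "eventually (\<lambda>t. a ?b - 1 \<le> a' t) (at_left ?b)"
    proof eventually_elim
      case (elim t)
      have "t \<in> I'" by (subst I'(2)) (use elim in simp)
      then show ?case using eq[of t] elim b0 by simp
    qed
    then show False using filterlim_at_bot_not_bounded_below[of a' "at_left ?b"] U'.a(2) I'(1)
      by (auto simp: blows_up_def)
  qed
  have "(a \<longlongrightarrow> a 0) (at_left 0)" using conta[of 0] by (simp add: isCont_def filterlim_at_split)
  moreover have "eventually (\<lambda>t. t \<in> {- 1<..<0}) (at_left (0::real))" by (rule eventually_at_left_real) simp
  then have "eventually (\<lambda>t. a t = a' t) (at_left 0)"
  proof eventually_elim
    case (elim t)
    then have "t \<in> I'" using U'.I_Iic[OF zero'] by auto
    then show ?case using eq[of t] elim by simp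
  qed
  ultimately have "(a' \<longlongrightarrow> a 0) (at_left 0)" by (rule Lim_transform_eventually)
  moreover have "isCont a' 0" by (rule U'.solves_isCont[OF U'.a(1) zero'])
  then have "(a' \<longlongrightarrow> a' 0) (at_left 0)" by (simp add: isCont_def filterlim_at_split)
  ultimately show "a' 0 = a 0" by (intro tendsto_unique[of "at_left (0::real)" a']) auto
qed

lemma riccati_pair_exists:
  assumes \<kappa>: "\<kappa> > 0" and \<kappa>0: "\<kappa>0 > 0" and u: "upper_solution (rhs lam \<alpha> g \<kappa>0) a0 I0" "0 \<in> I0"
  obtains a I r J where "riccati_pair lam (forcing \<alpha> g \<kappa>) a I r J" "a 0 = a0 0"
proof -
  interpret R0: riccati_eq lam "forcing \<alpha> g \<kappa>0" by (rule riccati_eq_forcing[OF \<kappa>0])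
  interpret R: riccati_eq lam "forcing \<alpha> g \<kappa>" by (rule riccati_eq_forcing[OF \<kappa>])
  obtain b K where b: "riccati_upper lam (forcing \<alpha> g \<kappa>0) b K" using R0.pullback_attractor_exists by blast
  have b0: "0 \<in> K" "a0 0 = b 0"
    using riccati_upper.upper_solution_unique[OF b] u by (auto simp: rhs_eq_riccati)
  obtain a I where a: "riccati_upper lam (forcing \<alpha> g \<kappa>) a I" using R.pullback_attractor_exists by blast
  obtain r J where r: "riccati_lower lam (forcing \<alpha> g \<kappa>) r J" using R.repelling_locale_exists by blast
  note ind = attractor_independent_of_rate[OF \<kappa>0 \<kappa> b b0(1) a]
  have "riccati_pair lam (forcing \<alpha> g \<kappa>) a I r J"
    unfolding riccati_pair_def riccati_pair_axioms_def using a r ind(1) by simp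
  then show thesis using that ind(2) b0(2) by simp
qed

lemma case_A_not_case_B: "case_A lam \<alpha> g \<kappa> \<Longrightarrow> \<not> case_B lam \<alpha> g \<kappa>"
  unfolding case_A_def case_B_def hyperbolic_def by blast

end

context riccati_pair
begin

lemma global_from_attractor_iff_solution: "global_from (a 0) \<longleftrightarrow> (\<exists>b. solution f b UNIV)"
proof
  assume "global_from (a 0)"
  then have "I = UNIV" using attractor_global by simp
  then have "solution f a UNIV" using a(1) by (simp add: solution_iff)
  then show "\<exists>b. solution f b UNIV" by blast
qed (use global_from_attractor_if_solution in blast)

end

theorem corollary3p13:
  fixes lam \<kappa>1 :: real and \<alpha> g :: "real \<Rightarrow> real"
  assumes "lam > 0"
    and "in_S UNIV \<alpha>"
    and "in_S {0..} g"
    and "\<exists>\<kappa>>0. \<exists>a I. upper_solution (rhs lam \<alpha> g \<kappa>) a I \<and> 0 \<in> I \<and> a 0 > 0"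
    and "\<kappa>1 > 0"
    and "case_C lam \<alpha> g \<kappa>1"
  shows "\<exists>!\<kappa>bar. \<kappa>bar > \<kappa>1 \<and>
           (\<forall>\<kappa>>\<kappa>bar. case_A lam \<alpha> g \<kappa>) \<and>
           case_B lam \<alpha> g \<kappa>bar \<and>
           (\<forall>\<kappa>. 0 < \<kappa> \<and> \<kappa> < \<kappa>bar \<longrightarrow> case_C lam \<alpha> g \<kappa>)"
proof -
  interpret rate_problem lam \<alpha> g by unfold_locales (fact assms(1-3))+
  obtain \<kappa>0 aa II where \<kappa>0: "\<kappa>0 > 0" and u: "upper_solution (rhs lam \<alpha> g \<kappa>0) aa II" "0 \<in> II" "aa 0 > 0"
    using assms(4) by blast
  define a0 where "a0 = aa 0"
  have a0: "a0 > 0" using u(3) by (simp add: a0_def)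
  have A: "case_A lam \<alpha> g \<kappa>" if \<kappa>: "\<kappa> > 0" and p: "persists \<kappa> x0" "x0 < a0" for \<kappa> x0
  proof -
    obtain a I r J where rp: "riccati_pair lam (forcing \<alpha> g \<kappa>) a I r J" "a 0 = aa 0"
      using riccati_pair_exists[OF \<kappa> \<kappa>0 u(1,2)] .
    interpret P: riccati_pair lam "forcing \<alpha> g \<kappa>" a I r J by (rule rp(1))
    show ?thesis
      using P.hyperbolic_case[of x0] p rp(2) P.a(3) P.r(3)
      unfolding case_A_def rhs_eq_riccati persists_def a0_def by auto
  qed
  have B: "case_B lam \<alpha> g \<kappa>" if \<kappa>: "\<kappa> > 0" and p: "persists \<kappa> a0" "\<And>x0. x0 < a0 \<Longrightarrow> \<not> persists \<kappa> x0" for \<kappa>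
  proof -
    obtain a I r J where rp: "riccati_pair lam (forcing \<alpha> g \<kappa>) a I r J" "a 0 = aa 0"
      using riccati_pair_exists[OF \<kappa> \<kappa>0 u(1,2)] .
    interpret P: riccati_pair lam "forcing \<alpha> g \<kappa>" a I r J by (rule rp(1))
    have "P.global_from (a 0)" "\<And>x0. x0 < a 0 \<Longrightarrow> \<not> P.global_from x0"
      using p rp(2) by (auto simp: persists_def a0_def)
    from P.nonhyperbolic_case[OF this] show ?thesis
      using P.a(3) unfolding case_B_def rhs_eq_riccati by blast
  qed
  have C: "case_C lam \<alpha> g \<kappa>" if \<kappa>: "\<kappa> > 0" and p: "\<not> persists \<kappa> a0" for \<kappa>
  proof -
    obtain a I r J where rp: "riccati_pair lam (forcing \<alpha> g \<kappa>) a I r J" "a 0 = aa 0"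
      using riccati_pair_exists[OF \<kappa> \<kappa>0 u(1,2)] .
    interpret P: riccati_pair lam "forcing \<alpha> g \<kappa>" a I r J by (rule rp(1))
    have "\<not> P.global_from (a 0)" using p rp(2) by (auto simp: persists_def a0_def)
    from P.escape_case[OF this] show ?thesis unfolding case_C_def rhs_eq_riccati by blast
  qed
  have np1: "\<not> persists \<kappa>1 a0"
  proof -
    obtain a I r J where rp: "riccati_pair lam (forcing \<alpha> g \<kappa>1) a I r J" "a 0 = aa 0"
      using riccati_pair_exists[OF assms(5) \<kappa>0 u(1,2)] .
    interpret P: riccati_pair lam "forcing \<alpha> g \<kappa>1" a I r J by (rule rp(1))
    show ?thesis
      using assms(6) P.global_from_attractor_iff_solution rp(2)
      unfolding case_C_def rhs_eq_riccati persists_def a0_def by simp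
  qed
  have up: "persists \<kappa>' a0" if "0 < \<kappa>" "\<kappa> \<le> \<kappa>'" "persists \<kappa> a0" for \<kappa> \<kappa>'
  proof (rule persists_mono[OF _ persists_increase_rate[OF that]])
    show "\<kappa> * a0 / \<kappa>' \<le> a0" using that(1,2) a0 by (simp add: field_simps)
  qed (use that in simp)
  define N where "N = {\<kappa>. \<kappa> > 0 \<and> \<not> persists \<kappa> a0}"
  have N1: "\<kappa>1 \<in> N" using assms(5) np1 by (simp add: N_def)
  obtain K where K: "K > 0" "persists K a0" using persists_large_rate[OF a0] .
  have bN: "bdd_above N"
  proof (rule bdd_aboveI[of _ K])
    fix \<kappa> assume "\<kappa> \<in> N"
    then show "\<kappa> \<le> K" using up[OF K(1) _ K(2), of \<kappa>] by (cases "\<kappa> \<le> K") (auto simp: N_def)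
  qed
  define \<kappa>b where "\<kappa>b = Sup N"
  have upper: "\<kappa> \<le> \<kappa>b" if "\<kappa> \<in> N" for \<kappa> unfolding \<kappa>b_def by (rule cSup_upper[OF that bN])
  have pos: "\<kappa>b > 0" using upper[OF N1] assms(5) by simp
  have pb: "persists \<kappa>b a0"
  proof (rule ccontr)
    assume "\<not> persists \<kappa>b a0"
    then obtain \<kappa>' where "\<kappa>b < \<kappa>'" "\<not> persists \<kappa>' a0" using not_persists_larger_rate[OF pos] by blast
    then show False using upper[of \<kappa>'] pos by (simp add: N_def)
  qed
  have below: "\<not> persists \<kappa> a0" if \<kappa>: "0 < \<kappa>" "\<kappa> < \<kappa>b" for \<kappa>
  proof
    assume p: "persists \<kappa> a0"
    have "N \<noteq> {}" using N1 by blast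
    from less_cSupD[OF this \<kappa>(2)[unfolded \<kappa>b_def]] obtain \<kappa>' where "\<kappa>' \<in> N" "\<kappa> < \<kappa>'" by blast
    then show False using up[OF \<kappa>(1) _ p, of \<kappa>'] by (simp add: N_def)
  qed
  have strict: "\<not> persists \<kappa>b x0" if x0: "x0 < a0" for x0
  proof
    assume "persists \<kappa>b x0"
    then obtain \<kappa>' where "0 < \<kappa>'" "\<kappa>' < \<kappa>b" "persists \<kappa>' a0"
      using persists_smaller_rate[OF pos _ x0 a0] by blast
    then show False using below by blast
  qed
  have above: "case_A lam \<alpha> g \<kappa>" if "\<kappa> > \<kappa>b" for \<kappa>
  proof (rule A)
    show "persists \<kappa> (\<kappa>b * a0 / \<kappa>)" by (rule persists_increase_rate[OF pos _ pb]) (use that in simp)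
    show "\<kappa>b * a0 / \<kappa> < a0" using that pos a0 by (simp add: field_simps)
  qed (use that pos in simp)
  have "\<kappa>1 \<noteq> \<kappa>b" using np1 pb by blast
  then have gt: "\<kappa>b > \<kappa>1" using upper[OF N1] by simp
  show ?thesis
  proof (rule ex1I[of _ \<kappa>b])
    show "\<kappa>b > \<kappa>1 \<and> (\<forall>\<kappa>>\<kappa>b. case_A lam \<alpha> g \<kappa>) \<and> case_B lam \<alpha> g \<kappa>b \<and>
       (\<forall>\<kappa>. 0 < \<kappa> \<and> \<kappa> < \<kappa>b \<longrightarrow> case_C lam \<alpha> g \<kappa>)"
      using gt above B[OF pos pb strict] C below by blast
    fix \<kappa> assume \<kappa>: "\<kappa> > \<kappa>1 \<and> (\<forall>\<kappa>'>\<kappa>. case_A lam \<alpha> g \<kappa>') \<and> case_B lam \<alpha> g \<kappa> \<and>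
       (\<forall>\<kappa>'. 0 < \<kappa>' \<and> \<kappa>' < \<kappa> \<longrightarrow> case_C lam \<alpha> g \<kappa>')"
    show "\<kappa> = \<kappa>b"
    proof (rule linorder_cases[of \<kappa> \<kappa>b])
      assume "\<kappa> < \<kappa>b"
      then have "case_A lam \<alpha> g \<kappa>b" using \<kappa> by blast
      then show ?thesis using case_A_not_case_B B[OF pos pb strict] by blast
    next
      assume "\<kappa> > \<kappa>b"
      then show ?thesis using above case_A_not_case_B \<kappa> by blast
    qed
  qed
qed

end
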